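(* Let $\varphi_p: A_S\to A_{S'}$ be an LCM-homomorphism. Then $\varphi_p$ is compatible with the normal form: if $(g_1,\ldots,g_n)$ is the normal form of $g\in A_S^+$, then $(\varphi_p(g_1),\ldots,\varphi_p(g_n))$ is the normal form of $\varphi_p(g)$.
   Context: Artin-Tits systems. Let $S$ be a finite set and $M=(m_{s,t})_{s,t\in S}$ a symmetric matrix with entries in $(\mathbb{N}\setminus\{0\})\cup\{\infty\}$, with $m_{s,s}=1$ and $m_{s,t}\neq 1$ for $s\ne t$. For elements $u,v$ and $m\in\mathbb{N}$ put $[u,v\rangle^m=\underbrace{uvu\cdots}_{m\text{ terms}}$. The Artin-Tits group is $A_S=\langle S\mid [s,t\rangle^{m_{s,t}}=[t,s\rangle^{m_{s,t}},\ s\neq t\in S,\ m_{s,t}\neq\infty\rangle$; the pair $(A_S,S)$ is called an Artin-Tits system. $A_S^+$ is the submonoid of $A_S$ generated by $S$ (it has the same presentation, as a monoid). The Coxeter group $W_S$ is obtained from the presentation of $A_S$ by adding the relations $s^2=1$, $s\in S$. For $T\subset S$, $A_T$ is the subgroup generated by $T$; $(A_T,T)$ is the Artin-Tits system of the matrix $(m_{s,t})_{s,t\in T}$. $T$ (or $A_T$) is of spherical type if $W_T$ is finite. For $u,v\in A_S^+$, $u\prec v$ means that $u$ divides $v$ on the left in $A_S^+$; $u\vee_\prec v$ denotes the least common multiple of $u,v$ for $\prec$ (it is $\infty$ if it does not exist). If $T\subset S$ is of spherical type, $\Delta_T\in A_S^+$ denotes the least common multiple of $T$ for $\prec$. LCM-homomorphism.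 Let $p$ be a map from $S$ to the set of nonempty subsets of $S'$ such that: (L0) if $s\neq t\in S$, then $p(s)\cap p(t)=\emptyset$; (L1) for $s\in S$, $p(s)$ is of spherical type; (L2) if $s\neq t\in S$ and $m_{s,t}\neq\infty$, then $[\Delta_{p(s)},\Delta_{p(t)}\rangle^{m_{s,t}}=[\Delta_{p(t)},\Delta_{p(s)}\rangle^{m_{s,t}}=\Delta_{p(s)}\vee_\prec\Delta_{p(t)}$ in $A_{S'}^+$; (L3) if $s\neq t\in S$ and $m_{s,t}=\infty$, then for every $u\in p(s)$ the set $\{u\}\cup p(t)$ is not of spherical type, and for every $u\in p(t)$ the set $\{u\}\cup p(s)$ is not of spherical type. Then $\varphi_p(s)=\Delta_{p(s)}$ ($s\in S$) defines a homomorphism $\varphi_p:A_S\to A_{S'}$; a homomorphism obtained in this way is called an LCM-homomorphism. It maps $A_S^+$ into $A_{S'}^+$. Normal form. An element of $A_S^+$ is reduced if none of its expressions as a word in $S$ contains a square $ss$ of an element $s\in S$ as a factor; $A_{S,red}\subset A_S^+$ is the set of reduced elements. For $g\in A_S^+$ the set $\{h\in A_{S,red}\mid h\prec g\}$ has a greatest element for $\prec$, denoted $\alpha(g)$. The normal form of $g\in A_S^+$ is the unique sequence $(g_1,\ldots,g_n)$ with $g=g_1\cdots g_n$, no $g_i$ equal to $1$, and $g_i=\alpha(g_i\cdots g_n)$ for all $i$. *)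

theory Defs
  imports "HOL-Algebra.Divisibility" "HOL-Library.Extended_Nat"
begin

section \<open>Groups given by generators and relations\<close>

text \<open>A letter \<open>(s, True)\<close> stands for the generator \<open>s\<close> and \<open>(s, False)\<close> for its formal inverse.\<close>

type_synonym 'a signed_word = "('a \<times> bool) list"

definition pos_word :: "'a list \<Rightarrow> 'a signed_word" where
  "pos_word w = map (\<lambda>s. (s, True)) w"

inductive_set presentation_cong ::
    "'a set \<Rightarrow> ('a signed_word \<times> 'a signed_word) set \<Rightarrow> ('a signed_word \<times> 'a signed_word) set"
  for X :: "'a set" and R :: "('a signed_word \<times> 'a signed_word) set"
where
  refl: "w \<in> lists (X \<times> UNIV) \<Longrightarrow> (w, w) \<in> presentation_cong X R"
| sym: "(v, w) \<in> presentation_cong X R \<Longrightarrow> (w, v) \<in> presentation_cong X R"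
| trans: "\<lbrakk>(u, v) \<in> presentation_cong X R; (v, w) \<in> presentation_cong X R\<rbrakk>
    \<Longrightarrow> (u, w) \<in> presentation_cong X R"
| cancel: "\<lbrakk>s \<in> X; x \<in> lists (X \<times> UNIV); y \<in> lists (X \<times> UNIV)\<rbrakk>
    \<Longrightarrow> (x @ [(s, b), (s, \<not> b)] @ y, x @ y) \<in> presentation_cong X R"
| relation: "\<lbrakk>(u, v) \<in> R; u \<in> lists (X \<times> UNIV); v \<in> lists (X \<times> UNIV);
      x \<in> lists (X \<times> UNIV); y \<in> lists (X \<times> UNIV)\<rbrakk>
    \<Longrightarrow> (x @ u @ y, x @ v @ y) \<in> presentation_cong X R"

definition presented_group ::
    "'a set \<Rightarrow> ('a signed_word \<times> 'a signed_word) set \<Rightarrow> 'a signed_word set monoid" where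
  "presented_group X R =
     \<lparr>carrier = lists (X \<times> UNIV) // presentation_cong X R,
      mult = (\<lambda>A B. \<Union>a\<in>A. \<Union>b\<in>B. presentation_cong X R `` {a @ b}),
      one = presentation_cong X R `` {[]}\<rparr>"

inductive_set generated_submonoid :: "('g, 'm) monoid_scheme \<Rightarrow> 'g set \<Rightarrow> 'g set"
  for G :: "('g, 'm) monoid_scheme" (structure) and H :: "'g set"
where
  one: "\<one> \<in> generated_submonoid G H"
| incl: "h \<in> H \<Longrightarrow> h \<in> generated_submonoid G H"
| mult: "\<lbrakk>x \<in> generated_submonoid G H; y \<in> generated_submonoid G H\<rbrakk>
    \<Longrightarrow> x \<otimes> y \<in> generated_submonoid G H"

definition list_prod :: "('g, 'm) monoid_scheme \<Rightarrow> 'g list \<Rightarrow> 'g" where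
  "list_prod G xs = foldr (\<lambda>x y. x \<otimes>\<^bsub>G\<^esub> y) xs \<one>\<^bsub>G\<^esub>"

text \<open>The alternating word \<open>s t s \<dots>\<close> with \<open>n\<close> letters; its product is \<open>[s, t\<rangle>\<^sup>n\<close>.\<close>

primrec alt_list :: "'a \<Rightarrow> 'a \<Rightarrow> nat \<Rightarrow> 'a list" where
  "alt_list s t 0 = []"
| "alt_list s t (Suc n) = s # alt_list t s n"

definition alt_prod :: "('g, 'm) monoid_scheme \<Rightarrow> 'g \<Rightarrow> 'g \<Rightarrow> nat \<Rightarrow> 'g" where
  "alt_prod G u v n = list_prod G (alt_list u v n)"


section \<open>Artin-Tits systems\<close>

definition coxeter_matrix :: "'s set \<Rightarrow> ('s \<Rightarrow> 's \<Rightarrow> enat) \<Rightarrow> bool" where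
  "coxeter_matrix S m \<longleftrightarrow> finite S \<and>
     (\<forall>s\<in>S. \<forall>t\<in>S. m s t = m t s \<and> m s t \<noteq> 0 \<and> (m s t = 1 \<longleftrightarrow> s = t))"

definition braid_relations ::
    "'s set \<Rightarrow> ('s \<Rightarrow> 's \<Rightarrow> enat) \<Rightarrow> ('s signed_word \<times> 's signed_word) set" where
  "braid_relations S m =
     {(pos_word (alt_list s t (the_enat (m s t))), pos_word (alt_list t s (the_enat (m s t))))
      | s t. s \<in> S \<and> t \<in> S \<and> s \<noteq> t \<and> m s t \<noteq> \<infinity>}"

definition artin_group :: "'s set \<Rightarrow> ('s \<Rightarrow> 's \<Rightarrow> enat) \<Rightarrow> 's signed_word set monoid" where
  "artin_group S m = presented_group S (braid_relations S m)"

definition coxeter_group :: "'s set \<Rightarrow> ('s \<Rightarrow> 's \<Rightarrow> enat) \<Rightarrow> 's signed_word set monoid" where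
  "coxeter_group S m =
     presented_group S (braid_relations S m \<union> {(pos_word [s, s], []) | s. s \<in> S})"

definition artin_gen :: "'s set \<Rightarrow> ('s \<Rightarrow> 's \<Rightarrow> enat) \<Rightarrow> 's \<Rightarrow> 's signed_word set" where
  "artin_gen S m s = presentation_cong S (braid_relations S m) `` {pos_word [s]}"

text \<open>The submonoid \<open>A\<^sub>S\<^sup>+\<close> as a monoid of its own, so that \<open>u divides v\<close> in it
  (which in HOL-Algebra means \<open>v = u \<otimes> c\<close> for some \<open>c\<close> in the carrier) is \<open>u \<prec> v\<close>.\<close>

definition artin_monoid :: "'s set \<Rightarrow> ('s \<Rightarrow> 's \<Rightarrow> enat) \<Rightarrow> 's signed_word set monoid" where
  "artin_monoid S m =
     (artin_group S m)
       \<lparr>carrier := generated_submonoid (artin_group S m) (artin_gen S m ` S)\<rparr>"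

text \<open>\<open>W\<^sub>T\<close> is the Coxeter group of the restricted matrix.\<close>

definition spherical :: "'s set \<Rightarrow> ('s \<Rightarrow> 's \<Rightarrow> enat) \<Rightarrow> 's set \<Rightarrow> bool" where
  "spherical S m T \<longleftrightarrow> T \<subseteq> S \<and> finite (carrier (coxeter_group T m))"

definition is_left_lcm :: "('g, 'm) monoid_scheme \<Rightarrow> 'g set \<Rightarrow> 'g \<Rightarrow> bool" where
  "is_left_lcm G X v \<longleftrightarrow> v \<in> carrier G \<and> (\<forall>x\<in>X. x divides\<^bsub>G\<^esub> v) \<and>
     (\<forall>w\<in>carrier G. (\<forall>x\<in>X. x divides\<^bsub>G\<^esub> w) \<longrightarrow> v divides\<^bsub>G\<^esub> w)"

definition artin_Delta :: "'s set \<Rightarrow> ('s \<Rightarrow> 's \<Rightarrow> enat) \<Rightarrow> 's set \<Rightarrow> 's signed_word set" where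
  "artin_Delta S m T = (THE v. is_left_lcm (artin_monoid S m) (artin_gen S m ` T) v)"


section \<open>LCM-homomorphisms\<close>

definition lcm_map :: "'s set \<Rightarrow> ('s \<Rightarrow> 's \<Rightarrow> enat) \<Rightarrow> 't set \<Rightarrow> ('t \<Rightarrow> 't \<Rightarrow> enat)
    \<Rightarrow> ('s \<Rightarrow> 't set) \<Rightarrow> bool" where
  "lcm_map S m S' m' p \<longleftrightarrow>
     (\<forall>s\<in>S. p s \<noteq> {} \<and> p s \<subseteq> S') \<and>
     (\<forall>s\<in>S. \<forall>t\<in>S. s \<noteq> t \<longrightarrow> p s \<inter> p t = {}) \<and>
     (\<forall>s\<in>S. spherical S' m' (p s)) \<and>
     (\<forall>s\<in>S. \<forall>t\<in>S. s \<noteq> t \<and> m s t \<noteq> \<infinity> \<longrightarrow>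
        (let M = artin_monoid S' m'; u = artin_Delta S' m' (p s); v = artin_Delta S' m' (p t);
             n = the_enat (m s t)
         in alt_prod M u v n = alt_prod M v u n \<and> is_left_lcm M {u, v} (alt_prod M u v n))) \<and>
     (\<forall>s\<in>S. \<forall>t\<in>S. s \<noteq> t \<and> m s t = \<infinity> \<longrightarrow>
        (\<forall>u\<in>p s. \<not> spherical S' m' (insert u (p t))) \<and>
        (\<forall>u\<in>p t. \<not> spherical S' m' (insert u (p s))))"

text \<open>These conditions determine \<open>\<phi>\<close> on the carrier, because the generators generate \<open>A\<^sub>S\<close>.\<close>

definition lcm_homomorphism :: "'s set \<Rightarrow> ('s \<Rightarrow> 's \<Rightarrow> enat) \<Rightarrow> 't set \<Rightarrow> ('t \<Rightarrow> 't \<Rightarrow> enat)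
    \<Rightarrow> ('s \<Rightarrow> 't set) \<Rightarrow> ('s signed_word set \<Rightarrow> 't signed_word set) \<Rightarrow> bool" where
  "lcm_homomorphism S m S' m' p \<phi> \<longleftrightarrow> lcm_map S m S' m' p \<and>
     \<phi> \<in> hom (artin_group S m) (artin_group S' m') \<and>
     (\<forall>s\<in>S. \<phi> (artin_gen S m s) = artin_Delta S' m' (p s))"


section \<open>Normal form\<close>

definition reduced_elements :: "'s set \<Rightarrow> ('s \<Rightarrow> 's \<Rightarrow> enat) \<Rightarrow> 's signed_word set set" where
  "reduced_elements S m = {g \<in> carrier (artin_monoid S m).
     \<forall>w\<in>lists S. list_prod (artin_monoid S m) (map (artin_gen S m) w) = g \<longrightarrow>
       \<not> (\<exists>x s y. w = x @ [s, s] @ y)}"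

text \<open>\<open>is_alpha S m g a\<close> says \<open>a = \<alpha>(g)\<close>; a greatest element is unique since \<open>A\<^sub>S\<^sup>+\<close> is
  cancellative without nontrivial units.\<close>

definition is_alpha :: "'s set \<Rightarrow> ('s \<Rightarrow> 's \<Rightarrow> enat) \<Rightarrow> 's signed_word set
    \<Rightarrow> 's signed_word set \<Rightarrow> bool" where
  "is_alpha S m g a \<longleftrightarrow>
     (let M = artin_monoid S m; D = {h \<in> reduced_elements S m. h divides\<^bsub>M\<^esub> g}
      in a \<in> D \<and> (\<forall>h\<in>D. h divides\<^bsub>M\<^esub> a))"

definition normal_form :: "'s set \<Rightarrow> ('s \<Rightarrow> 's \<Rightarrow> enat) \<Rightarrow> 's signed_word set
    \<Rightarrow> 's signed_word set list \<Rightarrow> bool" where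
  "normal_form S m g gs \<longleftrightarrow>
     (let M = artin_monoid S m
      in set gs \<subseteq> carrier M \<and> list_prod M gs = g \<and> \<one>\<^bsub>M\<^esub> \<notin> set gs \<and>
         (\<forall>i<length gs. is_alpha S m (list_prod M (drop i gs)) (gs ! i)))"

end

(* Coxeter groups: an LCM-map sends reduced words to reduced words, and the left (right) descents of
   the image of w are the union of the p(s) over the left (right) descents s of w. Hence it preserves
   the local condition "every left descent of g_(i+1) is a right descent of g_i", which the factors
   of a normal form satisfy.

   Artin groups: if reduced g_1, ..., g_n satisfy this local condition, then every reduced h with
   h c = g_1 ... g_n in the Artin group, c positive, divides g_1. As divisibility is taken inside the
   group, this is essentially Paris' theorem that Artin monoids embed in their groups. The Coxeter
   matrix is unfolded to a triangle-free one with entries 2 and 3, where the Krammer-Paris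
   representation on the span of the positive roots exists; its operators are invertible for x <> 0,
   and at x = 0 they become nonnegative matrices, whose supports force the inversions of h to be
   inversions of g_1. *)

theory Submission
  imports Defs Complex_Main
begin

text \<open>\<open>artin_monoid\<close> lies inside the Artin group, so two positive words may be
  equal through words with inverse letters. The handle on such an equality is an action by
  bijections (\<open>artin_action\<close>), and every invariant is read off one: the length of a
  positive word from translations of the integers, its Coxeter element from reflections,
  divisibility from the operators \<open>K\<close>. Their entries are continuous in
  \<open>x\<close>, which carries identities from nonzero \<open>x\<close>, where the group acts, to
  \<open>x = 0\<close>, where the combinatorics is visible. The recursion for the coefficients
  \<open>H\<close> picks a descent of a root; independence of this choice is a computation in rank
  3, where without triangles only A1 x A1 x A1, A1 x A2 and A3 occur. This is why the matrix is
  unfolded. Perron weights make the projection from the unfolding equivariant and sign-preserving,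
  so that descents and reduced words transfer. Matsumoto's theorem is proved for an arbitrary
  relation, so that one induction serves the Artin group, the Coxeter presentation, the unfolding
  and the operators.\<close>

locale coxeter_system =
  fixes S :: "'s set" and m :: "'s \<Rightarrow> 's \<Rightarrow> enat"
  assumes coxeter: "coxeter_matrix S m"
begin

lemma finite_S: "finite S"
  using coxeter by (simp add: coxeter_matrix_def)

lemma m_sym: "s \<in> S \<Longrightarrow> t \<in> S \<Longrightarrow> m s t = m t s"
  using coxeter by (simp add: coxeter_matrix_def)

lemma m_self: "s \<in> S \<Longrightarrow> m s s = 1"
  using coxeter by (simp add: coxeter_matrix_def)

lemma m_ge_2:
  assumes "s \<in> S" "t \<in> S" "s \<noteq> t" "m s t \<noteq> \<infinity>"
  shows "the_enat (m s t) \<ge> 2"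
proof -
  obtain n where n: "m s t = enat n" using assms(4) by auto
  have "m s t \<noteq> 0" "m s t \<noteq> 1"
    using coxeter assms unfolding coxeter_matrix_def by blast+
  then have "n \<noteq> 0" "n \<noteq> 1"
    using n by (simp_all add: zero_enat_def one_enat_def)
  then show ?thesis using n by simp
qed

subsection \<open>The reflection representation\<close>

text \<open>\<open>e s\<close> is the simple root of \<open>s\<close> and \<open>ip s v\<close> is \<open>2 B(e s, v)\<close> for the Tits form \<open>B\<close>;
  the formula for \<open>kk\<close> covers \<open>s = t\<close>, as \<open>m s s = 1\<close>.\<close>

definition kk :: "'s \<Rightarrow> 's \<Rightarrow> real" where
  "kk s t = (if m s t = \<infinity> then 2 else 2 * cos (pi / real (the_enat (m s t))))"

definition ip :: "'s \<Rightarrow> ('s \<Rightarrow> real) \<Rightarrow> real" where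
  "ip s v = - (\<Sum>t\<in>S. kk s t * v t)"

definition sg :: "'s \<Rightarrow> ('s \<Rightarrow> real) \<Rightarrow> ('s \<Rightarrow> real)" where
  "sg s v = v(s := v s - ip s v)"

definition act :: "'s list \<Rightarrow> ('s \<Rightarrow> real) \<Rightarrow> ('s \<Rightarrow> real)" where
  "act w v = foldr sg w v"

definition e :: "'s \<Rightarrow> 's \<Rightarrow> real" where
  "e s = (\<lambda>t. if t = s then 1 else 0)"

definition nn :: "('s \<Rightarrow> real) \<Rightarrow> bool" where
  "nn v \<longleftrightarrow> (\<forall>t. v t \<ge> 0)"

lemma kk_sym: "s \<in> S \<Longrightarrow> t \<in> S \<Longrightarrow> kk s t = kk t s"
  by (simp add: kk_def m_sym)

lemma kk_self: "s \<in> S \<Longrightarrow> kk s s = -2"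
  by (simp add: kk_def m_self one_enat_def)

lemma act_Nil [simp]: "act [] v = v"
  by (simp add: act_def)

lemma act_Cons [simp]: "act (s # w) v = sg s (act w v)"
  by (simp add: act_def)

lemma act_append [simp]: "act (u @ w) v = act u (act w v)"
  by (simp add: act_def)

lemma ip_lin: "ip s (\<lambda>x. a * u x + b * v x) = a * ip s u + b * ip s v"
  by (simp add: ip_def sum.distrib sum_distrib_left algebra_simps)

lemma refl_lin: "sg s (\<lambda>x. a * u x + b * v x) = (\<lambda>x. a * sg s u x + b * sg s v x)"
  by (auto simp: sg_def ip_lin algebra_simps fun_eq_iff)

lemma act_lin: "act w (\<lambda>x. a * u x + b * v x) = (\<lambda>x. a * act w u x + b * act w v x)"
  by (induction w) (simp_all add: refl_lin)

lemma act_uminus: "act w (\<lambda>x. - v x) = (\<lambda>x. - act w v x)"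
  using act_lin[of w "-1" v 0 v] by simp

lemma act_sum:
  assumes "finite T"
  shows "act w (\<lambda>x. \<Sum>t\<in>T. c t * f t x) = (\<lambda>x. \<Sum>t\<in>T. c t * act w (f t) x)"
  using assms
proof (induction T rule: finite_induct)
  case empty
  show ?case using act_lin[of w 0 "\<lambda>_. 0" 0 "\<lambda>_. 0"] by simp
next
  case (insert a T)
  have "act w (\<lambda>x. c a * f a x + 1 * (\<Sum>t\<in>T. c t * f t x)) =
      (\<lambda>x. c a * act w (f a) x + 1 * act w (\<lambda>x. \<Sum>t\<in>T. c t * f t x) x)"
    by (rule act_lin)
  with insert show ?case by simp
qed

lemma e_same [simp]: "e s s = 1"
  by (simp add: e_def)

lemma e_other [simp]: "t \<noteq> s \<Longrightarrow> e s t = 0"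
  by (simp add: e_def)

lemma e_inj: "e s = e t \<longleftrightarrow> s = t"
  by (metis e_other e_same zero_neq_one)

lemma ip_e: "t \<in> S \<Longrightarrow> ip s (e t) = - kk s t"
  unfolding ip_def e_def using finite_S by (simp add: if_distrib cong: if_cong)

lemma ip_e_self [simp]: "s \<in> S \<Longrightarrow> ip s (e s) = 2"
  by (simp add: ip_e kk_self)

lemma refl_as: "sg s v = (\<lambda>x. 1 * v x + (- ip s v) * e s x)"
  by (auto simp: sg_def e_def)

lemma ip_refl: "s \<in> S \<Longrightarrow> ip t (sg s v) = ip t v + kk t s * ip s v"
  unfolding refl_as ip_lin by (simp add: ip_e)

lemma ip_refl_self [simp]: "s \<in> S \<Longrightarrow> ip s (sg s v) = - ip s v"
  by (simp add: ip_refl kk_self)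

lemma refl_refl [simp]: "s \<in> S \<Longrightarrow> sg s (sg s v) = v"
  by (rule ext) (simp add: sg_def[of s "sg s v"], simp add: sg_def)

lemma refl_e_self: "s \<in> S \<Longrightarrow> sg s (e s) = (\<lambda>x. - e s x)"
  by (rule ext) (use ip_e_self[of s] in \<open>auto simp: sg_def simp del: ip_e_self\<close>)

lemma act_rev_act [simp]: "w \<in> lists S \<Longrightarrow> act (rev w) (act w v) = v"
  by (induction w arbitrary: v) auto

lemma act_act_rev [simp]: "w \<in> lists S \<Longrightarrow> act w (act (rev w) v) = v"
  using act_rev_act[of "rev w" v] by (simp add: in_lists_conv_set)

lemma bij_refl: "s \<in> S \<Longrightarrow> bij (sg s)"
  by (rule o_bij[of "sg s"]) auto

lemma act_outside: "w \<in> lists T \<Longrightarrow> x \<notin> T \<Longrightarrow> act w v x = v x"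
  by (induction w) (auto simp: sg_def)

definition bil :: "('s \<Rightarrow> real) \<Rightarrow> ('s \<Rightarrow> real) \<Rightarrow> real" where
  "bil u v = (\<Sum>s\<in>S. u s * ip s v)"

lemma bil_sym: "bil u v = bil v u"
proof -
  have "bil u v = - (\<Sum>s\<in>S. \<Sum>t\<in>S. u s * kk s t * v t)"
    unfolding bil_def ip_def by (simp add: sum_distrib_left sum_negf mult.assoc)
  also have "\<dots> = - (\<Sum>t\<in>S. \<Sum>s\<in>S. u s * kk s t * v t)"
    by (subst sum.swap) simp
  also have "\<dots> = - (\<Sum>t\<in>S. \<Sum>s\<in>S. v t * kk t s * u s)"
    by (intro arg_cong[where f = uminus] sum.cong HOL.refl) (simp add: kk_sym)
  also have "\<dots> = bil v u"
    unfolding bil_def ip_def by (simp add: sum_distrib_left sum_negf mult.assoc)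
  finally show ?thesis .
qed

lemma bil_e: "s \<in> S \<Longrightarrow> bil (e s) v = ip s v"
  unfolding bil_def e_def using finite_S by (simp add: if_distrib[of "\<lambda>x. x * _"] cong: if_cong)

lemma bil_lin: "bil (\<lambda>x. a * u x + b * v x) z = a * bil u z + b * bil v z"
  by (simp add: bil_def sum.distrib sum_distrib_left algebra_simps)

lemma bil_refl:
  assumes "s \<in> S" shows "bil (sg s u) (sg s v) = bil u v"
proof -
  have *: "bil (sg s u) w = bil u w - ip s u * ip s w" for u w
    unfolding refl_as bil_lin using assms by (simp add: bil_e)
  have "bil u (sg s v) = bil u v - ip s v * ip s u"
    using *[of v u] by (simp add: bil_sym)
  then show ?thesis using assms by (simp add: *)
qed

lemma bil_act: "w \<in> lists S \<Longrightarrow> bil (act w u) (act w v) = bil u v"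
  by (induction w) (auto simp: bil_refl)

lemma refl_conj:
  assumes "w \<in> lists S" "s \<in> S" "t \<in> S" "act w (e s) = e t"
  shows "sg t (act w v) = act w (sg s v)"
proof -
  have "ip t (act w v) = ip s v"
    using bil_act[OF assms(1), of "e s" v] assms by (simp add: bil_e)
  then show ?thesis
    unfolding refl_as act_lin using assms(4) by simp
qed

lemma nn_e [simp]: "nn (e s)"
  by (simp add: nn_def e_def)

lemma nn_lin: "nn u \<Longrightarrow> nn v \<Longrightarrow> a \<ge> 0 \<Longrightarrow> b \<ge> 0 \<Longrightarrow> nn (\<lambda>x. a * u x + b * v x)"
  by (simp add: nn_def)

lemma act_e_nonzero:
  assumes "w \<in> lists S" "s \<in> S"
  shows "\<exists>x. act w (e s) x \<noteq> 0"
proof (rule ccontr)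
  assume "\<nexists>x. act w (e s) x \<noteq> 0"
  then have "act w (e s) = (\<lambda>x. 0)" by auto
  then have "bil (act w (e s)) (act w (e s)) = 0"
    by (simp add: bil_def)
  then show False using assms by (simp add: bil_act bil_e)
qed

lemma not_nn_both:
  assumes "w \<in> lists S" "s \<in> S" "nn (act w (e s))"
  shows "\<not> nn (\<lambda>x. - act w (e s) x)"
  using act_e_nonzero[OF assms(1,2)] assms(3) unfolding nn_def
  by (metis neg_0_le_iff_le order_antisym)

subsection \<open>Dihedral computations\<close>

text \<open>The Chebyshev polynomial of the second kind U_(n-1) at cos(pi / m), with its value n at
  1 for m infinite: the coefficients of the roots of the dihedral subsystem.\<close>

definition sin_ratio :: "'s \<Rightarrow> 's \<Rightarrow> nat \<Rightarrow> real" where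
  "sin_ratio s t n = (if m s t = \<infinity> then real n
     else sin (real n * (pi / real (the_enat (m s t)))) / sin (pi / real (the_enat (m s t))))"

lemma sin_pos_m:
  assumes "s \<in> S" "t \<in> S" "s \<noteq> t" "m s t \<noteq> \<infinity>"
  shows "sin (pi / real (the_enat (m s t))) > 0"
proof (rule sin_gt_zero)
  have "the_enat (m s t) \<ge> 2" by (rule m_ge_2[OF assms])
  then show "0 < pi / real (the_enat (m s t))" "pi / real (the_enat (m s t)) < pi"
    by (auto simp: field_simps)
qed

lemma U_0 [simp]: "sin_ratio s t 0 = 0"
  by (simp add: sin_ratio_def)

lemma U_1: "s \<in> S \<Longrightarrow> t \<in> S \<Longrightarrow> s \<noteq> t \<Longrightarrow> sin_ratio s t (Suc 0) = 1"
  using sin_pos_m[of s t] by (cases "m s t") (auto simp: sin_ratio_def)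

lemma U_rec: "sin_ratio s t (Suc (Suc n)) = kk s t * sin_ratio s t (Suc n) - sin_ratio s t n"
proof (cases "m s t = \<infinity>")
  case True
  then show ?thesis by (simp add: sin_ratio_def kk_def)
next
  case False
  then obtain N where N: "m s t = enat N" by auto
  define h where "h = pi / real N"
  have "sin (real (Suc (Suc n)) * h) = sin (real (Suc n) * h + h)"
       "sin (real n * h) = sin (real (Suc n) * h - h)"
    by (simp_all add: algebra_simps)
  then have *: "sin (real (Suc (Suc n)) * h) = 2 * cos h * sin (real (Suc n) * h) - sin (real n * h)"
    by (simp add: sin_add sin_diff)
  have sin_ratio: "sin_ratio s t j = sin (real j * h) / sin h" for j by (simp add: sin_ratio_def N h_def)
  have k: "kk s t = 2 * cos h" by (simp add: kk_def N h_def)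
  show ?thesis
    unfolding sin_ratio k * by (simp add: diff_divide_distrib)
qed

lemma U_nonneg:
  assumes "s \<in> S" "t \<in> S" "s \<noteq> t" "enat n \<le> m s t"
  shows "sin_ratio s t n \<ge> 0"
proof (cases "m s t = \<infinity>")
  case True
  then show ?thesis by (simp add: sin_ratio_def)
next
  case False
  have "the_enat (m s t) \<ge> 2" using m_ge_2[OF assms(1-3) False] .
  moreover have "n \<le> the_enat (m s t)" using assms(4) False by auto
  ultimately have "real n * (pi / real (the_enat (m s t))) \<le> pi"
    by (simp add: field_simps)
  then have "sin (real n * (pi / real (the_enat (m s t)))) \<ge> 0"
    by (intro sin_ge_zero) auto
  then show ?thesis
    using False sin_pos_m[OF assms(1-3) False] by (simp add: sin_ratio_def)
qed

text \<open>At n = m the angle is pi, and sin(pi - h) = sin h. This is how the finite value of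
  \<open>m s t\<close> enters the braid relation.\<close>

lemma U_end:
  assumes "s \<in> S" "t \<in> S" "s \<noteq> t" "m s t = enat (Suc n)"
  shows "sin_ratio s t (Suc n) = 0" "sin_ratio s t n = 1"
proof -
  have n: "n \<ge> 1" using m_ge_2[OF assms(1-3)] assms(4) by simp
  have "real n * pi / (1 + real n) = pi - pi / (1 + real n)"
    by (simp add: field_simps)
  then have "sin (real n * pi / (1 + real n)) = sin (pi / (1 + real n))"
    by (simp only: sin_pi_minus)
  moreover have "real (Suc n) * (pi / real (Suc n)) = pi" by simp
  ultimately show "sin_ratio s t (Suc n) = 0" "sin_ratio s t n = 1"
    using sin_pos_m[OF assms(1-3)] assms(4) unfolding sin_ratio_def
    by (simp_all only: enat.simps if_False the_enat.simps sin_pi) (simp_all add: ac_simps)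
qed

lemma rev_alt_list: "rev (alt_list s t (Suc n)) = (if even n then s else t) # rev (alt_list s t n)"
proof (induction n arbitrary: s t)
  case (Suc n)
  have "rev (alt_list s t (Suc (Suc n))) = rev (alt_list t s (Suc n)) @ [s]" by simp
  also have "\<dots> = (if even n then t else s) # rev (alt_list t s n) @ [s]"
    by (subst Suc.IH) simp
  finally show ?case by simp
qed simp

lemma rev_alt: "rev (alt_list s t n) = (if even n then alt_list t s n else alt_list s t n)"
proof (induction n)
  case (Suc n)
  show ?case unfolding rev_alt_list Suc by simp
qed simp

lemma set_alt_list: "set (alt_list s t n) \<subseteq> {s, t}"
  by (induction n arbitrary: s t) auto

lemma alt_list_lists [simp]: "s \<in> T \<Longrightarrow> t \<in> T \<Longrightarrow> alt_list s t n \<in> lists T"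
  using set_alt_list[of s t n] by auto

lemma length_alt_list [simp]: "length (alt_list s t n) = n"
  by (induction n arbitrary: s t) auto

lemma alt_list_add: "alt_list s t (n + k) =
    alt_list s t n @ (if even n then alt_list s t k else alt_list t s k)"
  by (induction n arbitrary: s t) auto

lemma dihedral_e:
  assumes "s \<in> S" "t \<in> S" "s \<noteq> t"
  shows "act (rev (alt_list t s n)) (e s) =
    (\<lambda>x. (if even n then sin_ratio s t (Suc n) else sin_ratio s t n) * e s x
       + (if even n then sin_ratio s t n else sin_ratio s t (Suc n)) * e t x)"
proof (induction n)
  case 0
  show ?case using assms by (simp add: U_1)
next
  case (Suc n)
  let ?v = "act (rev (alt_list t s n)) (e s)"
  have k: "kk t s = kk s t" using assms by (simp add: kk_sym)
  show ?case
  proof (cases "even n")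
    case True
    have v: "?v = (\<lambda>x. sin_ratio s t (Suc n) * e s x + sin_ratio s t n * e t x)"
      using Suc True by simp
    have "ip t ?v = sin_ratio s t (Suc n) * - kk s t + sin_ratio s t n * 2"
      unfolding v ip_lin using assms k by (simp add: ip_e kk_self)
    then have ipv: "ip t ?v = 2 * sin_ratio s t n - kk s t * sin_ratio s t (Suc n)" by simp
    have "act (rev (alt_list t s (Suc n))) (e s) =
       (\<lambda>x. sin_ratio s t (Suc n) * e s x + (kk s t * sin_ratio s t (Suc n) - sin_ratio s t n) * e t x)"
      unfolding rev_alt_list using True
      by (simp only: if_True act_Cons refl_as[of t] ipv) (simp add: v fun_eq_iff algebra_simps)
    then show ?thesis using True by (simp add: U_rec)
  next
    case False
    have v: "?v = (\<lambda>x. sin_ratio s t n * e s x + sin_ratio s t (Suc n) * e t x)"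
      using Suc False by simp
    have "ip s ?v = sin_ratio s t n * 2 + sin_ratio s t (Suc n) * - kk s t"
      unfolding v ip_lin using assms k by (simp add: ip_e kk_self)
    then have ipv: "ip s ?v = 2 * sin_ratio s t n - kk s t * sin_ratio s t (Suc n)" by simp
    have "act (rev (alt_list t s (Suc n))) (e s) =
       (\<lambda>x. (kk s t * sin_ratio s t (Suc n) - sin_ratio s t n) * e s x + sin_ratio s t (Suc n) * e t x)"
      unfolding rev_alt_list using False
      by (simp only: if_False act_Cons refl_as[of s] ipv) (simp add: v fun_eq_iff algebra_simps)
    then show ?thesis using False by (simp add: U_rec)
  qed
qed

lemma dihedral_pos:
  assumes "s \<in> S" "t \<in> S" "s \<noteq> t" "enat n < m s t"
  shows "\<exists>p q. p \<ge> 0 \<and> q \<ge> 0 \<and> act (rev (alt_list t s n)) (e s) = (\<lambda>x. p * e s x + q * e t x)"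
proof -
  have "enat n \<le> m s t" "enat (Suc n) \<le> m s t"
    using assms(4) by (auto simp: Suc_ile_eq)
  then have "sin_ratio s t n \<ge> 0" "sin_ratio s t (Suc n) \<ge> 0" using U_nonneg assms by blast+
  then show ?thesis unfolding dihedral_e[OF assms(1-3)]
    by (intro exI[of _ "if even n then sin_ratio s t (Suc n) else sin_ratio s t n"]
        exI[of _ "if even n then sin_ratio s t n else sin_ratio s t (Suc n)"]) auto
qed

text \<open>Both pairings follow the Chebyshev recursion. The exception at n = 0 stands for the
  value -1 of the recursion at index -1, which truncated subtraction would turn into 0.\<close>

lemma dihedral_ip:
  assumes "s \<in> S" "t \<in> S" "s \<noteq> t"
  shows "ip (if even n then s else t) (act (rev (alt_list s t n)) v) =
           sin_ratio s t (Suc n) * ip s v + sin_ratio s t n * ip t v \<and>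
         ip (if even n then t else s) (act (rev (alt_list s t n)) v) =
           (if n = 0 then ip t v else - (sin_ratio s t n * ip s v + sin_ratio s t (n - 1) * ip t v))"
proof (induction n)
  case 0
  show ?case using assms by (simp add: U_1)
next
  case (Suc n)
  have k: "kk t s = kk s t" using assms by (simp add: kk_sym)
  have r: "rev (alt_list s t (Suc n)) = (if even n then s else t) # rev (alt_list s t n)"
    by (rule rev_alt_list)
  show ?case
  proof (cases n)
    case 0
    then show ?thesis using assms k U_rec[of s t 0] by (simp add: ip_refl U_1 kk_self)
  next
    case (Suc j)
    have r': "rev (alt_list s t (Suc (Suc j))) = (if even n then s else t) # rev (alt_list s t n)"
      using r Suc by simp
    have IH: "ip (if even n then s else t) (act (rev (alt_list s t n)) v) =
           sin_ratio s t (Suc n) * ip s v + sin_ratio s t n * ip t v"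
         "ip (if even n then t else s) (act (rev (alt_list s t n)) v) =
           - (sin_ratio s t n * ip s v + sin_ratio s t j * ip t v)"
      using Suc.IH Suc by auto
    have sin_ratio: "sin_ratio s t (Suc (Suc n)) = kk s t * sin_ratio s t (Suc n) - sin_ratio s t n"
      "sin_ratio s t (Suc n) = kk s t * sin_ratio s t n - sin_ratio s t j" using Suc by (simp_all add: U_rec)
    show ?thesis
    proof (cases "even n")
      case True
      then have IH': "ip s (act (rev (alt_list s t n)) v) = sin_ratio s t (Suc n) * ip s v + sin_ratio s t n * ip t v"
         "ip t (act (rev (alt_list s t n)) v) = - (sin_ratio s t n * ip s v + sin_ratio s t j * ip t v)"
        using IH by auto
      have "ip t (sg s (act (rev (alt_list s t n)) v)) = sin_ratio s t (Suc (Suc n)) * ip s v + sin_ratio s t (Suc n) * ip t v"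
        unfolding ip_refl[OF assms(1)] IH' k sin_ratio by (simp add: algebra_simps)
      moreover have "ip s (sg s (act (rev (alt_list s t n)) v)) = - (sin_ratio s t (Suc n) * ip s v + sin_ratio s t n * ip t v)"
        unfolding ip_refl_self[OF assms(1)] IH' by simp
      ultimately show ?thesis unfolding r using True by simp
    next
      case False
      then have IH': "ip t (act (rev (alt_list s t n)) v) = sin_ratio s t (Suc n) * ip s v + sin_ratio s t n * ip t v"
         "ip s (act (rev (alt_list s t n)) v) = - (sin_ratio s t n * ip s v + sin_ratio s t j * ip t v)"
        using IH by auto
      have "ip s (sg t (act (rev (alt_list s t n)) v)) = sin_ratio s t (Suc (Suc n)) * ip s v + sin_ratio s t (Suc n) * ip t v"
        unfolding ip_refl[OF assms(2)] IH' k sin_ratio by (simp add: algebra_simps)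
      moreover have "ip t (sg t (act (rev (alt_list s t n)) v)) = - (sin_ratio s t (Suc n) * ip s v + sin_ratio s t n * ip t v)"
        unfolding ip_refl_self[OF assms(2)] IH' by simp
      ultimately show ?thesis unfolding r using False by simp
    qed
  qed
qed

lemma alt_diff:
  assumes "s \<in> S" "t \<in> S"
  shows "\<exists>p q. act (alt_list s t n) v = (\<lambda>x. v x + p * e s x + q * e t x)"
  using assms
proof (induction n arbitrary: s t)
  case 0
  show ?case by (rule exI[of _ 0], rule exI[of _ 0]) simp
next
  case (Suc n)
  obtain p q where pq: "act (alt_list t s n) v = (\<lambda>x. v x + p * e t x + q * e s x)"
    using Suc by blast
  show ?case
    by (rule exI[of _ "q - ip s (act (alt_list t s n) v)"], rule exI[of _ p])
       (simp only: alt_list.simps act_Cons refl_as, simp add: pq fun_eq_iff algebra_simps)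
qed

text \<open>The two sides differ by a vector in the span of \<open>e s\<close> and
  \<open>e t\<close>, and their pairings with both roots agree. The Gram determinant of this plane
  is 4 - (kk s t)^2, nonzero for finite \<open>m s t\<close>, so the difference vanishes.\<close>

lemma braid_act_rev:
  assumes "s \<in> S" "t \<in> S" "s \<noteq> t" "m s t = enat n"
  shows "act (rev (alt_list s t n)) v = act (rev (alt_list t s n)) v"
proof -
  let ?A = "act (rev (alt_list s t n)) v" and ?B = "act (rev (alt_list t s n)) v"
  have n2: "n \<ge> 2" using m_ge_2[of s t] assms by simp
  obtain j where j: "n = Suc j" using n2 by (cases n) auto
  have mts: "m t s = enat n" using assms m_sym by simp
  have ends: "sin_ratio s t (Suc j) = 0" "sin_ratio s t j = 1" "sin_ratio t s (Suc j) = 0" "sin_ratio t s j = 1"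
    using U_end[of s t j] U_end[of t s j] assms mts j by auto
  have e2: "sin_ratio s t (Suc (Suc j)) = -1" "sin_ratio t s (Suc (Suc j)) = -1"
    using ends by (simp_all add: U_rec)
  have ips: "ip s ?A = ip s ?B" "ip t ?A = ip t ?B"
    using dihedral_ip[OF assms(1-3), of n v] dihedral_ip[of t s n v] assms
    by (auto simp: j ends e2 split: if_splits)
  obtain p q p' q' where A: "?A = (\<lambda>x. v x + p * e s x + q * e t x)"
      and B: "?B = (\<lambda>x. v x + p' * e s x + q' * e t x)"
  proof -
    have *: "\<exists>p q. act (alt_list t s n) v = (\<lambda>x. v x + p * e s x + q * e t x)"
    proof -
      obtain p q where "act (alt_list t s n) v = (\<lambda>x. v x + p * e t x + q * e s x)"
        using alt_diff[of t s n v] assms by blast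
      then have "act (alt_list t s n) v = (\<lambda>x. v x + q * e s x + p * e t x)" by (simp add: fun_eq_iff)
      then show ?thesis by blast
    qed
    have "\<exists>p q. ?A = (\<lambda>x. v x + p * e s x + q * e t x)"
      unfolding rev_alt using alt_diff[of s t n v] * assms(1,2) by presburger
    moreover have "\<exists>p q. ?B = (\<lambda>x. v x + p * e s x + q * e t x)"
      unfolding rev_alt using alt_diff[of s t n v] * assms(1,2) by presburger
    ultimately show ?thesis using that by blast
  qed
  define P where "P = p - p'"
  define Q where "Q = q - q'"
  have D: "(\<lambda>x. 1 * ?A x + (-1) * ?B x) = (\<lambda>x. P * e s x + Q * e t x)"
    unfolding A B P_def Q_def by (simp add: fun_eq_iff algebra_simps)
  have k: "kk t s = kk s t" using assms by (simp add: kk_sym)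
  have "ip s (\<lambda>x. 1 * ?A x + (-1) * ?B x) = 0" "ip t (\<lambda>x. 1 * ?A x + (-1) * ?B x) = 0"
    unfolding ip_lin using ips by auto
  then have 1: "2 * P - kk s t * Q = 0" "2 * Q - kk s t * P = 0"
    unfolding D ip_lin using assms k by (simp_all add: ip_e kk_self algebra_simps)
  have "kk s t ^ 2 \<noteq> 4"
  proof -
    have "sin (pi / real n) > 0" using sin_pos_m[OF assms(1-3)] assms(4) by simp
    moreover have "(sin (pi / real n))\<^sup>2 + (cos (pi / real n))\<^sup>2 = 1" by simp
    ultimately have "(cos (pi / real n))\<^sup>2 \<noteq> 1"
      by (metis add_cancel_left_left less_irrefl power_eq_0_iff)
    then show ?thesis using assms(4) by (simp add: kk_def power_mult_distrib)
  qed
  moreover have "(4 - (kk s t)\<^sup>2) * P = 0" "(4 - (kk s t)\<^sup>2) * Q = 0"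
    using 1 by algebra+
  ultimately have "P = 0" "Q = 0" by auto
  then show ?thesis unfolding A B P_def Q_def by simp
qed

lemma braid_act:
  assumes "s \<in> S" "t \<in> S" "s \<noteq> t" "m s t = enat n"
  shows "act (alt_list s t n) = act (alt_list t s n)"
  using braid_act_rev[OF assms] by (cases "even n") (auto simp: rev_alt fun_eq_iff)

end

context coxeter_system
begin

subsection \<open>Reduced words\<close>

text \<open>Equality in the Coxeter group is encoded as equality of \<open>act\<close>, so that
  length can be studied through signs of roots.\<close>

definition reduced :: "'s list \<Rightarrow> bool" where
  "reduced w \<longleftrightarrow> w \<in> lists S \<and> (\<forall>w'\<in>lists S. act w' = act w \<longrightarrow> length w \<le> length w')"

text \<open>The root criterion: w^(-1) does not keep \<open>e s\<close> positive. For reduced w it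
  agrees with s w failing to be reduced (\<open>red_Cons_iff\<close>).\<close>

definition left_descent :: "'s list \<Rightarrow> 's \<Rightarrow> bool" where
  "left_descent w s \<longleftrightarrow> \<not> nn (act (rev w) (e s))"

lemma act_eq_iff: "act u = act v \<longleftrightarrow> (\<forall>x. act u x = act v x)"
  by (rule fun_eq_iff)

lemma act_cong_append: "act u = act u' \<Longrightarrow> act w = act w' \<Longrightarrow> act (u @ w) = act (u' @ w')"
  by (simp add: act_eq_iff)

lemma act_cong_Cons: "act w = act w' \<Longrightarrow> act (s # w) = act (s # w')"
  by (simp add: act_eq_iff)

lemma act_double: "s \<in> S \<Longrightarrow> act (x @ [s, s] @ y) = act (x @ y)"
  by (simp add: act_eq_iff)

lemma act_rev_cong:
  assumes "u \<in> lists S" "v \<in> lists S" "act u = act v"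
  shows "act (rev u) = act (rev v)"
proof (rule ext)
  fix x
  have "act u (act (rev v) x) = x" using assms by simp
  then show "act (rev u) x = act (rev v) x" by (metis act_rev_act assms(1))
qed

lemma red_lists: "reduced w \<Longrightarrow> w \<in> lists S"
  by (simp add: reduced_def)

lemma red_le: "reduced w \<Longrightarrow> w' \<in> lists S \<Longrightarrow> act w' = act w \<Longrightarrow> length w \<le> length w'"
  by (simp add: reduced_def)

lemma red_cong:
  "reduced w \<Longrightarrow> w' \<in> lists S \<Longrightarrow> act w' = act w \<Longrightarrow> length w' \<le> length w \<Longrightarrow> reduced w'"
  unfolding reduced_def by fastforce

lemma red_length: "reduced u \<Longrightarrow> reduced v \<Longrightarrow> act u = act v \<Longrightarrow> length u = length v"
  by (metis red_le red_lists order_antisym)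

lemma ex_red:
  assumes "w \<in> lists S"
  shows "\<exists>w'. reduced w' \<and> act w' = act w"
proof -
  obtain w' where "w' \<in> lists S \<and> act w' = act w"
      "\<forall>y. y \<in> lists S \<and> act y = act w \<longrightarrow> length w' \<le> length y"
    using ex_has_least_nat[of "\<lambda>w'. w' \<in> lists S \<and> act w' = act w" w length] assms by auto
  then show ?thesis unfolding reduced_def by metis
qed

lemma rev_lists [simp]: "rev w \<in> lists T \<longleftrightarrow> w \<in> lists T"
  by (simp add: in_lists_conv_set)

lemma red_rev [simp]: "reduced (rev w) \<longleftrightarrow> reduced w"
proof -
  have "reduced (rev w)" if "reduced w" for w
    unfolding reduced_def
  proof (intro conjI ballI impI)
    show "rev w \<in> lists S" using that red_lists by simp
    fix w' assume w': "w' \<in> lists S" "act w' = act (rev w)"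
    then have "act (rev w') = act w"
      using act_rev_cong[of w' "rev w"] that red_lists by simp
    then show "length (rev w) \<le> length w'" using red_le[OF that, of "rev w'"] w' by simp
  qed
  from this this[of "rev w"] show ?thesis by auto
qed

lemma red_appendD1: "reduced (u @ v) \<Longrightarrow> reduced u"
  unfolding reduced_def
proof (intro conjI ballI impI, elim conjE)
  assume "u @ v \<in> lists S" then show "u \<in> lists S" by simp
next
  fix w' assume *: "u @ v \<in> lists S \<and> (\<forall>w'\<in>lists S. act w' = act (u @ v) \<longrightarrow> length (u @ v) \<le> length w')"
    and w': "w' \<in> lists S" "act w' = act u"
  have "w' @ v \<in> lists S" "act (w' @ v) = act (u @ v)"
    using * w' by (auto intro: act_cong_append)
  then show "length u \<le> length w'" using * by force
qed

lemma red_appendD2: "reduced (u @ v) \<Longrightarrow> reduced v"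
  using red_appendD1[of "rev v" "rev u"] red_rev[of "u @ v"] red_rev[of v] by simp

lemma red_ConsD: "reduced (s # w) \<Longrightarrow> reduced w"
  using red_appendD2[of "[s]" w] by simp

lemma red_Nil [simp]: "reduced []"
  by (simp add: reduced_def)

lemma red_no_square: "reduced (x @ [s, s] @ y) \<Longrightarrow> False"
proof -
  assume r: "reduced (x @ [s, s] @ y)"
  then have l: "x @ [s, s] @ y \<in> lists S" by (rule red_lists)
  then have "act (x @ y) = act (x @ [s, s] @ y)" using act_double[of s x y] by simp
  then show False using red_le[OF r, of "x @ y"] l by simp
qed

lemma alternating:
  assumes "f \<in> lists {s, t}" "\<And>x a y. f \<noteq> x @ [a, a] @ y"
  shows "f = alt_list s t (length f) \<or> f = alt_list t s (length f)"
proof -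
  have "\<forall>x a y. f \<noteq> x @ [a, a] @ y" using assms(2) by blast
  with assms(1) show ?thesis
  proof (induction f rule: list.induct)
    case (Cons a f)
    have sq: "a # f \<noteq> x @ [b, b] @ y" for x b y using Cons.prems(2) by blast
    have "f \<noteq> x @ [b, b] @ y" for x b y
      using sq[of "a # x" b y] by simp
    then have IH: "f = alt_list s t (length f) \<or> f = alt_list t s (length f)"
      using Cons by simp
    have a: "a \<in> {s, t}" using Cons.prems(1) by simp
    show ?case
    proof (cases f)
      case Nil
      then show ?thesis using a by auto
    next
      case (Cons b g)
      then have "b \<noteq> a" using sq[of "[]" a g] by auto
      then show ?thesis using IH Cons a by auto
    qed
  qed simp
qed

text \<open>By minimality d alternates and does not end in s. It is shorter than
  \<open>m s t\<close>, because otherwise a braid move would make it end in s. Below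
  \<open>m s t\<close> the Chebyshev coefficients are nonnegative.\<close>

lemma dihedral_min:
  assumes st: "s \<in> S" "t \<in> S" "s \<noteq> t" and d: "d \<in> lists {s, t}"
    and min: "\<And>d'. d' \<in> lists {s, t} \<Longrightarrow> act d' = act (d @ [s]) \<Longrightarrow> length d \<le> length d'"
  shows "\<exists>p q. p \<ge> 0 \<and> q \<ge> 0 \<and> act d (e s) = (\<lambda>x. p * e s x + q * e t x)"
proof -
  have dS: "d \<in> lists S" using d st by auto
  have "rev d \<noteq> x @ [a, a] @ y" for x a y
  proof
    assume "rev d = x @ [a, a] @ y"
    then have "rev (rev d) = rev (x @ [a, a] @ y)" by (rule arg_cong)
    then have eq: "d = rev y @ [a, a] @ rev x" by simp
    then have "a \<in> S" using dS by simp
    then have "act (rev y @ rev x @ [s]) = act (d @ [s])"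
      using act_double[of a "rev y" "rev x @ [s]"] eq by simp
    then show False using min[of "rev y @ rev x @ [s]"] d eq by (simp add: in_lists_conv_set)
  qed
  then have alt: "rev d = alt_list s t (length d) \<or> rev d = alt_list t s (length d)"
    using alternating[of "rev d" s t] d by simp
  show ?thesis
  proof (cases "d = []")
    case True
    then show ?thesis by (intro exI[of _ 1] exI[of _ 0]) simp
  next
    case False
    then obtain k where k: "length d = Suc k" by (cases d) auto
    have "rev d \<noteq> alt_list s t (length d)"
    proof
      assume "rev d = alt_list s t (length d)"
      then have "rev d = s # alt_list t s k" using k by simp
      then have "rev (rev d) = rev (s # alt_list t s k)" by (rule arg_cong)
      then have eq: "d = rev (alt_list t s k) @ [s]" by simp
      then have "act (rev (alt_list t s k)) = act (d @ [s])"
        using st by (simp add: act_eq_iff)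
      then show False using min[of "rev (alt_list t s k)"] k by simp
    qed
    then have "rev d = alt_list t s (length d)" using alt by simp
    then have eq: "d = rev (alt_list t s (length d))" by (metis rev_rev_ident)
    have "enat (length d) < m s t"
    proof (rule ccontr)
      assume "\<not> ?thesis"
      then obtain n where n: "m s t = enat n" "n \<le> length d"
        by (cases "m s t") auto
      obtain n' where n': "n = Suc n'" using m_ge_2[of s t] n st by (cases n) auto
      define j where "j = length d - n"
      have "length d = n + j" using n j_def by simp
      then have "rev d = alt_list t s n @ (if even n then alt_list t s j else alt_list s t j)"
        using \<open>rev d = alt_list t s (length d)\<close> by (simp add: alt_list_add)
      then obtain f where f: "rev d = alt_list t s n @ f" "f \<in> lists {s, t}"
        by (metis alt_list_lists insertCI)
      then have d': "d = rev f @ rev (alt_list t s n)" by (metis rev_append rev_rev_ident)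
      have "act d = act (rev f @ rev (alt_list s t n))"
        unfolding d' using braid_act_rev[OF st n(1)] by (simp add: act_eq_iff)
      also have "\<dots> = act ((rev f @ rev (alt_list t s n')) @ [s])"
        by (simp add: n')
      finally have "act (d @ [s]) = act (rev f @ rev (alt_list t s n'))"
        using st by (simp add: act_eq_iff)
      then show False using min[of "rev f @ rev (alt_list t s n')"] f(2) d' n' by simp
    qed
    from dihedral_pos[OF st this] eq show ?thesis by simp
  qed
qed

text \<open>Humphreys, Reflection Groups and Coxeter Groups, Theorem 5.4: split off the longest right
  factor in the dihedral subgroup generated by \<open>s\<close> and the last letter \<open>t\<close>.\<close>

lemma red_nn:
  assumes "reduced w" "s \<in> S"
    "\<And>w'. w' \<in> lists S \<Longrightarrow> act w' = act (w @ [s]) \<Longrightarrow> length w \<le> length w'"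
  shows "nn (act w (e s))"
  using assms
proof (induction "length w" arbitrary: w s rule: less_induct)
  case less
  show ?case
  proof (cases w rule: rev_cases)
    case Nil
    then show ?thesis by simp
  next
    case (snoc w1 t)
    have wS: "w1 \<in> lists S" "t \<in> S" using red_lists[OF less.prems(1)] snoc by auto
    have "t \<noteq> s"
    proof
      assume "t = s"
      then have "act w1 = act (w @ [s])" using snoc wS by (simp add: act_eq_iff)
      then show False using less.prems(3)[of w1] wS snoc by simp
    qed
    define P where "P v \<longleftrightarrow> v \<in> lists S \<and> (\<exists>d\<in>lists {s, t}. length v + length d = length w
       \<and> act (v @ d) = act w)" for v
    have "P w1" unfolding P_def using wS snoc by (auto intro!: bexI[of _ "[t]"])
    then obtain v where v: "P v" "\<And>y. P y \<Longrightarrow> length v \<le> length y"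
      using ex_has_least_nat[of P w1 length] by blast
    obtain d where d: "d \<in> lists {s, t}" "length v + length d = length w" "act (v @ d) = act w"
      and vS: "v \<in> lists S" using v(1) P_def by auto
    have dS: "d \<in> lists S" using d(1) wS less.prems(2) by auto
    have lv: "length v < length w" using v(2)[OF \<open>P w1\<close>] snoc by simp
    have rv: "reduced v" unfolding reduced_def
    proof (intro conjI ballI impI)
      fix w' assume w': "w' \<in> lists S" "act w' = act v"
      then have "act (w' @ d) = act w" using d(3) by (simp add: act_eq_iff)
      then show "length v \<le> length w'" using red_le[OF less.prems(1), of "w' @ d"] w' dS d(2) by simp
    qed (rule vS)
    \<comment> \<open>If v x were shorter than v, the letter x could be moved from v into the
      dihedral factor, against the minimality of v.\<close>
    have mv: "length v \<le> length v'" if x: "x \<in> {s, t}" and v': "v' \<in> lists S" "act v' = act (v @ [x])" for x v'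
    proof (rule ccontr)
      assume c: "\<not> ?thesis"
      have xS: "x \<in> S" using x wS less.prems(2) by auto
      have a: "act (v' @ x # d) = act w"
        using v' d(3) xS by (simp add: act_eq_iff)
      then have "length w \<le> length (v' @ x # d)"
        using red_le[OF less.prems(1), of "v' @ x # d"] v' dS xS by simp
      then have "length v' + length (x # d) = length w" using c d(2) by simp
      then have "P v'" unfolding P_def using v' a d(1) x by (auto intro!: bexI[of _ "x # d"])
      then show False using v(2) c by blast
    qed
    have nv: "nn (act v (e s))" "nn (act v (e t))"
      using less.hyps[OF lv rv] mv wS less.prems(2) by auto
    have "\<exists>p q. p \<ge> 0 \<and> q \<ge> 0 \<and> act d (e s) = (\<lambda>x. p * e s x + q * e t x)"
    proof (rule dihedral_min)
      fix d' assume d': "d' \<in> lists {s, t}" "act d' = act (d @ [s])"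
      then have "act (v @ d') = act (w @ [s])" using d(3) by (simp add: act_eq_iff)
      moreover have "v @ d' \<in> lists S" using d'(1) vS wS less.prems(2) by auto
      ultimately have "length w \<le> length (v @ d')" using less.prems(3) by blast
      then show "length d \<le> length d'" using d(2) by simp
    qed (use less.prems(2) wS \<open>t \<noteq> s\<close> d(1) in auto)
    then obtain p q where pq: "p \<ge> 0" "q \<ge> 0" "act d (e s) = (\<lambda>x. p * e s x + q * e t x)" by blast
    have "act w (e s) = act v (act d (e s))" using d(3) by (metis act_append)
    also have "\<dots> = (\<lambda>x. p * act v (e s) x + q * act v (e t) x)" unfolding pq(3) act_lin ..
    finally show ?thesis using nn_lin pq nv by simp
  qed
qed

lemma red_snoc_cases:
  assumes "reduced w" "s \<in> S"
  obtains "reduced (w @ [s])" "nn (act w (e s))"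
  | w' where "reduced (w' @ [s])" "act (w' @ [s]) = act w" "length w = Suc (length w')"
      "nn (\<lambda>x. - act w (e s) x)"
proof -
  have wS: "w \<in> lists S" using assms red_lists by simp
  have neg: "act w' (e s) = (\<lambda>x. - act w (e s) x)" if "act w' = act (w @ [s])" for w'
  proof -
    have "act w' (e s) = act w (sg s (e s))" using that by simp
    then show ?thesis using assms(2) by (simp add: refl_e_self act_uminus)
  qed
  have bk: "act (w' @ [s]) = act w" if "act w' = act (w @ [s])" for w'
    using that assms(2) by (simp add: act_eq_iff)
  show ?thesis
  proof (cases "\<forall>w'\<in>lists S. act w' = act (w @ [s]) \<longrightarrow> length w \<le> length w'")
    case True
    then have nnw: "nn (act w (e s))" using red_nn assms by blast
    have "reduced (w @ [s])"
      unfolding reduced_def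
    proof (intro conjI ballI impI)
      fix w' assume w': "w' \<in> lists S" "act w' = act (w @ [s])"
      show "length (w @ [s]) \<le> length w'"
      proof (rule ccontr)
        assume "\<not> ?thesis"
        \<comment> \<open>A word for w s of the same length as w is excluded by signs:
          \<open>red_nn\<close> would make both w e_s and its negative w' e_s nonnegative.\<close>
        then have l: "length w' = length w" using True w' by force
        have "reduced w'" unfolding reduced_def using w' l True by simp
        then have "nn (act w' (e s))"
        proof (rule red_nn[OF _ assms(2)])
          fix w'' assume "w'' \<in> lists S" "act w'' = act (w' @ [s])"
          then show "length w' \<le> length w''" using bk[OF w'(2)] l red_le[OF assms(1)] by simp
        qed
        then show False using neg[OF w'(2)] not_nn_both[OF wS assms(2) nnw] by simp
      qed
    qed (use wS assms in simp)
    then show ?thesis using nnw that(1) by simp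
  next
    case False
    then obtain w' where w': "w' \<in> lists S" "act w' = act (w @ [s])" "length w' < length w" by force
    have b: "act (w' @ [s]) = act w" using bk w' by simp
    have "length w \<le> length (w' @ [s])" using red_le[OF assms(1), of "w' @ [s]"] b w' assms by simp
    then have l: "length w = Suc (length w')" using w' by simp
    have r: "reduced (w' @ [s])" using red_cong[OF assms(1), of "w' @ [s]"] b l w' assms by simp
    have "nn (act w' (e s))"
    proof (rule red_nn[OF _ assms(2)])
      show "reduced w'" using r red_appendD1 by blast
      fix w'' assume "w'' \<in> lists S" "act w'' = act (w' @ [s])"
      then show "length w' \<le> length w''" using b red_le[OF assms(1)] l by fastforce
    qed
    then show ?thesis using that(2)[OF r b l] neg[OF w'(2)] by simp
  qed
qed

lemma red_Cons_cases:
  assumes "reduced w" "s \<in> S"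
  obtains "reduced (s # w)" "\<not> left_descent w s"
  | w' where "reduced (s # w')" "act (s # w') = act w" "length w = Suc (length w')"
      "left_descent w s" "nn (\<lambda>x. - act (rev w) (e s) x)"
proof -
  have rr: "reduced (rev w)" using assms by simp
  show ?thesis
  proof (cases rule: red_snoc_cases[OF rr assms(2), case_names up down])
    case up
    then have "reduced (s # w)" "\<not> left_descent w s" using red_rev[of "s # w"] by (simp_all add: left_descent_def)
    then show ?thesis using that(1) by blast
  next
    case (down w')
    have r: "reduced (s # rev w')" using down(1) red_rev[of "s # rev w'"] by simp
    have a: "act (s # rev w') = act w"
      using act_rev_cong[OF _ _ down(2)] red_lists[OF down(1)] red_lists[OF assms(1)] by simp
    have "left_descent w s" unfolding left_descent_def
      using not_nn_both[of "rev w" s] red_lists[OF assms(1)] assms(2) down(4) by auto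
    then show ?thesis using that(2)[OF r a] down by simp
  qed
qed

lemma root_cases:
  assumes "w \<in> lists S" "s \<in> S"
  shows "nn (act w (e s)) \<or> nn (\<lambda>x. - act w (e s) x)"
proof -
  obtain w' where "reduced w'" "act w' = act w" using ex_red assms by blast
  then show ?thesis by (metis red_snoc_cases assms(2))
qed

lemma LD_cong: "u \<in> lists S \<Longrightarrow> v \<in> lists S \<Longrightarrow> act u = act v \<Longrightarrow> left_descent u s = left_descent v s"
  unfolding left_descent_def using act_rev_cong by metis

lemma red_Cons_iff:
  assumes "reduced w" "s \<in> S"
  shows "reduced (s # w) \<longleftrightarrow> \<not> left_descent w s"
proof (cases rule: red_Cons_cases[OF assms, case_names up down])
  case up
  then show ?thesis by simp
next
  case (down w')
  have "\<not> reduced (s # w)"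
  proof
    assume r: "reduced (s # w)"
    have "act w' = act (s # w)"
    proof
      fix x
      have "act w x = sg s (act w' x)" using down(2) by (metis act_Cons)
      then show "act w' x = act (s # w) x" using assms(2) by simp
    qed
    then have "length (s # w) \<le> length w'"
      using red_le[OF r] red_lists[OF down(1)] by simp
    then show False using down by simp
  qed
  then show ?thesis using down by simp
qed

lemma red_snoc_iff: "reduced w \<Longrightarrow> s \<in> S \<Longrightarrow> reduced (w @ [s]) \<longleftrightarrow> nn (act w (e s))"
  using red_Cons_iff[of "rev w" s] red_rev[of "w @ [s]"] by (simp add: left_descent_def)

lemma LD_Cons: "reduced (s # w) \<Longrightarrow> left_descent (s # w) s"
proof -
  assume r: "reduced (s # w)"
  have "s \<in> S" using red_lists[OF r] by simp
  show ?thesis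
  proof (rule ccontr)
    assume "\<not> ?thesis"
    then have "reduced ([] @ [s, s] @ w)" using red_Cons_iff[OF r \<open>s \<in> S\<close>] by simp
    then show False by (rule red_no_square)
  qed
qed

lemma LD_append: "reduced (u @ v) \<Longrightarrow> s \<in> S \<Longrightarrow> left_descent u s \<Longrightarrow> left_descent (u @ v) s"
  using red_Cons_iff[of u s] red_Cons_iff[of "u @ v" s] red_appendD1[of u v] red_appendD1[of "s # u" v]
  by auto

lemma LD_exchange:
  assumes "reduced w" "s \<in> S" "left_descent w s"
  obtains w' where "reduced (s # w')" "act (s # w') = act w" "length w = Suc (length w')"
  using red_Cons_cases[OF assms(1,2)] assms(3) by metis

subsection \<open>Exchange inside standard parabolic subgroups\<close>

text \<open>The reflection in \<open>e a\<close> changes only the coordinate a. A positive root that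
  stops being nonnegative is therefore a multiple of \<open>e a\<close>, and its norm 2 makes the
  factor 1.\<close>

lemma root_eq_simple:
  assumes "w \<in> lists S" "s \<in> S" "a \<in> S" "nn (act w (e s))" "\<not> nn (sg a (act w (e s)))"
  shows "act w (e s) = e a"
proof -
  define b where "b = act w (e s)"
  have nb: "\<not> nn (sg a b)" "nn b" using assms b_def by simp_all
  have "nn (\<lambda>x. - sg a b x)" using root_cases[of "a # w" s] assms nb b_def by simp
  then have "b x \<le> 0" if "x \<noteq> a" for x
    using that unfolding nn_def sg_def by (metis fun_upd_other neg_0_le_iff_le)
  then have "b x = 0" if "x \<noteq> a" for x
    using that nb(2) unfolding nn_def by (metis order_antisym)
  then have b: "b = (\<lambda>x. b a * e a x + 0 * e a x)" by (auto simp: e_def fun_eq_iff)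
  have "bil b b = 2"
    unfolding b_def using bil_act[OF assms(1), of "e s" "e s"] bil_e[of s "e s"] ip_e_self[of s] assms(2)
    by metis
  moreover have "bil b b = b a * (b a * 2)"
  proof -
    have "bil b b = b a * ip a b" by (subst (1) b, subst bil_lin) (simp add: bil_e assms)
    moreover have "ip a b = b a * 2" by (subst b, subst ip_lin) (simp add: assms)
    ultimately show ?thesis by simp
  qed
  ultimately have "(b a)\<^sup>2 = 1" by (simp add: power2_eq_square)
  moreover have "b a \<ge> 0" using nb(2) by (simp add: nn_def)
  ultimately have "b a = 1" by (auto simp: power2_eq_1_iff)
  then show ?thesis using b b_def by simp
qed

text \<open>Reading w from the right, some letter a first turns the image of \<open>e s\<close>
  negative. Just before it the image is \<open>e a\<close>, so s moves across to a and the two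
  cancel.\<close>

lemma deletion:
  assumes "w \<in> lists S" "s \<in> S" "\<not> nn (act w (e s))"
  shows "\<exists>x a y. w = x @ [a] @ y \<and> act (x @ y) = act (w @ [s])"
  using assms
proof (induction w rule: list.induct)
  case (Cons a w)
  have aw: "a \<in> S" "w \<in> lists S" using Cons by auto
  show ?case
  proof (cases "nn (act w (e s))")
    case True
    have "act w (e s) = e a" using root_eq_simple[OF aw(2) Cons.prems(2) aw(1) True] Cons.prems by simp
    then have "sg a (act w v) = act w (sg s v)" for v
      using refl_conj[OF aw(2) Cons.prems(2) aw(1)] by simp
    then have "act w = act ((a # w) @ [s])"
      using aw(1) by (simp add: act_eq_iff flip: \<open>\<And>v. sg a (act w v) = act w (sg s v)\<close>)
    then show ?thesis by (metis append_Cons append_Nil)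
  next
    case False
    then obtain x b y where "w = x @ [b] @ y" "act (x @ y) = act (w @ [s])" using Cons aw by blast
    then have "a # w = (a # x) @ [b] @ y" "act ((a # x) @ y) = act ((a # w) @ [s])"
      by (auto simp: act_eq_iff)
    then show ?thesis by blast
  qed
qed simp

text \<open>The shorter word comes from \<open>deletion\<close>, so it is a subword of w and keeps
  its letters in T; \<open>LD_exchange\<close> gives no such control.\<close>

lemma LD_exchange_in:
  assumes "T \<subseteq> S" "w \<in> lists T" "reduced w" "s \<in> S" "left_descent w s"
  obtains w' where "w' \<in> lists T" "reduced (s # w')" "act (s # w') = act w" "length w = Suc (length w')"
proof -
  have wS: "w \<in> lists S" using assms by auto
  obtain x a y where xy: "rev w = x @ [a] @ y" "act (x @ y) = act (rev w @ [s])"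
    using deletion[of "rev w" s] wS assms(4,5) by (auto simp: left_descent_def)
  define w' where "w' = rev (x @ y)"
  have w: "w = rev y @ [a] @ rev x" using xy(1) by (metis append.assoc rev_append rev_rev_ident rev_singleton_conv)
  have w'T: "w' \<in> lists T" using assms(2) by (simp add: w w'_def in_lists_conv_set)
  have l: "length w = Suc (length w')" by (simp add: w w'_def)
  have w'S: "w' \<in> lists S" using w'T assms by auto
  have "act (rev (s # w')) = act (rev w)"
    using xy(2) assms(4) by (simp add: w'_def act_eq_iff)
  then have a: "act (s # w') = act w"
    using act_rev_cong[of "rev (s # w')" "rev w"] w'S assms(4) wS by simp
  have "reduced (s # w')" using red_cong[OF assms(3) _ a] w'S assms(4) l by simp
  then show ?thesis using that w'T a l by blast
qed

text \<open>Descents in J are moved from y into d until none is left, which makes y the minimal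
  representative of its coset.\<close>

lemma parabolic_decomposition:
  assumes "J \<subseteq> T" "T \<subseteq> S" "w \<in> lists T" "reduced w"
  obtains d y where "d \<in> lists J" "y \<in> lists T" "reduced (d @ y)" "act (d @ y) = act w"
    "\<And>j. j \<in> J \<Longrightarrow> \<not> left_descent y j"
proof -
  have "\<exists>d y. d \<in> lists J \<and> y \<in> lists T \<and> reduced (d @ y) \<and> act (d @ y) = act w \<and> (\<forall>j\<in>J. \<not> left_descent y j)"
    if "d \<in> lists J" "y \<in> lists T" "reduced (d @ y)" "act (d @ y) = act w" for d y
    using that
  proof (induction "length y" arbitrary: d y rule: less_induct)
    case less
    show ?case
    proof (cases "\<forall>j\<in>J. \<not> left_descent y j")
      case True
      then show ?thesis using less.prems by blast
    next
      case False
      then obtain j where j: "j \<in> J" "left_descent y j" by blast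
      have "reduced y" using less.prems red_appendD2 by blast
      then obtain y' where y': "y' \<in> lists T" "reduced (j # y')" "act (j # y') = act y"
          "length y = Suc (length y')"
        using LD_exchange_in[OF assms(2) less.prems(2)] j assms(1,2) by blast
      have a: "act ((d @ [j]) @ y') = act (d @ y)" using y'(3) by (simp add: act_eq_iff)
      have "reduced ((d @ [j]) @ y')"
        using less.prems(1) y'(1,4) j(1) assms(1,2) by (intro red_cong[OF less.prems(3) _ a]) auto
      then show ?thesis
        using less.hyps[of y' "d @ [j]"] y' less.prems j(1) a by simp
    qed
  qed
  from this[of "[]" w] assms(3,4) show ?thesis using that by auto blast
qed

lemma nn_sum:
  assumes "finite J" "\<And>j. j \<in> J \<Longrightarrow> c j \<ge> 0" "\<And>j. j \<in> J \<Longrightarrow> nn (f j)"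
  shows "nn (\<lambda>x. \<Sum>j\<in>J. c j * f j x)"
  using assms unfolding nn_def by (auto intro!: sum_nonneg)

lemma act_supported:
  assumes "J \<subseteq> S" "\<And>x. x \<notin> J \<Longrightarrow> v x = 0"
  shows "act w v = (\<lambda>x. \<Sum>j\<in>J. v j * act w (e j) x)"
proof -
  have fin: "finite J" using assms finite_S finite_subset by blast
  have "v = (\<lambda>x. \<Sum>j\<in>J. v j * e j x)"
  proof
    fix x
    have "(\<Sum>j\<in>J. v j * e j x) = (\<Sum>j\<in>J. if j = x then v j else 0)"
      by (rule sum.cong) (auto simp: e_def)
    then show "v x = (\<Sum>j\<in>J. v j * e j x)" using fin assms(2) by simp
  qed
  then have "act w v = act w (\<lambda>x. \<Sum>j\<in>J. v j * e j x)" by (rule arg_cong)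
  then show ?thesis using act_sum[OF fin, of w v e] by simp
qed

lemma act_supported_nn:
  assumes "J \<subseteq> S" "\<And>x. x \<notin> J \<Longrightarrow> v x = 0" "nn v" "\<And>j. j \<in> J \<Longrightarrow> nn (act w (e j))"
  shows "nn (act w v)"
proof -
  have "finite J" using assms finite_S finite_subset by blast
  then have "nn (\<lambda>x. \<Sum>j\<in>J. v j * act w (e j) x)"
    using nn_sum[of J v "\<lambda>j. act w (e j)"] assms(3,4) by (simp add: nn_def)
  then show ?thesis
    by (subst act_supported[of J v w, OF assms(1,2)])
qed

lemma act_supported_neg:
  assumes "J \<subseteq> S" "\<And>x. x \<notin> J \<Longrightarrow> v x = 0" "nn v" "\<And>j. j \<in> J \<Longrightarrow> nn (\<lambda>x. - act w (e j) x)"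
  shows "nn (\<lambda>x. - act w v x)"
proof -
  have "finite J" using assms finite_S finite_subset by blast
  then have "nn (\<lambda>x. \<Sum>j\<in>J. v j * - act w (e j) x)"
    using nn_sum[of J v "\<lambda>j x. - act w (e j) x"] assms(3,4) by (simp add: nn_def)
  then show ?thesis
    by (subst act_supported[of J v w, OF assms(1,2)]) (simp_all add: sum_negf)
qed

lemma act_e_outside: "w \<in> lists J \<Longrightarrow> u \<in> J \<Longrightarrow> x \<notin> J \<Longrightarrow> act w (e u) x = 0"
  by (cases "x = u") (simp_all add: act_outside[of w J x "e u"])

text \<open>y^(-1) keeps the simple roots of J nonnegative, hence preserves the sign of any vector
  of one sign supported on J. The root d^(-1) e_u is such a vector.\<close>

lemma LD_parabolic:
  assumes "J \<subseteq> S" "d \<in> lists J" "y \<in> lists S" "\<And>j. j \<in> J \<Longrightarrow> \<not> left_descent y j" "u \<in> J"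
  shows "left_descent (d @ y) u \<longleftrightarrow> left_descent d u"
proof -
  define v where "v = act (rev d) (e u)"
  have v0: "v x = 0" if "x \<notin> J" for x
    unfolding v_def using act_e_outside[of "rev d" J u x] that assms by simp
  have uS: "u \<in> S" "rev d \<in> lists S" "rev y \<in> lists S" using assms by auto
  have y: "nn (act (rev y) (e j))" if "j \<in> J" for j using assms(4)[OF that] by (simp add: left_descent_def)
  have eq: "act (rev (d @ y)) (e u) = act (rev y) v" by (simp add: v_def)
  show ?thesis
  proof (cases "nn v")
    case True
    then show ?thesis using act_supported_nn[OF assms(1) v0 True y] eq by (simp add: left_descent_def v_def)
  next
    case False
    then have n: "nn (\<lambda>x. - v x)" using root_cases[of "rev d" u] uS v_def by auto
    have "nn (act (rev y) (\<lambda>x. - v x))"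
      by (rule act_supported_nn[OF assms(1) _ n y]) (simp_all add: v0)
    then have "nn (\<lambda>x. - act (rev (d @ y)) (e u) x)" unfolding eq act_uminus .
    then have "left_descent (d @ y) u"
      unfolding left_descent_def using not_nn_both[of "rev (d @ y)" u] uS by auto
    then show ?thesis using False by (simp add: left_descent_def v_def)
  qed
qed

lemma red_parabolic_append:
  assumes "J \<subseteq> S" "d \<in> lists J" "reduced d" "reduced y" "\<And>j. j \<in> J \<Longrightarrow> \<not> left_descent y j"
  shows "reduced (d @ y)"
  using assms(2,3)
proof (induction d rule: list.induct)
  case (Cons u d)
  have "reduced (u # d)" using Cons.prems by simp
  then have "reduced d" "\<not> left_descent d u" using red_ConsD[of u d] red_Cons_iff[of d u] red_lists[of "u # d"] by auto
  moreover have "reduced (d @ y)" using Cons \<open>reduced d\<close> by simp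
  moreover have "u \<in> J" "d \<in> lists J" "u \<in> S" using Cons.prems(1) assms(1) by auto
  ultimately show ?case
    using red_Cons_iff[of "d @ y" u] LD_parabolic[OF assms(1) _ red_lists[OF assms(4)] assms(5), of d u]
    by simp
qed (use assms in simp)

subsection \<open>Longest elements\<close>

text \<open>The longest element of a parabolic subgroup, described by descents. Its existence turns
  out to be equivalent to finiteness (\<open>spherical_iff_longest\<close>).\<close>

definition longest :: "'s set \<Rightarrow> 's list \<Rightarrow> bool" where
  "longest J d \<longleftrightarrow> d \<in> lists J \<and> reduced d \<and> (\<forall>j\<in>J. left_descent d j)"

text \<open>d^(-1) sends nonnegative vectors supported on J to nonpositive ones. If d = x y and x t
  is reduced, then y^(-1) e_t = d^(-1) (x e_t) is negative, so y can be rewritten to begin with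
  t.\<close>

lemma longest_prefix:
  assumes "J \<subseteq> S" "longest J d" "x \<in> lists J" "reduced x"
  shows "\<exists>y\<in>lists J. reduced (x @ y) \<and> act (x @ y) = act d"
  using assms(3,4)
proof (induction x rule: rev_induct)
  case Nil
  then show ?case using assms(2) by (auto simp: longest_def)
next
  case (snoc t x)
  have rx: "reduced x" using snoc.prems red_appendD1 by blast
  have tJ: "t \<in> J" "x \<in> lists J" "t \<in> S" using snoc.prems assms(1) by auto
  obtain y where y: "y \<in> lists J" "reduced (x @ y)" "act (x @ y) = act d" using snoc rx tJ by blast
  have dS: "d \<in> lists S" "x \<in> lists S" "y \<in> lists S" using assms(1,2) tJ y(1) by (auto simp: longest_def)
  define b where "b = act x (e t)"
  have nb: "nn b" using red_snoc_iff[OF rx, of t] snoc.prems tJ b_def by simp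
  have "nn (\<lambda>z. - act (rev d) b z)"
  proof (rule act_supported_neg[OF assms(1) _ nb])
    show "b z = 0" if "z \<notin> J" for z
      unfolding b_def using act_e_outside[of x J t z] that tJ by simp
    fix j assume j: "j \<in> J"
    then have "\<not> nn (act (rev d) (e j))" using assms(2) by (simp add: longest_def left_descent_def)
    then show "nn (\<lambda>z. - act (rev d) (e j) z)"
      using root_cases[of "rev d" j] dS j assms(1) by auto
  qed
  moreover have "act (rev d) b = act (rev y) (e t)"
  proof -
    have "act (rev d) = act (rev (x @ y))" using act_rev_cong[of d "x @ y"] y(3) dS by simp
    then show ?thesis using dS by (simp add: b_def)
  qed
  ultimately have "left_descent y t"
    unfolding left_descent_def using not_nn_both[of "rev y" t] dS tJ(3) by auto
  then obtain y' where y': "y' \<in> lists J" "reduced (t # y')" "act (t # y') = act y" "length y = Suc (length y')"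
    using LD_exchange_in[OF assms(1) y(1) red_appendD2[OF y(2)] tJ(3)] by blast
  have a: "act ((x @ [t]) @ y') = act (x @ y)" using y'(3) by (simp add: act_eq_iff)
  have "reduced ((x @ [t]) @ y')"
    using y'(1,4) dS tJ assms(1) by (intro red_cong[OF y(2) _ a]) auto
  then show ?case using a y(3) y'(1) by metis
qed

lemma longest_unique:
  assumes "J \<subseteq> S" "longest J d" "longest J d'"
  shows "act d = act d'"
proof -
  have d: "reduced d" "reduced d'" "d \<in> lists J" "d' \<in> lists J" using assms by (auto simp: longest_def)
  obtain y where y: "reduced (d @ y)" "act (d @ y) = act d'" using longest_prefix[OF assms(1,3)] d by blast
  obtain y' where y': "reduced (d' @ y')" "act (d' @ y') = act d" using longest_prefix[OF assms(1,2)] d by blast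
  have "length (d @ y) = length d'" "length (d' @ y') = length d"
    using red_length y y' d by blast+
  then have "length y = 0" unfolding length_append by linarith
  then have "y = []" by simp
  then show ?thesis using y by simp
qed

lemma longest_max_length:
  "J \<subseteq> S \<Longrightarrow> longest J d \<Longrightarrow> x \<in> lists J \<Longrightarrow> reduced x \<Longrightarrow> length x \<le> length d"
  by (metis longest_prefix longest_def red_length length_append le_add1)

text \<open>The left factor of w in its parabolic decomposition inherits all descents in J, so it is
  the longest element.\<close>

lemma longest_divides:
  assumes "J \<subseteq> S" "reduced w" "\<And>j. j \<in> J \<Longrightarrow> left_descent w j"
  shows "\<exists>d. longest J d"
    and "longest J d \<Longrightarrow> \<exists>y. reduced (d @ y) \<and> act (d @ y) = act w"
proof -
  obtain d0 y where y: "d0 \<in> lists J" "y \<in> lists S" "reduced (d0 @ y)" "act (d0 @ y) = act w"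
      "\<And>j. j \<in> J \<Longrightarrow> \<not> left_descent y j"
    using parabolic_decomposition[OF assms(1) subset_refl red_lists[OF assms(2)] assms(2)] by metis
  have "left_descent d0 j" if "j \<in> J" for j
    using LD_parabolic[OF assms(1) y(1,2,5) that] assms(3)[OF that]
      LD_cong[of "d0 @ y" w j] y red_lists[OF assms(2)] red_lists[OF y(3)] by simp
  then have l0: "longest J d0" using y red_appendD1 by (auto simp: longest_def)
  then show "\<exists>d. longest J d" by blast
  assume l: "longest J d"
  then have d: "reduced d" "d \<in> lists S" using assms(1) by (auto simp: longest_def)
  have "act d = act d0" using longest_unique[OF assms(1) l l0] .
  moreover have "length d = length d0" using red_length[OF d(1) red_appendD1[OF y(3)]] calculation by simp
  ultimately have "act (d @ y) = act (d0 @ y)" "length (d @ y) = length (d0 @ y)"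
    by (simp_all add: act_eq_iff)
  then show "\<exists>y. reduced (d @ y) \<and> act (d @ y) = act w"
    using red_cong[OF y(3), of "d @ y"] d(2) y(2,4) by (intro exI[of _ y]) simp
qed

lemma longest_exists:
  assumes "J \<subseteq> S" "finite (act ` lists J)"
  shows "\<exists>d. longest J d"
proof -
  define L where "L f = (LEAST n. \<exists>x\<in>lists S. act x = f \<and> length x = n)" for f
  have L: "length x = L (act x)" if "reduced x" for x
    unfolding L_def using that
    by (intro Least_equality[symmetric]) (auto simp: reduced_def)
  have "length ` {x \<in> lists J. reduced x} \<subseteq> L ` (act ` lists J)"
    using L by auto
  then have fin: "finite (length ` {x \<in> lists J. reduced x})" using assms(2) finite_surj by blast
  moreover have "[] \<in> {x \<in> lists J. reduced x}" by simp
  then have "length ` {x \<in> lists J. reduced x} \<noteq> {}" by blast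
  ultimately have "Max (length ` {x \<in> lists J. reduced x}) \<in> length ` {x \<in> lists J. reduced x}" by (rule Max_in)
  then obtain d where "d \<in> {x \<in> lists J. reduced x}" "Max (length ` {x \<in> lists J. reduced x}) = length d"
    by (elim imageE) (rule that)
  then have d: "d \<in> lists J" "reduced d" "length d = Max (length ` {x \<in> lists J. reduced x})"
    by simp_all
  have "left_descent d j" if j: "j \<in> J" for j
  proof (rule ccontr)
    assume "\<not> left_descent d j"
    then have "reduced (j # d)" "j # d \<in> lists J" using red_Cons_iff[OF d(2)] j assms(1) d(1) by auto
    then have "length (j # d) \<in> length ` {x \<in> lists J. reduced x}" by (intro imageI) simp
    then have "length (j # d) \<le> Max (length ` {x \<in> lists J. reduced x})"
      using fin by (intro Max_ge)
    then show False using d(3) by simp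
  qed
  then show ?thesis using d by (auto simp: longest_def)
qed

lemma longest_snoc:
  assumes "J \<subseteq> S" "longest J d" "j \<in> J"
  obtains d' where "reduced (d' @ [j])" "act (d' @ [j]) = act d"
proof -
  have d: "reduced d" "d \<in> lists J" "j \<in> S" using assms by (auto simp: longest_def)
  show ?thesis
  proof (cases rule: red_snoc_cases[OF d(1,3), case_names up down])
    case up
    then have "length (d @ [j]) \<le> length d"
      using longest_max_length[OF assms(1,2), of "d @ [j]"] d(2) assms(3) by simp
    then show ?thesis by simp
  next
    case (down w')
    then show ?thesis using that by blast
  qed
qed

subsection \<open>Matsumoto's theorem\<close>

lemma alt_list_not_red:
  assumes "s \<in> S" "t \<in> S" "s \<noteq> t" "m s t = enat n" "n < k"
  shows "\<not> reduced (alt_list s t k)"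
proof
  assume r: "reduced (alt_list s t k)"
  obtain n' where n': "n = Suc n'" using m_ge_2[of s t] assms by (cases n) auto
  have "alt_list s t k = alt_list s t (Suc n) @ (if even (Suc n) then alt_list s t (k - Suc n) else alt_list t s (k - Suc n))"
    using alt_list_add[of s t "Suc n" "k - Suc n"] assms(5) by simp
  then have "reduced (alt_list s t (Suc n))" using r red_appendD1 by metis
  then have r': "reduced (s # alt_list t s n)" by simp
  have "act (s # alt_list t s n) = act (s # alt_list s t n)"
    by (intro act_cong_Cons braid_act[OF assms(1-4), symmetric])
  also have "\<dots> = act (alt_list t s n')"
    using n' assms(1) by (simp add: act_eq_iff)
  finally have "length (s # alt_list t s n) \<le> length (alt_list t s n')"
    using red_le[OF r', of "alt_list t s n'"] assms by simp
  then show False using n' by simp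
qed

lemma LD_alt_list:
  assumes "s \<in> S" "t \<in> S" "s \<noteq> t" "enat k < m s t"
  shows "\<not> left_descent (alt_list s t k) t"
proof -
  have "enat k < m t s" using assms m_sym by simp
  then obtain p q where "p \<ge> 0" "q \<ge> 0" "act (rev (alt_list s t k)) (e t) = (\<lambda>x. p * e t x + q * e s x)"
    using dihedral_pos[of t s k] assms by auto
  then show ?thesis using nn_lin[of "e t" "e s" p q] by (simp add: left_descent_def)
qed

lemma red_alt_list:
  assumes "s \<in> S" "t \<in> S" "s \<noteq> t" "enat k \<le> m s t"
  shows "reduced (alt_list s t k)"
  using assms
proof (induction k arbitrary: s t)
  case (Suc k)
  have k: "enat k < m t s" using Suc.prems m_sym by (metis Suc_ile_eq)
  then have "reduced (alt_list t s k)" using Suc by (metis less_imp_le)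
  moreover have "\<not> left_descent (alt_list t s k) s" using LD_alt_list[OF _ _ _ k] Suc.prems by simp
  ultimately show ?case using red_Cons_iff[of "alt_list t s k" s] Suc.prems by simp
qed simp

text \<open>The dihedral part of w has both descents, whereas an alternating word shorter than
  \<open>m s t\<close> has only one. Hence \<open>m s t\<close> is finite and the dihedral part has
  exactly this length.\<close>

lemma LD_dihedral:
  assumes T: "T \<subseteq> S" and st: "s \<in> T" "t \<in> T" "s \<noteq> t"
    and w: "w \<in> lists T" "reduced w" "left_descent w s" "left_descent w t"
  obtains n y where "m s t = enat n" "y \<in> lists T" "reduced (alt_list s t n @ y)"
    "act (alt_list s t n @ y) = act w"
proof -
  have stS: "s \<in> S" "t \<in> S" using T st by auto
  obtain d y where y: "d \<in> lists {s, t}" "y \<in> lists T" "reduced (d @ y)" "act (d @ y) = act w"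
      "\<And>j. j \<in> {s, t} \<Longrightarrow> \<not> left_descent y j"
    using parabolic_decomposition[of "{s, t}" T w] T st w by auto
  have yS: "y \<in> lists S" using y(2) T by auto
  have LDd: "left_descent d j" if "j \<in> {s, t}" for j
    using LD_parabolic[OF _ y(1) yS y(5) that] LD_cong[OF red_lists[OF y(3)] red_lists[OF w(2)] y(4)]
      that w(3,4) stS by auto
  have rd: "reduced d" using y red_appendD1 by blast
  have "d \<noteq> x @ [a, a] @ z" for x a z using rd red_no_square by metis
  then obtain a b where ab: "{a, b} = {s, t}" "d = alt_list a b (length d)"
    using alternating[OF y(1)] by blast
  have abS: "a \<in> S" "b \<in> S" "a \<noteq> b" "m a b = m s t"
    using ab(1) stS st(3) m_sym by (auto simp: doubleton_eq_iff)
  have "\<not> enat (length d) < m a b"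
    using LD_alt_list[OF abS(1-3)] LDd[of b] ab by (metis insertCI)
  then obtain n where n: "m a b = enat n" "n \<le> length d" by (cases "m a b") auto
  have "length d = n" using alt_list_not_red[OF abS(1-3) n(1), of "length d"] rd ab(2) n(2) by fastforce
  then have d: "d = alt_list a b n" using ab(2) by simp
  have "act (alt_list s t n) = act d"
    using braid_act[OF stS st(3)] n abS(4) ab(1) d by (auto simp: doubleton_eq_iff)
  then have a: "act (alt_list s t n @ y) = act (d @ y)" by (simp add: act_eq_iff)
  have "reduced (alt_list s t n @ y)"
    using d yS stS by (intro red_cong[OF y(3) _ a]) auto
  then show ?thesis using that a y n abS(4) by metis
qed

text \<open>An induction principle for an arbitrary R; the set T allows its use inside a parabolic
  subgroup, as the Coxeter presentation of T requires.\<close>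

lemma matsumoto:
  assumes T: "T \<subseteq> S"
    and R_refl: "\<And>w. w \<in> lists T \<Longrightarrow> R w w"
    and R_trans: "\<And>u v w. R u v \<Longrightarrow> R v w \<Longrightarrow> R u w"
    and R_Cons: "\<And>s u v. s \<in> T \<Longrightarrow> R u v \<Longrightarrow> R (s # u) (s # v)"
    and R_braid: "\<And>s t n y. s \<in> T \<Longrightarrow> t \<in> T \<Longrightarrow> s \<noteq> t \<Longrightarrow> m s t = enat n \<Longrightarrow> y \<in> lists T \<Longrightarrow>
        R (alt_list s t n @ y) (alt_list t s n @ y)"
    and uv: "u \<in> lists T" "v \<in> lists T" "reduced u" "reduced v" "act u = act v"
  shows "R u v"
  using uv
proof (induction "length u" arbitrary: u v rule: less_induct)
  case less
  have len: "length u = length v" using red_length less.prems by blast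
  have tail: "R (s # u') (s # v')"
    if "length (s # u') \<le> length u" "s # u' \<in> lists T" "s # v' \<in> lists T" "reduced (s # u')" "reduced (s # v')"
      "act (s # u') = act (s # v')" for s u' v'
  proof -
    have sS: "s \<in> S" using that(2) T by auto
    have "act u' = act v'"
    proof
      fix x
      have "sg s (act u' x) = sg s (act v' x)" using that(6) by (metis act_Cons)
      then show "act u' x = act v' x" using sS by (metis refl_refl)
    qed
    then have "R u' v'" using less.hyps[of u' v'] that red_ConsD by auto
    then show ?thesis using R_Cons that(2) by simp
  qed
  show ?case
  proof (cases u)
    case Nil
    then show ?thesis using len R_refl[of "[]"] by simp
  next
    case (Cons s u')
    then obtain t v' where v: "v = t # v'" using len by (cases v) auto
    show ?thesis
    proof (cases "s = t")
      case True
      then show ?thesis using tail[of s u' v'] less.prems Cons v by simp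
    next
      case False
      have st: "s \<in> T" "t \<in> T" using less.prems Cons v by auto
      have lds: "left_descent u s" "left_descent u t"
        using LD_Cons[of s u'] LD_Cons[of t v'] LD_cong[OF red_lists red_lists, of u v] less.prems Cons v by auto
      obtain n y where y: "m s t = enat n" "y \<in> lists T" "reduced (alt_list s t n @ y)"
          "act (alt_list s t n @ y) = act u"
        using LD_dihedral[OF T st False less.prems(1,3) lds] by metis
      obtain n' where n': "n = Suc n'" using m_ge_2[of s t] y(1) st T False by (cases n) auto
      have l1: "length (alt_list s t n @ y) = length u" using red_length[OF y(3) less.prems(3) y(4)] .
      have a2: "act (alt_list t s n @ y) = act (alt_list s t n @ y)"
        using braid_act[of s t n, symmetric] st T False y(1) by (intro act_cong_append) auto
      have altT: "alt_list s t n \<in> lists T" "alt_list t s n \<in> lists T" "alt_list s t n' \<in> lists T" "alt_list t s n' \<in> lists T"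
        using st by simp_all
      have r2: "reduced (alt_list t s n @ y)"
        using st T y(2) set_alt_list[of t s n] by (intro red_cong[OF y(3) _ a2]) auto
      \<comment> \<open>Each of u and v is compared with an alternating word that has the same first
        letter, so that only shorter tails remain; one braid move links the two alternating
        words.\<close>
      have "R u (alt_list s t n @ y)"
        using tail[of s u' "alt_list t s n' @ y"] less.prems y st n' Cons by simp
      moreover have "R (alt_list s t n @ y) (alt_list t s n @ y)"
        using R_braid st False y by blast
      moreover have "R (alt_list t s n @ y) v"
        using tail[of t "alt_list s t n' @ y" v'] less.prems y st n' v r2 a2 l1 by simp
      ultimately show ?thesis using R_trans by blast
    qed
  qed
qed

text \<open>The word is cut where the next letter s first spoils reducedness. The reduced prefix x
  then has an expression u s, so rewriting x exposes a square.\<close>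

lemma not_red_square:
  assumes T: "T \<subseteq> S" and w: "w \<in> lists T" "\<not> reduced w"
  obtains x s y u where "w = x @ [s] @ y" "reduced x" "u \<in> lists T" "s \<in> T" "reduced (u @ [s])" "act (u @ [s]) = act x"
proof -
  have "\<exists>x s y. w = x @ [s] @ y \<and> reduced x \<and> \<not> reduced (x @ [s])"
    using w(2)
  proof (induction w rule: rev_induct)
    case (snoc s w)
    show ?case
    proof (cases "reduced w")
      case True
      show ?thesis
        by (rule exI[of _ w], rule exI[of _ s], rule exI[of _ "[]"]) (use True snoc.prems in simp)
    next
      case False
      then obtain x r y where "w = x @ [r] @ y" "reduced x" "\<not> reduced (x @ [r])" using snoc.IH by blast
      then show ?thesis
        by (intro exI[of _ x] exI[of _ r] exI[of _ "y @ [s]"]) simp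
    qed
  qed simp
  then obtain x s y where xs: "w = x @ [s] @ y" "reduced x" "\<not> reduced (x @ [s])" by blast
  have sT: "s \<in> T" "x \<in> lists T" "s \<in> S" using xs w T by auto
  have "left_descent (rev x) s" using red_snoc_iff[OF xs(2) sT(3)] xs(3) by (simp add: left_descent_def)
  then obtain u where u: "u \<in> lists T" "reduced (s # u)" "act (s # u) = act (rev x)"
    using LD_exchange_in[OF T _ _ sT(3), of "rev x"] sT(2) xs(2) rev_lists red_rev by metis
  have "act (rev u @ [s]) = act x"
    using act_rev_cong[of "s # u" "rev x"] u red_lists[OF u(2)] red_lists[OF xs(2)] by simp
  moreover have "reduced (rev u @ [s])" using u(2) red_rev[of "s # u"] by simp
  moreover have "rev u \<in> lists T" using u(1) by simp
  ultimately show ?thesis using that[OF xs(1,2)] sT(1) by blast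
qed

text \<open>The local condition, in terms of roots. Empty words can occur only at the end, since a
  nonempty factor has a left descent and the empty word has no right descent. This lets a chain keep
  a prescribed number of factors.\<close>

fun normal_chain :: "'s list list \<Rightarrow> bool" where
  "normal_chain [] = True"
| "normal_chain [a] = reduced a"
| "normal_chain (a # b # as) = (reduced a \<and> (\<forall>s\<in>S. left_descent b s \<longrightarrow> \<not> nn (act a (e s))) \<and> normal_chain (b # as))"

end

section \<open>Positive roots of a simply laced, triangle-free system\<close>

locale small_type = coxeter_system S m for S :: "'s set" and m +
  assumes small: "s \<in> S \<Longrightarrow> t \<in> S \<Longrightarrow> s \<noteq> t \<Longrightarrow> m s t = 2 \<or> m s t = 3"
    and triangle_free: "s \<in> S \<Longrightarrow> t \<in> S \<Longrightarrow> r \<in> S \<Longrightarrow> m s t = 3 \<Longrightarrow> m s r = 3 \<Longrightarrow> m t r \<noteq> 3"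
begin

lemma kk_2: "m s t = 2 \<Longrightarrow> kk s t = 0"
  by (simp add: kk_def numeral_eq_enat)

lemma kk_3: "m s t = 3 \<Longrightarrow> kk s t = 1"
  by (simp add: kk_def numeral_eq_enat cos_60)

lemma m_ne: "s \<in> S \<Longrightarrow> m s t = 2 \<Longrightarrow> s \<noteq> t" "s \<in> S \<Longrightarrow> m s t = 3 \<Longrightarrow> s \<noteq> t"
  using m_self[of s] by auto

lemma sg_comm:
  assumes "s \<in> S" "t \<in> S" "m s t = 2"
  shows "sg s (sg t v) = sg t (sg s v)"
  using braid_act[of s t 2] m_ne(1)[of s t] assms
  by (auto simp: act_eq_iff numeral_2_eq_2 numeral_eq_enat)

lemma sg_braid:
  assumes "s \<in> S" "t \<in> S" "m s t = 3"
  shows "sg s (sg t (sg s v)) = sg t (sg s (sg t v))"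
  using braid_act[of s t 3] m_ne(2)[of s t] assms
  by (auto simp: act_eq_iff numeral_3_eq_3 numeral_eq_enat)

definition pos_roots :: "('s \<Rightarrow> real) set" where
  "pos_roots = {act w (e s) | w s. w \<in> lists S \<and> s \<in> S \<and> nn (act w (e s))}"

lemma e_pr: "s \<in> S \<Longrightarrow> e s \<in> pos_roots"
  unfolding pos_roots_def by (rule CollectI, rule exI[of _ "[]"]) auto

lemma pr_nn: "b \<in> pos_roots \<Longrightarrow> nn b"
  by (auto simp: pos_roots_def)

lemma pr_bil: "b \<in> pos_roots \<Longrightarrow> bil b b = 2"
  unfolding pos_roots_def using bil_act[of _ "e _" "e _"] bil_e[of _ "e _"] by fastforce

lemma pr_sg:
  assumes "b \<in> pos_roots" "s \<in> S" "b \<noteq> e s"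
  shows "sg s b \<in> pos_roots"
proof -
  obtain w r where w: "w \<in> lists S" "r \<in> S" "nn (act w (e r))" "b = act w (e r)"
    using assms(1) by (auto simp: pos_roots_def)
  have n: "nn (sg s b)" using root_eq_simple[OF w(1,2) assms(2) w(3)] assms(3) w(4) by blast
  show ?thesis unfolding pos_roots_def
    by (rule CollectI, rule exI[of _ "s # w"], rule exI[of _ r]) (use w assms(2) n in auto)
qed

lemma kk_int: "s \<in> S \<Longrightarrow> t \<in> S \<Longrightarrow> kk s t \<in> \<int>"
  using small[of s t] kk_2[of s t] kk_3[of s t] kk_self[of s] by (cases "s = t") auto

lemma ip_int: "s \<in> S \<Longrightarrow> (\<And>x. v x \<in> \<int>) \<Longrightarrow> ip s v \<in> \<int>"
  unfolding ip_def by (intro Ints_minus Ints_sum Ints_mult kk_int) auto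

lemma act_int: "w \<in> lists S \<Longrightarrow> (\<And>x. v x \<in> \<int>) \<Longrightarrow> act w v x \<in> \<int>"
proof (induction w arbitrary: x rule: list.induct)
  case (Cons s w)
  then have "\<And>x. act w v x \<in> \<int>" "s \<in> S" by auto
  then show ?case by (simp add: sg_def ip_int)
qed simp

lemma e_int: "e s x \<in> \<int>"
  by (simp add: e_def)

lemma pr_int: "b \<in> pos_roots \<Longrightarrow> b x \<in> \<int>"
  unfolding pos_roots_def using act_int[of _ "e _", OF _ e_int] by fastforce

text \<open>All entries of \<open>kk\<close> are integers here, so roots have integer coordinates
  and the coordinate sum of a positive root is a natural number on which to recurse.\<close>

definition height :: "('s \<Rightarrow> real) \<Rightarrow> nat" where
  "height b = nat \<lfloor>\<Sum>s\<in>S. b s\<rfloor>"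

lemma sum_sg: "s \<in> S \<Longrightarrow> (\<Sum>x\<in>S. sg s b x) = (\<Sum>x\<in>S. b x) - ip s b"
  using finite_S by (simp add: sg_def sum.remove[of S s])

lemma height_sg:
  assumes "b \<in> pos_roots" "s \<in> S" "ip s b > 0" "b \<noteq> e s"
  shows "height (sg s b) < height b"
proof -
  have i: "(\<Sum>x\<in>S. b x) \<in> \<int>" "ip s b \<in> \<int>"
    using pr_int[OF assms(1)] ip_int[OF assms(2)] by auto
  then obtain k j where k: "(\<Sum>x\<in>S. b x) = of_int k" "ip s b = of_int j" by (auto elim!: Ints_cases)
  have "sg s b \<in> pos_roots" by (rule pr_sg[OF assms(1,2,4)])
  then have "(\<Sum>x\<in>S. sg s b x) \<ge> 0" using pr_nn by (auto simp: nn_def intro!: sum_nonneg)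
  then have *: "of_int (k - j) \<ge> (0::real)" using sum_sg[OF assms(2), of b] k by simp
  have "j > 0" using assms(3) k by simp
  moreover have "k - j \<ge> 0" using * by linarith
  ultimately show ?thesis
    unfolding height_def sum_sg[OF assms(2)] k of_int_diff[symmetric] floor_of_int by simp
qed

text \<open>The norm of b is 2 while its coordinates are nonnegative, so some pairing with a simple
  root must be positive.\<close>

lemma ex_descent:
  assumes "b \<in> pos_roots"
  shows "\<exists>t\<in>S. ip t b > 0"
proof (rule ccontr)
  assume "\<not> ?thesis"
  then have "bil b b \<le> 0"
    unfolding bil_def using pr_nn[OF assms]
    by (intro sum_nonpos) (auto simp: nn_def mult_nonneg_nonpos not_less)
  then show False using pr_bil[OF assms] by simp
qed

lemma sg_e_adj:
  assumes "s \<in> S" "t \<in> S" "m s t = 3"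
  shows "sg s (e t) = sg t (e s)"
proof -
  have "kk s t = 1" "kk t s = 1" using kk_3 assms m_sym by auto
  then show ?thesis using assms m_ne(2)[OF assms(1,3)]
    by (auto simp: refl_as ip_e algebra_simps)
qed

lemma simple_ip_pos: "u \<in> S \<Longrightarrow> z \<in> S \<Longrightarrow> ip z (e u) > 0 \<Longrightarrow> u = z"
  using kk_int[of z u] small[of z u] kk_2[of z u] kk_3[of z u] by (cases "u = z") (auto simp: ip_e)

subsection \<open>The coefficients of the Krammer--Paris representation\<close>

text \<open>Up to normalisation \<open>H b s - 1\<close> below is Paris' polynomial \<open>T(s, b)\<close> at \<open>y = 1/2\<close>, and
  \<open>rhs\<close> is its recursion along a descent \<open>t\<close> of \<open>b\<close>. The value does not depend on the descent
  chosen, which is checked in subsystems of rank 3.\<close>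

definition rhs :: "(('s \<Rightarrow> real) \<Rightarrow> 's \<Rightarrow> real) \<Rightarrow> 's \<Rightarrow> 's \<Rightarrow> ('s \<Rightarrow> real) \<Rightarrow> real" where
  "rhs h s t b = (if m s t = 2 then h (sg t b) s
     else if ip s b + ip t b > 0 then 2 * h (sg s (sg t b)) t
     else if ip s b + ip t b = 0 then 2 * h (sg t b) t - h (sg t b) s
     else h (sg t b) s + 2 * h (sg t b) t)"

definition descent :: "('s \<Rightarrow> real) \<Rightarrow> 's" where
  "descent b = (SOME t. t \<in> S \<and> ip t b > 0)"

lemma descent: "b \<in> pos_roots \<Longrightarrow> descent b \<in> S \<and> ip (descent b) b > 0"
  unfolding descent_def using ex_descent by (intro someI_ex[of "\<lambda>t. t \<in> S \<and> ip t b > 0"]) blast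

text \<open>The last three lines are \<open>rhs\<close> along \<open>descent b\<close>, written out
  so that each recursive call carries the guard under which the height drops. The values on simple
  roots make \<open>H b s - 1\<close> equal to 1 at \<open>e s\<close> and 0 at the others.\<close>

function H :: "('s \<Rightarrow> real) \<Rightarrow> 's \<Rightarrow> real" where
  "H b s = (if b = e s then 2 else if b \<in> e ` S then 1
     else if b \<notin> pos_roots \<or> s \<notin> S \<or> ip s b > 0 then 0
     else if m s (descent b) = 2 then H (sg (descent b) b) s
     else if ip s b + ip (descent b) b > 0 then 2 * H (sg s (sg (descent b) b)) (descent b)
     else if ip s b + ip (descent b) b = 0
       then 2 * H (sg (descent b) b) (descent b) - H (sg (descent b) b) s
     else H (sg (descent b) b) s + 2 * H (sg (descent b) b) (descent b))"
  by pat_completeness auto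
termination
proof (relation "measure (\<lambda>(b, s). height b)")
  have low: "height (sg (descent b) b) < height b" if "b \<notin> e ` S" "b \<in> pos_roots" for b
    using height_sg[of b "descent b"] descent[OF that(2)] that by auto
  then show "\<And>b s. b \<noteq> e s \<Longrightarrow> b \<notin> e ` S \<Longrightarrow> \<not> (b \<notin> pos_roots \<or> s \<notin> S \<or> 0 < ip s b) \<Longrightarrow>
      m s (descent b) = 2 \<Longrightarrow> ((sg (descent b) b, s), (b, s)) \<in> measure (\<lambda>(b, s). height b)"
    by simp
  show "((sg s (sg (descent b) b), descent b), b, s) \<in> measure (\<lambda>(b, s). height b)"
    if h: "b \<notin> e ` S" "\<not> (b \<notin> pos_roots \<or> s \<notin> S \<or> 0 < ip s b)" "m s (descent b) \<noteq> 2"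
      "0 < ip s b + ip (descent b) b" for b s
  proof -
    let ?t = "descent b"
    have t: "?t \<in> S" "ip ?t b > 0" "?t \<noteq> s" "b \<noteq> e ?t" using descent[of b] h by auto
    then have m3: "m s ?t = 3" "m ?t s = 3" using small[of s ?t] h m_sym by auto
    have p: "sg ?t b \<in> pos_roots" using pr_sg t h by blast
    \<comment> \<open>Otherwise b = s_t e_s, whose pairing with s is 1, while \<open>ip s b\<close>
      is not positive here.\<close>
    have "sg ?t b \<noteq> e s"
    proof
      assume "sg ?t b = e s"
      then have "b = sg ?t (e s)" using t(1) by (metis refl_refl)
      moreover have "ip s (sg ?t (e s)) = 1"
        using h t(1) kk_3[OF m3(1)] kk_3[OF m3(2)] by (simp add: ip_refl ip_e kk_self)
      ultimately have "ip s b = 1" by metis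
      then show False using h by simp
    qed
    moreover have "ip s (sg ?t b) = ip s b + ip ?t b" using t h kk_3[OF m3(1)] by (simp add: ip_refl)
    ultimately have "height (sg s (sg ?t b)) < height (sg ?t b)" using height_sg[OF p, of s] h by simp
    then show ?thesis using low[of b] h by simp
  qed
qed (use height_sg descent in auto)

declare H.simps [simp del]

lemma H_self: "s \<in> S \<Longrightarrow> H (e s) s = 2"
  by (subst H.simps) simp

lemma H_simple: "s \<in> S \<Longrightarrow> t \<in> S \<Longrightarrow> s \<noteq> t \<Longrightarrow> H (e t) s = 1"
  by (subst H.simps) (simp add: e_inj)

lemma H_pos: "b \<in> pos_roots \<Longrightarrow> s \<in> S \<Longrightarrow> ip s b > 0 \<Longrightarrow> b \<noteq> e s \<Longrightarrow> H b s = 0"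
  by (subst H.simps) (auto dest: simple_ip_pos)

lemma H_descent:
  assumes "b \<in> pos_roots" "s \<in> S" "b \<notin> e ` S" "ip s b \<le> 0"
  shows "H b s = rhs H s (descent b) b"
  using assms unfolding rhs_def by (subst H.simps) (auto simp: image_iff)


section \<open>Independence of the coefficients from the chosen descent\<close>

definition consistent_below :: "nat \<Rightarrow> bool" where
  "consistent_below N \<longleftrightarrow> (\<forall>d\<in>pos_roots. \<forall>x\<in>S. \<forall>z\<in>S. height d < N \<longrightarrow> ip x d \<le> 0 \<longrightarrow> ip z d > 0 \<longrightarrow> d \<noteq> e z
     \<longrightarrow> H d x = rhs H x z d)"

context
  fixes N :: nat and L :: "('s \<Rightarrow> real) \<Rightarrow> bool"
  assumes cb: "consistent_below N" and L_def: "\<And>d. L d \<longleftrightarrow> d \<in> pos_roots \<and> height d < N"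
begin

lemma Ldown: "L d \<Longrightarrow> z \<in> S \<Longrightarrow> ip z d > 0 \<Longrightarrow> d \<noteq> e z \<Longrightarrow> L (sg z d)"
  unfolding L_def using pr_sg height_sg by (meson order.strict_trans)

lemma IH: "L d \<Longrightarrow> x \<in> S \<Longrightarrow> z \<in> S \<Longrightarrow> ip x d \<le> 0 \<Longrightarrow> ip z d > 0 \<Longrightarrow> d \<noteq> e z \<Longrightarrow> H d x = rhs H x z d"
  using cb unfolding L_def consistent_below_def by blast

lemma IHc: "L d \<Longrightarrow> x \<in> S \<Longrightarrow> z \<in> S \<Longrightarrow> m x z = 2 \<Longrightarrow> ip x d \<le> 0 \<Longrightarrow> ip z d > 0 \<Longrightarrow> d \<noteq> e z \<Longrightarrow>
    H d x = H (sg z d) x"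
  using IH[of d x z] by (simp add: rhs_def)

lemma IHp: "L d \<Longrightarrow> x \<in> S \<Longrightarrow> z \<in> S \<Longrightarrow> m x z = 3 \<Longrightarrow> ip x d \<le> 0 \<Longrightarrow> ip z d > 0 \<Longrightarrow> d \<noteq> e z \<Longrightarrow>
    ip x d + ip z d > 0 \<Longrightarrow> H d x = 2 * H (sg x (sg z d)) z"
  using IH[of d x z] by (simp add: rhs_def)

lemma IH0: "L d \<Longrightarrow> x \<in> S \<Longrightarrow> z \<in> S \<Longrightarrow> m x z = 3 \<Longrightarrow> ip x d \<le> 0 \<Longrightarrow> ip z d > 0 \<Longrightarrow> d \<noteq> e z \<Longrightarrow>
    ip x d + ip z d = 0 \<Longrightarrow> H d x = 2 * H (sg z d) z - H (sg z d) x"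
  using IH[of d x z] by (simp add: rhs_def)

lemma IHn: "L d \<Longrightarrow> x \<in> S \<Longrightarrow> z \<in> S \<Longrightarrow> m x z = 3 \<Longrightarrow> ip x d \<le> 0 \<Longrightarrow> ip z d > 0 \<Longrightarrow> d \<noteq> e z \<Longrightarrow>
    ip x d + ip z d < 0 \<Longrightarrow> H d x = H (sg z d) x + 2 * H (sg z d) z"
  using IH[of d x z] by (simp add: rhs_def)

text \<open>Each use of the recursion must know that the root is not the simple root of the descent;
  one differing pairing is enough to see this.\<close>

lemma ne_e: "y \<in> S \<Longrightarrow> z \<in> S \<Longrightarrow> ip y d \<noteq> - kk y z \<Longrightarrow> d \<noteq> e z"
  using ip_e[of z y] by auto

text \<open>Type A1 x A1 x A1: both sides equal the value at s_r s_t b.\<close>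

lemma consistency_comm:
  assumes S: "s \<in> S" "t \<in> S" "r \<in> S" and M: "m s t = 2" "m s r = 2" "m t r = 2"
    and b: "L (sg t b)" "L (sg r b)" "ip s b \<le> 0" "ip t b > 0" "ip r b > 0"
  shows "rhs H s t b = rhs H s r b"
proof -
  have k: "kk s t = 0" "kk s r = 0" "kk t r = 0" "kk r t = 0"
    using kk_2 M S m_sym by auto
  have ne: "sg r b \<noteq> e t" "sg t b \<noteq> e r"
    using ne_e[of r t "sg r b"] ne_e[of t r "sg t b"] S k b by (auto simp: ip_refl)
  have "H (sg t b) s = H (sg r (sg t b)) s"
    by (rule IHc) (use S M b k ne in \<open>auto simp: ip_refl\<close>)
  moreover have "H (sg r b) s = H (sg t (sg r b)) s"
    by (rule IHc) (use S M b k ne in \<open>auto simp: ip_refl\<close>)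
  ultimately show ?thesis using sg_comm[of t r b] S M by (simp add: rhs_def)
qed

text \<open>Type A1 x A2 with s isolated: \<open>H\<close> at s does not change along descents by t
  and r, and both paths lead to s_t s_r s_t b. If b is the highest root of the A2, they stop at
  simple roots, where the value is 1.\<close>

lemma consistency_comm_A2:
  assumes S: "s \<in> S" "t \<in> S" "r \<in> S" and M: "m s t = 2" "m s r = 2" "m t r = 3"
    and b: "b \<in> pos_roots" "L (sg t b)" "L (sg r b)" "ip s b \<le> 0" "ip t b > 0" "ip r b > 0"
  shows "rhs H s t b = rhs H s r b"
proof -
  have M': "m r t = 3" using M S m_sym by simp
  have k: "kk s t = 0" "kk s r = 0" "kk t r = 1" "kk r t = 1" "kk t t = -2" "kk r r = -2"
    using kk_2 kk_3 kk_self M M' S m_sym by auto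
  have ne: "s \<noteq> t" "s \<noteq> r" using m_ne M S by blast+
  show ?thesis
  proof (cases "sg t b = e r \<or> sg r b = e t")
    case True
    then have "b = sg t (e r) \<or> b = sg r (e t)" using S by (metis refl_refl)
    then have b': "b = sg t (e r)" "b = sg r (e t)" using sg_e_adj[OF S(2,3) M(3)] by auto
    have "sg t b = e r" by (subst b'(1)) (simp add: S)
    moreover have "sg r b = e t" by (subst b'(2)) (simp add: S)
    ultimately show ?thesis using M H_simple[of s t] H_simple[of s r] S ne by (simp add: rhs_def)
  next
    case False
    have Lrt: "L (sg r (sg t b))"
      by (rule Ldown) (use S b k False in \<open>auto simp: ip_refl\<close>)
    have Ltr: "L (sg t (sg r b))"
      by (rule Ldown) (use S b k False in \<open>auto simp: ip_refl\<close>)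
    have ne': "sg r (sg t b) \<noteq> e t" "sg t (sg r b) \<noteq> e r"
      using ne_e[of r t "sg r (sg t b)"] ne_e[of t t "sg r (sg t b)"]
        ne_e[of t r "sg t (sg r b)"] ne_e[of r r "sg t (sg r b)"] S k b
      by (simp_all add: ip_refl) (smt (verit))+
    have "H (sg t b) s = H (sg r (sg t b)) s"
      by (rule IHc) (use S M b k False in \<open>auto simp: ip_refl\<close>)
    moreover have "H (sg r (sg t b)) s = H (sg t (sg r (sg t b))) s"
      by (rule IHc[OF Lrt]) (use S M b k ne' in \<open>auto simp: ip_refl\<close>)
    moreover have "H (sg r b) s = H (sg t (sg r b)) s"
      by (rule IHc) (use S M b k False in \<open>auto simp: ip_refl\<close>)
    moreover have "H (sg t (sg r b)) s = H (sg r (sg t (sg r b))) s"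
      by (rule IHc[OF Ltr]) (use S M b k ne' in \<open>auto simp: ip_refl\<close>)
    ultimately show ?thesis using sg_braid[of t r b] S M by (simp add: rhs_def)
  qed
qed

text \<open>Type A2 x A1 with r isolated: descending by r leaves the pairings with s and t alone, so
  it commutes with each of the three cases of \<open>rhs\<close>.\<close>

lemma consistency_A1A2:
  assumes S: "s \<in> S" "t \<in> S" "r \<in> S" and M: "m s t = 3" "m s r = 2" "m t r = 2"
    and b: "L (sg t b)" "L (sg r b)" "ip s b \<le> 0" "ip t b > 0" "ip r b > 0"
  shows "rhs H s t b = rhs H s r b"
proof -
  have M': "m t s = 3" "m r s = 2" "m r t = 2" using M S m_sym by auto
  have k: "kk s t = 1" "kk t s = 1" "kk s r = 0" "kk r s = 0" "kk t r = 0" "kk r t = 0"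
      "kk s s = -2" "kk t t = -2" "kk r r = -2"
    using kk_2 kk_3 kk_self M M' S by auto
  have tr: "sg r (sg t b) = sg t (sg r b)" using sg_comm M' S by blast
  have sr: "sg r (sg s d) = sg s (sg r d)" for d using sg_comm M' S by blast
  have r: "rhs H s r b = H (sg r b) s" using M by (simp add: rhs_def)
  have ne: "sg r b \<noteq> e t" "sg t b \<noteq> e r"
    using ne_e[of r t "sg r b"] ne_e[of t r "sg t b"] S k b by (auto simp: ip_refl)
  have Ht: "H (sg t b) t = H (sg t (sg r b)) t"
    unfolding tr[symmetric]
    by (rule IHc) (use S M b k ne in \<open>auto simp: ip_refl\<close>)
  consider "ip s b + ip t b > 0" | "ip s b + ip t b = 0" | "ip s b + ip t b < 0" by linarith
  then show ?thesis
  proof cases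
    case 1
    have "sg t b \<noteq> e s"
      using ne_e[of r s "sg t b"] S k b by (auto simp: ip_refl)
    then have Lst: "L (sg s (sg t b))"
      using Ldown[OF b(1), of s] S b k 1 by (simp add: ip_refl)
    have "H (sg r b) s = 2 * H (sg s (sg t (sg r b))) t"
      by (rule IHp) (use S M b k 1 ne in \<open>auto simp: ip_refl\<close>)
    moreover have "sg s (sg t b) \<noteq> e r"
      using ne_e[of s r "sg s (sg t b)"] S k b 1 by (auto simp: ip_refl)
    then have "H (sg s (sg t b)) t = H (sg r (sg s (sg t b))) t"
      by (intro IHc[OF Lst]) (use S M b k 1 in \<open>auto simp: ip_refl\<close>)
    ultimately show ?thesis using 1 M by (simp add: r rhs_def sr tr)
  next
    case 2
    have "H (sg r b) s = 2 * H (sg t (sg r b)) t - H (sg t (sg r b)) s"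
      by (rule IH0) (use S M b k 2 ne in \<open>auto simp: ip_refl\<close>)
    moreover have "H (sg t b) s = H (sg r (sg t b)) s"
      by (rule IHc) (use S M b k 2 ne in \<open>auto simp: ip_refl\<close>)
    ultimately show ?thesis using 2 M Ht by (simp add: r rhs_def tr)
  next
    case 3
    have "H (sg r b) s = H (sg t (sg r b)) s + 2 * H (sg t (sg r b)) t"
      by (rule IHn) (use S M b k 3 ne in \<open>auto simp: ip_refl\<close>)
    moreover have "H (sg t b) s = H (sg r (sg t b)) s"
      by (rule IHc) (use S M b k 3 ne in \<open>auto simp: ip_refl\<close>)
    ultimately show ?thesis using 3 M Ht by (simp add: r rhs_def tr)
  qed
qed

text \<open>Type A3 with s in the middle, where t and r play symmetric roles. The signs of A + B, A
  + C and A + B + C decide which case of \<open>rhs\<close> applies on each path down, and the paths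
  are followed until they meet.\<close>

lemma consistency_A3_middle:
  assumes S: "s \<in> S" "t \<in> S" "r \<in> S" and M: "m s t = 3" "m s r = 3" "m t r = 2"
    and b: "L (sg t b)" "L (sg r b)" "ip s b \<le> 0" "ip t b > 0" "ip r b > 0"
    and le: "ip t b \<le> ip r b"
  shows "rhs H s t b = rhs H s r b"
proof -
  have M': "m t s = 3" "m r s = 3" "m r t = 2" using M S m_sym by auto
  have k: "kk s t = 1" "kk t s = 1" "kk s r = 1" "kk r s = 1" "kk t r = 0" "kk r t = 0"
      "kk s s = -2" "kk t t = -2" "kk r r = -2"
    using kk_2 kk_3 kk_self M M' S by auto
  have tr: "sg r (sg t d) = sg t (sg r d)" for d using sg_comm M' S by blast
  have sts: "sg s (sg t (sg s d)) = sg t (sg s (sg t d))" for d using sg_braid M S by blast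
  have srs: "sg s (sg r (sg s d)) = sg r (sg s (sg r d))" for d using sg_braid M S by blast
  define A B C where "A = ip s b" and "B = ip t b" and "C = ip r b"
  note abc = A_def[symmetric] B_def[symmetric] C_def[symmetric]
  have h: "A \<le> 0" "B > 0" "C > 0" "B \<le> C" using b le by (simp_all add: abc)
  define g where "g = sg t (sg r b)"
  have g: "sg t (sg r b) = g" "sg r (sg t b) = g" using tr g_def by auto
  have ip_t: "ip s (sg t b) = A + B" "ip t (sg t b) = - B" "ip r (sg t b) = C"
    using S k by (simp_all add: ip_refl abc)
  have ip_r: "ip s (sg r b) = A + C" "ip t (sg r b) = B" "ip r (sg r b) = - C"
    using S k by (simp_all add: ip_refl abc)
  have ip_g: "ip s g = A + B + C" "ip t g = - B" "ip r g = - C"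
    using S k by (simp_all add: ip_refl abc g_def)
  have ip_sg: "ip s (sg s g) = - (A + B + C)" "ip t (sg s g) = A + C" "ip r (sg s g) = A + B"
    using S k by (simp_all add: ip_refl ip_g)
  have ne: "sg r b \<noteq> e t" "sg t b \<noteq> e r"
    using ne_e[of r t "sg r b"] ne_e[of t r "sg t b"] S k h ip_r ip_t by auto
  have Lg: "L g" using Ldown[OF b(2), of t] S ip_r h ne by (simp add: g)
  have Htg: "H (sg t b) t = H g t"
    using IHc[OF b(1), of t r] S M ip_t h ne by (simp add: g)
  have Hrg: "H (sg r b) r = H g r"
    using IHc[OF b(2), of r t] S M' ip_r h ne by (simp add: g)
  note R = rhs_def abc M
  show ?thesis
  proof (cases "A + B > 0")
    case True
    have 1: "ip s (sg s (sg t b)) = - (A + B)" "ip t (sg s (sg t b)) = A" "ip r (sg s (sg t b)) = A + B + C"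
      and 2: "ip s (sg s (sg r b)) = - (A + C)" "ip r (sg s (sg r b)) = A" "ip t (sg s (sg r b)) = A + B + C"
      using S k by (simp_all add: ip_refl ip_t ip_r)
    have es: "sg t b \<noteq> e s" "sg r b \<noteq> e s"
      using ne_e[of r s "sg t b"] ne_e[of t s "sg r b"] S k h ip_r ip_t by auto
    have L1: "L (sg s (sg t b))" using Ldown[OF b(1), of s] S ip_t True es by simp
    have L2: "L (sg s (sg r b))" using Ldown[OF b(2), of s] S ip_r True es h by simp
    show ?thesis
    proof (cases "sg s (sg t b) = e r \<or> sg s (sg r b) = e t")
      \<comment> \<open>Here b is the highest root of the A3, so both paths end at simple
        roots.\<close>
      case simple: True
      have "b = sg t (sg s (e r)) \<or> b = sg r (sg s (e t))"
        using simple S by (metis refl_refl)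
      moreover have "sg t (sg s (e r)) = sg r (sg s (e t))"
      proof -
        have "sg t (sg s (e r)) = sg t (sg r (e s))" using sg_e_adj[of s r] S M by simp
        also have "\<dots> = sg r (sg t (e s))" using tr by simp
        finally show ?thesis using sg_e_adj[of s t] S M by simp
      qed
      ultimately have "b = sg t (sg s (e r))" "b = sg r (sg s (e t))" by auto
      then have "sg s (sg t b) = e r" "sg s (sg r b) = e t" using S by (metis refl_refl)+
      moreover have "H (e r) t = 1" "H (e t) r = 1" using H_simple S m_ne M M' by blast+
      ultimately show ?thesis using True h by (simp add: R)
    next
      case False
      have L1': "L (sg r (sg s (sg t b)))" using Ldown[OF L1, of r] S 1 True h False by simp
      have L2': "L (sg t (sg s (sg r b)))" using Ldown[OF L2, of t] S 2 True h False by simp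
      have a: "H (sg s (sg t b)) t = H (sg r (sg s (sg t b))) t"
        using IHc[OF L1, of t r] S M 1 True h False by simp
      have a': "H (sg s (sg r b)) r = H (sg t (sg s (sg r b))) r"
        using IHc[OF L2, of r t] S M' 2 True h False by simp
      have 3: "ip t (sg r (sg s (sg t b))) = A" "ip s (sg r (sg s (sg t b))) = C"
           "ip r (sg r (sg s (sg t b))) = - (A + B + C)"
        and 4: "ip r (sg t (sg s (sg r b))) = A" "ip s (sg t (sg s (sg r b))) = B"
           "ip t (sg t (sg s (sg r b))) = - (A + B + C)"
        using S k 1 2 by (simp_all add: ip_refl)
      have "sg r (sg s (sg t b)) \<noteq> e s" "sg t (sg s (sg r b)) \<noteq> e s"
        using ne_e[of s s "sg r (sg s (sg t b))"] ne_e[of t s "sg r (sg s (sg t b))"]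
          ne_e[of r s "sg r (sg s (sg t b))"] ne_e[of s s "sg t (sg s (sg r b))"]
          ne_e[of t s "sg t (sg s (sg r b))"] ne_e[of r s "sg t (sg s (sg r b))"] S k 3 4 h True
        by (smt (verit))+
      then have "H (sg r (sg s (sg t b))) t = 2 * H (sg t (sg s (sg r (sg s (sg t b))))) s"
          "H (sg t (sg s (sg r b))) r = 2 * H (sg r (sg s (sg t (sg s (sg r b))))) s"
        using IHp[OF L1', of t s] IHp[OF L2', of r s] S M' 3 4 h True by auto
      moreover have "sg t (sg s (sg r (sg s (sg t b)))) = sg r (sg s (sg t (sg s (sg r b))))"
        by (simp add: srs sts tr)
      ultimately show ?thesis using a a' True h by (simp add: R)
    qed
  next
    case ABle: False
    \<comment> \<open>From here on paths pass through g. \<open>D\<close> is the pairing of g with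
      s, and its sign selects the case of \<open>rhs\<close> on the way down to g.\<close>
    define D where "D = A + B + C"
    have eq_s: "g \<noteq> e s"
      using ne_e[of s s g] ne_e[of t s g] ne_e[of r s g] S k ip_g h ABle by (smt (verit))
    have Hst: "H (sg t b) s = (if D > 0 then 2 * H (sg s g) r
        else if D = 0 then 2 * H g r - H g s else H g s + 2 * H g r)"
      using IH[OF b(1), of s r] S M ip_t h ABle ne by (simp add: rhs_def g D_def)
    have Lsg: "L (sg s g)" if "D > 0" using Ldown[OF Lg, of s] S ip_g eq_s that D_def by simp
    have Hgt: "H g t = (if A + C > 0 then 2 * H (sg t (sg s g)) s
        else if A + C = 0 then 2 * H (sg s g) s - H (sg s g) t else H (sg s g) t + 2 * H (sg s g) s)"
      if "D > 0" using IH[OF Lg, of t s] S M' ip_g h eq_s that by (simp add: rhs_def D_def)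
    have Hgr: "H g r = (if A + B = 0 then 2 * H (sg s g) s - H (sg s g) r
        else H (sg s g) r + 2 * H (sg s g) s)"
      if "D > 0" using IH[OF Lg, of r s] S M' ip_g h eq_s that ABle by (simp add: rhs_def D_def)
    show ?thesis
    proof (cases "A + C > 0")
      case False
      have Hsr: "H (sg r b) s = (if D > 0 then 2 * H (sg s g) t
        else if D = 0 then 2 * H g t - H g s else H g s + 2 * H g t)"
        using IH[OF b(2), of s t] S M ip_r h False ne by (simp add: rhs_def g D_def ac_simps)
      have "A + B = 0 \<longrightarrow> A + C = 0" using ABle False h by linarith
      moreover have "A + C = 0 \<longrightarrow> D > 0" "A + B = 0 \<longrightarrow> D > 0" using h D_def by auto
      ultimately show ?thesis using ABle False Hst Hsr Htg Hrg Hgt Hgr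
        by (auto simp: R)
    next
      case ACpos: True
      have D: "D > 0" using ACpos h D_def by simp
      have es: "sg r b \<noteq> e s"
        using ne_e[of t s "sg r b"] S k h ip_r by auto
      have L2: "L (sg s (sg r b))" using Ldown[OF b(2), of s] S ip_r es ACpos by simp
      have 2: "ip s (sg s (sg r b)) = - (A + C)" "ip r (sg s (sg r b)) = A" "ip t (sg s (sg r b)) = D"
        using S k by (simp_all add: ip_refl ip_r D_def)
      have n2: "sg s (sg r b) \<noteq> e t"
        using ne_e[of s t "sg s (sg r b)"] ne_e[of t t "sg s (sg r b)"] ne_e[of r t "sg s (sg r b)"]
          S k 2 h ABle D_def by (smt (verit))
      have a: "H (sg s (sg r b)) r = H (sg t (sg s (sg r b))) r"
        using IHc[OF L2, of r t] S M' 2 h n2 D by simp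
      have L3: "L (sg t (sg s (sg r b)))" using Ldown[OF L2, of t] S 2 D n2 by simp
      have 3: "ip s (sg t (sg s (sg r b))) = B" "ip r (sg t (sg s (sg r b))) = A" "ip t (sg t (sg s (sg r b))) = - D"
        using S k 2 by (simp_all add: ip_refl D_def)
      have n3: "sg t (sg s (sg r b)) \<noteq> e s"
        using ne_e[of s s "sg t (sg s (sg r b))"] ne_e[of t s "sg t (sg s (sg r b))"]
          ne_e[of r s "sg t (sg s (sg r b))"] S k 3 h ABle by (smt (verit))
      have eq: "sg s (sg t (sg s (sg r b))) = sg t (sg s g)" by (simp add: sts g_def)
      have c: "H (sg t (sg s (sg r b))) r = (if A + B = 0 then 2 * H (sg t (sg s g)) s - H (sg t (sg s g)) r
           else H (sg t (sg s g)) r + 2 * H (sg t (sg s g)) s)"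
        using IH[OF L3, of r s] S M' 3 n3 h ABle by (simp add: rhs_def eq)
      have n4: "sg s g \<noteq> e t"
        using ne_e[of s t "sg s g"] ne_e[of t t "sg s g"] ne_e[of r t "sg s g"] S k ip_sg h ABle
        by (smt (verit))
      have d: "H (sg s g) r = H (sg t (sg s g)) r"
        using IHc[OF Lsg[OF D], of r t] S M' ip_sg n4 ACpos ABle by simp
      show ?thesis
        using ABle ACpos D Hst Htg Hgt[OF D] a c d by (auto simp: R)
    qed
  qed
qed

text \<open>Type A3 with t in the middle and s at an end. As s and r commute, the right side is a
  single value of \<open>H\<close>; apart from the case of simple roots, both sides are compared
  through g = s_t s_r s_t b and the roots below it.\<close>

lemma consistency_A3_end:
  assumes S: "s \<in> S" "t \<in> S" "r \<in> S" and M: "m s t = 3" "m s r = 2" "m t r = 3"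
    and b: "L (sg t b)" "L (sg r b)" "ip s b \<le> 0" "ip t b > 0" "ip r b > 0"
  shows "rhs H s t b = rhs H s r b"
proof -
  have M': "m t s = 3" "m r s = 2" "m r t = 3" using M S m_sym by auto
  have k: "kk s t = 1" "kk t s = 1" "kk s r = 0" "kk r s = 0" "kk t r = 1" "kk r t = 1"
      "kk s s = -2" "kk t t = -2" "kk r r = -2"
    using kk_2 kk_3 kk_self M M' S by auto
  have sr: "sg r (sg s d) = sg s (sg r d)" for d using sg_comm M' S by blast
  have sts: "sg s (sg t (sg s d)) = sg t (sg s (sg t d))" for d using sg_braid M S by blast
  have trt: "sg r (sg t (sg r d)) = sg t (sg r (sg t d))" for d using sg_braid M' S by blast
  define A B C where "A = ip s b" and "B = ip t b" and "C = ip r b"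
  note abc = A_def[symmetric] B_def[symmetric] C_def[symmetric]
  have h: "A \<le> 0" "B > 0" "C > 0" using b by (simp_all add: abc)
  define D where "D = A + B + C"
  define g where "g = sg t (sg r (sg t b))"
  have g: "sg t (sg r (sg t b)) = g" "sg r (sg t (sg r b)) = g" using trt g_def by auto
  have ip_t: "ip s (sg t b) = A + B" "ip t (sg t b) = - B" "ip r (sg t b) = B + C"
    using S k by (simp_all add: ip_refl abc)
  have ip_r: "ip s (sg r b) = A" "ip t (sg r b) = B + C" "ip r (sg r b) = - C"
    using S k by (simp_all add: ip_refl abc)
  have ip_rt: "ip s (sg r (sg t b)) = A + B" "ip t (sg r (sg t b)) = C" "ip r (sg r (sg t b)) = - (B + C)"
    using S k by (simp_all add: ip_refl ip_t)
  have ip_tr: "ip s (sg t (sg r b)) = D" "ip t (sg t (sg r b)) = - (B + C)" "ip r (sg t (sg r b)) = B"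
    using S k by (simp_all add: ip_refl ip_r D_def)
  have ip_g: "ip s g = D" "ip t g = - C" "ip r g = - B"
    using S k by (simp_all add: ip_refl ip_rt D_def g_def)
  have Rr: "rhs H s r b = H (sg r b) s" using M by (simp add: rhs_def)
  note R = rhs_def abc M Rr
  show ?thesis
  proof (cases "sg r b = e t \<or> sg t b = e r")
    case True
    then have "b = sg t (e r) \<or> b = sg r (e t)" using S by (metis refl_refl)
    then have b': "b = sg t (e r)" "b = sg r (e t)" using sg_e_adj[OF S(2,3) M(3)] by auto
    have s1: "sg t b = e r" by (subst b'(1)) (simp add: S)
    have s2: "sg r b = e t" by (subst b'(2)) (simp add: S)
    have "A + B = ip s (e r)" using ip_t(1) s1 by simp
    then have "A + B = 0" using S k by (simp add: ip_e)
    moreover have "H (e r) t = 1" "H (e r) s = 1" "H (e t) s = 1"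
      using H_simple S m_ne M M' by blast+
    ultimately show ?thesis by (simp add: R s1 s2)
  next
    case False
    then have ne: "sg r b \<noteq> e t" "sg t b \<noteq> e r" by auto
    have Lrt: "L (sg r (sg t b))" using Ldown[OF b(1), of r] S ip_t h ne by simp
    have Ltr: "L (sg t (sg r b))" using Ldown[OF b(2), of t] S ip_r h ne by simp
    have n1: "sg r (sg t b) \<noteq> e t" "sg t (sg r b) \<noteq> e r"
      using ne_e[of t t "sg r (sg t b)"] ne_e[of r t "sg r (sg t b)"]
        ne_e[of t r "sg t (sg r b)"] ne_e[of r r "sg t (sg r b)"] S k ip_rt ip_tr h by (smt (verit))+
    have Lg: "L g" using Ldown[OF Lrt, of t] S ip_rt h n1 by (simp add: g)
    have n2: "g \<noteq> e s" using ne_e[of t s g] ne_e[of r s g] S k ip_g h by auto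
    have Htr: "H (sg t b) t = 2 * H g r"
      using IHp[OF b(1), of t r] S M ip_t h ne by (simp add: g)
    have Hsr: "H (sg r b) s = (if D > 0 then 2 * H (sg s (sg t (sg r b))) t
        else if D = 0 then 2 * H (sg t (sg r b)) t - H (sg t (sg r b)) s
        else H (sg t (sg r b)) s + 2 * H (sg t (sg r b)) t)"
      using IH[OF b(2), of s t] S M ip_r h ne by (simp add: rhs_def D_def ac_simps)
    have Htr': "H (sg t (sg r b)) t = H g t + 2 * H g r"
      using IHn[OF Ltr, of t r] S M ip_tr h n1 by (simp add: g)
    have Hstr': "H (sg t (sg r b)) s = H g s" if "D \<le> 0"
      using IHc[OF Ltr, of s r] S M ip_tr h n1 that by (simp add: g)
    have Hgr: "H g r = H (sg s g) r" if "D > 0"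
      using IHc[OF Lg, of r s] S M' ip_g h n2 that by simp
    have n3: "sg t (sg r b) \<noteq> e s"
      using ne_e[of t s "sg t (sg r b)"] ne_e[of r s "sg t (sg r b)"] S k ip_tr h by auto
    have Lstr: "L (sg s (sg t (sg r b)))" if "D > 0"
      using Ldown[OF Ltr, of s] S ip_tr n3 that by simp
    have ip_str: "ip s (sg s (sg t (sg r b))) = - D" "ip t (sg s (sg t (sg r b))) = A"
        "ip r (sg s (sg t (sg r b))) = B"
      using S k by (simp_all add: ip_refl ip_tr D_def)
    have n4: "sg s (sg t (sg r b)) \<noteq> e r" if "D > 0"
      using ne_e[of s r "sg s (sg t (sg r b))"] S k ip_str that by auto
    have rstr: "sg r (sg s (sg t (sg r b))) = sg s g" by (simp add: sr g)
    have Hstr: "H (sg s (sg t (sg r b))) t = (if A + B > 0 then 2 * H (sg t (sg s g)) r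
        else if A + B = 0 then 2 * H (sg s g) r - H (sg s g) t else H (sg s g) t + 2 * H (sg s g) r)"
      if "D > 0"
      using IH[OF Lstr[OF that], of t r] S M ip_str h n4[OF that] by (simp add: rhs_def rstr)
    show ?thesis
    proof (cases "A + B > 0")
      case True
      have D: "D > 0" using True h D_def by simp
      have n5: "sg t b \<noteq> e s" using ne_e[of r s "sg t b"] S k ip_t h by auto
      have Lst: "L (sg s (sg t b))" using Ldown[OF b(1), of s] S ip_t n5 True by simp
      have ip_st: "ip s (sg s (sg t b)) = - (A + B)" "ip t (sg s (sg t b)) = A" "ip r (sg s (sg t b)) = B + C"
        using S k by (simp_all add: ip_refl ip_t)
      have n6: "sg s (sg t b) \<noteq> e r" using ne_e[of s r "sg s (sg t b)"] S k ip_st True by auto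
      have a: "H (sg s (sg t b)) t = 2 * H (sg t (sg r (sg s (sg t b)))) r"
        using IHp[OF Lst, of t r] S M ip_st h n6 True by simp
      have Lrst: "L (sg r (sg s (sg t b)))" using Ldown[OF Lst, of r] S ip_st n6 h by simp
      have ip_rst: "ip s (sg r (sg s (sg t b))) = - (A + B)" "ip t (sg r (sg s (sg t b))) = D"
          "ip r (sg r (sg s (sg t b))) = - (B + C)"
        using S k by (simp_all add: ip_refl ip_st D_def)
      have n7: "sg r (sg s (sg t b)) \<noteq> e t"
        using ne_e[of s t "sg r (sg s (sg t b))"] ne_e[of t t "sg r (sg s (sg t b))"]
          ne_e[of r t "sg r (sg s (sg t b))"] S k ip_rst True h D_def by (smt (verit))
      have Ltrst: "L (sg t (sg r (sg s (sg t b))))" using Ldown[OF Lrst, of t] S ip_rst n7 D by simp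
      have ip_trst: "ip s (sg t (sg r (sg s (sg t b)))) = C" "ip t (sg t (sg r (sg s (sg t b)))) = - D"
          "ip r (sg t (sg r (sg s (sg t b)))) = A"
        using S k by (simp_all add: ip_refl ip_rst D_def)
      have n8: "sg t (sg r (sg s (sg t b))) \<noteq> e s"
        using ne_e[of s s "sg t (sg r (sg s (sg t b)))"] ne_e[of t s "sg t (sg r (sg s (sg t b)))"]
          ne_e[of r s "sg t (sg r (sg s (sg t b)))"] S k ip_trst True h D_def by (smt (verit))
      have c: "H (sg t (sg r (sg s (sg t b)))) r = H (sg s (sg t (sg r (sg s (sg t b))))) r"
        using IHc[OF Ltrst, of r s] S M' ip_trst h n8 by simp
      have "sg s (sg t (sg r (sg s (sg t b)))) = sg t (sg s g)"
        by (simp add: sr sts g_def)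
      then show ?thesis using True D Hsr Hstr[OF D] a c by (simp add: R)
    next
      case ABle: False
      have Hs: "H (sg t b) s = H (sg r (sg t b)) s"
        using IHc[OF b(1), of s r] S M ip_t h ne ABle by simp
      have Hs': "H (sg r (sg t b)) s = (if D > 0 then 2 * H (sg s g) t
        else if D = 0 then 2 * H g t - H g s else H g s + 2 * H g t)"
        using IH[OF Lrt, of s t] S M ip_rt h n1 ABle by (simp add: rhs_def D_def g ac_simps)
      have "A + B = 0 \<longrightarrow> D > 0" using h D_def by auto
      then show ?thesis using ABle Hs Hs' Htr Hsr Htr' Hstr' Hgr Hstr
        by (cases "D > 0"; cases "D = 0"; cases "A + B = 0") (simp_all add: R)
    qed
  qed
qed

end


text \<open>Up to exchanging t and r, the preceding lemmas cover all types of {s, t, r} except the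
  triangle, of type affine A2, which \<open>triangle_free\<close> excludes.\<close>

lemma consistency:
  assumes cb: "consistent_below N" and L_def: "\<And>d. L d \<longleftrightarrow> d \<in> pos_roots \<and> height d < N"
    and S: "s \<in> S" "t \<in> S" "r \<in> S"
    and b: "b \<in> pos_roots" "L (sg t b)" "L (sg r b)" "ip s b \<le> 0" "ip t b > 0" "ip r b > 0"
  shows "rhs H s t b = rhs H s r b"
proof (cases "t = r")
  case False
  have ne: "s \<noteq> t" "s \<noteq> r" using b by auto
  note c = cb L_def
  note sym = m_sym[OF S(1,2)] m_sym[OF S(1,3)] m_sym[OF S(2,3)]
  consider "m s t = 2" "m s r = 2" | "m s t = 3" "m s r = 2" | "m s t = 2" "m s r = 3"
    | "m s t = 3" "m s r = 3"
    using small S ne by blast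
  then show ?thesis
  proof cases
    case 1
    then show ?thesis using small[OF S(2,3) False] consistency_comm[OF c S 1 _ b(2-6)]
      consistency_comm_A2[OF c S 1 _ b] by blast
  next
    case 2
    then show ?thesis using small[OF S(2,3) False] consistency_A1A2[OF c S 2 _ b(2-6)]
      consistency_A3_end[OF c S 2 _ b(2-6)] by blast
  next
    case 3
    then show ?thesis
      using small[OF S(2,3) False] consistency_A1A2[OF c S(1,3,2) 3(2,1) _ b(3,2,4,6,5)]
        consistency_A3_end[OF c S(1,3,2) 3(2,1) _ b(3,2,4,6,5)] sym by metis
  next
    case 4
    have "m t r = 2" "m r t = 2"
      using triangle_free[OF S 4] small[OF S(2,3) False] sym by auto
    then show ?thesis
      using consistency_A3_middle[OF c S 4 _ b(2-6)]
        consistency_A3_middle[OF c S(1,3,2) 4(2,1) _ b(3,2,4,6,5)] by linarith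
  qed
qed simp

lemma consistent_all: "consistent_below N"
proof (induction N)
  case 0
  show ?case by (simp add: consistent_below_def)
next
  case (Suc N)
  show ?case unfolding consistent_below_def
  proof (intro ballI impI)
    fix d x z
    assume d: "d \<in> pos_roots" "x \<in> S" "z \<in> S" "height d < Suc N" "ip x d \<le> 0" "0 < ip z d" "d \<noteq> e z"
    let ?r = "descent d"
    have r: "?r \<in> S" "ip ?r d > 0" using descent[OF d(1)] by auto
    have ns: "d \<notin> e ` S" using simple_ip_pos[of _ z] d by auto
    then have nr: "d \<noteq> e ?r" using r by auto
    have "H d x = rhs H x ?r d" by (rule H_descent[OF d(1,2) ns d(5)])
    also have "\<dots> = rhs H x z d"
    proof (rule consistency[OF Suc HOL.refl d(2) r(1) d(3) d(1) _ _ d(5) r(2) d(6)])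
      show "sg ?r d \<in> pos_roots \<and> height (sg ?r d) < N"
        using pr_sg[OF d(1) r(1) nr] height_sg[OF d(1) r nr] d(4) by simp
      show "sg z d \<in> pos_roots \<and> height (sg z d) < N"
        using pr_sg[OF d(1,3,7)] height_sg[OF d(1,3,6,7)] d(4) by simp
    qed
    finally show "H d x = rhs H x z d" .
  qed
qed

lemma H_rule:
  assumes "b \<in> pos_roots" "s \<in> S" "t \<in> S" "ip s b \<le> 0" "ip t b > 0" "b \<noteq> e t"
  shows "H b s = rhs H s t b"
  using consistent_all[of "Suc (height b)"] assms unfolding consistent_below_def by blast

text \<open>Serves the case of \<open>A_H_3\<close> in which b is orthogonal to both roots and
  offers no descent along s or t. A third descent r is used, adjacent to at most one of s and t
  because there are no triangles.\<close>

lemma H_orthogonal: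
  assumes "b \<in> pos_roots" "s \<in> S" "t \<in> S" "m s t = 3" "ip s b = 0" "ip t b = 0"
  shows "H b s = H b t"
  using assms
proof (induction "height b" arbitrary: b s t rule: less_induct)
  case less
  note S = less.prems(2,3) and st = less.prems(4)
  have ts: "m t s = 3" using S st m_sym by simp
  obtain r where r: "r \<in> S" "ip r b > 0" using ex_descent less.prems by blast
  have ne: "r \<noteq> s" "r \<noteq> t" "s \<noteq> t" using r less.prems m_ne by auto
  have *: "H b s = H b t" if S: "s \<in> S" "t \<in> S" and st: "m s t = 3" "m t s = 3" and ip: "ip s b = 0" "ip t b = 0"
    and sr: "m s r = 3" and ne: "r \<noteq> t" and nb: "b \<noteq> e r" for s t
  proof -
    have "m t r = 2" using triangle_free[OF S(1,2) r(1) st(1) sr] small[OF S(2) r(1)] ne by auto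
    then have M: "m r s = 3" "m t r = 2" "m r t = 2" using m_sym S r sr by auto
    have k: "kk s t = 1" "kk t s = 1" "kk s r = 1" "kk r s = 1" "kk t r = 0" "kk r t = 0"
      "kk s s = -2" "kk t t = -2" "kk r r = -2"
      using kk_2 kk_3 kk_self M st sr S r by auto
    define B where "B = ip r b"
    have B: "B > 0" using r B_def by simp
    have p1: "sg r b \<in> pos_roots" "height (sg r b) < height b"
      using pr_sg height_sg less.prems r nb by blast+
    have i1: "ip s (sg r b) = B" "ip t (sg r b) = 0" "ip r (sg r b) = - B"
      using S r k ip by (simp_all add: ip_refl B_def)
    have n1: "sg r b \<noteq> e s" using i1 k S r by (auto simp: ip_e)
    have p2: "sg s (sg r b) \<in> pos_roots" "height (sg s (sg r b)) < height b"
      using pr_sg[OF p1(1) S(1) n1] height_sg[OF p1(1) S(1) _ n1] i1 B p1(2) by auto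
    have i2: "ip s (sg s (sg r b)) = - B" "ip t (sg s (sg r b)) = B" "ip r (sg s (sg r b)) = 0"
      using S r k i1 by (simp_all add: ip_refl)
    have n2: "sg s (sg r b) \<noteq> e t"
    proof
      assume "sg s (sg r b) = e t"
      then have "ip s (e t) = - B" "ip t (e t) = B" using i2 by metis+
      then show False using k S by (simp add: ip_e)
    qed
    have p3: "sg t (sg s (sg r b)) \<in> pos_roots" "height (sg t (sg s (sg r b))) < height b"
      using pr_sg[OF p2(1) S(2) n2] height_sg[OF p2(1) S(2) _ n2] i2 B p2(2) by auto
    have i3: "ip s (sg t (sg s (sg r b))) = 0" "ip r (sg t (sg s (sg r b))) = 0"
      using S r k i2 by (simp_all add: ip_refl)
    \<comment> \<open>Descending along r, s, t one reaches a root orthogonal to s and r, to which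
      the induction hypothesis for this pair applies; the recursion for t then leads back to
      b.\<close>
    have "H b s = 2 * H (sg s (sg r b)) r"
      using H_rule[of b s r] less.prems(1) S r ip sr nb by (simp add: rhs_def)
    also have "H (sg s (sg r b)) r = H (sg t (sg s (sg r b))) r"
      using H_rule[of "sg s (sg r b)" r t] p2 S r M i2 B n2 by (simp add: rhs_def)
    also have "\<dots> = H (sg t (sg s (sg r b))) s"
      using less.hyps[OF p3(2) p3(1) S(1) r(1) sr i3] by simp
    also have "2 * \<dots> = H (sg r b) t"
      using H_rule[of "sg r b" t s] p1 S r st i1 B n1 by (simp add: rhs_def)
    also have "\<dots> = H b t"
      using H_rule[of b t r] less.prems(1) S r ip M nb by (simp add: rhs_def)
    finally show ?thesis .
  qed
  show ?case
  proof (cases "b = e r")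
    case True
    then show ?thesis using H_simple r S ne by simp
  next
    case False
    consider "m s r = 3" | "m t r = 3" | "m s r = 2" "m t r = 2"
      using small S r ne by blast
    then show ?thesis
    proof cases
      case 1
      then show ?thesis using * S st ts less.prems ne False by blast
    next
      case 2
      then show ?thesis using *[of t s] S st ts less.prems ne False by simp
    next
      case 3
      then have k: "kk s r = 0" "kk t r = 0" using kk_2 by auto
      have p1: "sg r b \<in> pos_roots" "height (sg r b) < height b"
        using pr_sg height_sg less.prems r False by blast+
      have "H b s = H (sg r b) s" "H b t = H (sg r b) t"
        using H_rule[of b s r] H_rule[of b t r] less.prems r 3 False by (simp_all add: rhs_def)
      moreover have "H (sg r b) s = H (sg r b) t"
        using less.hyps[OF p1(2) p1(1) S st] less.prems r k by (simp add: ip_refl)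
      ultimately show ?thesis by simp
    qed
  qed
qed

section \<open>The operators and their braid relations\<close>

text \<open>The operators \<open>K x s\<close> are the duals of the Krammer--Paris operators on the span of the
  positive roots, for Paris' parameter \<open>y = 1/2\<close> and in the basis rescaled by \<open>2\<close> to the depth.\<close>

definition A :: "'s \<Rightarrow> (('s \<Rightarrow> real) \<Rightarrow> real) \<Rightarrow> ('s \<Rightarrow> real) \<Rightarrow> real" where
  "A s u b = (if b = e s then 0 else if ip s b = 0 then u b else if ip s b > 0 then u (sg s b)
     else (u b + u (sg s b)) / 2)"

definition K :: "real \<Rightarrow> 's \<Rightarrow> (('s \<Rightarrow> real) \<Rightarrow> real) \<Rightarrow> ('s \<Rightarrow> real) \<Rightarrow> real" where
  "K x s u = (\<lambda>b. if b \<in> pos_roots then A s u b + x * (H b s - 1) * u (e s) else u b)"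

text \<open>For commuting s and t the value of \<open>H\<close> at s is invariant under the
  reflection in t. This makes the terms in x of \<open>K_comm\<close> agree.\<close>

lemma A_H_2:
  assumes "b \<in> pos_roots" "s \<in> S" "t \<in> S" "m s t = 2"
  shows "A t (\<lambda>b. H b s - 1) b = H b s - 1"
proof -
  have ne: "s \<noteq> t" using m_ne assms by auto
  have k: "kk s t = 0" "kk t s = 0" using kk_2 assms m_sym by auto
  have inv: "H c s = H (sg t c) s" if "c \<in> pos_roots" "ip t c > 0" "c \<noteq> e t" for c
  proof (cases "ip s c \<le> 0")
    case True
    then show ?thesis using H_rule[of c s t] that assms by (simp add: rhs_def)
  next
    case False
    have "sg t c \<in> pos_roots" using pr_sg that assms by blast
    moreover have "ip s (sg t c) > 0" using False k assms by (simp add: ip_refl)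
    moreover have "sg t c \<noteq> e s"
    proof
      assume eq: "sg t c = e s"
      have "ip t (sg t c) = - ip t c" using assms by simp
      then have "ip t c = 0" unfolding eq using assms k by (simp add: ip_e)
      then show False using that by simp
    qed
    moreover have "c \<noteq> e s" using that assms k by (auto simp: ip_e)
    ultimately show ?thesis using H_pos[of c s] H_pos[of "sg t c" s] False that assms by simp
  qed
  show ?thesis
  proof (cases "b = e t")
    case True
    then show ?thesis using H_simple assms ne by (simp add: A_def)
  next
    case False
    have "H (sg t b) s = H b s" if "ip t b < 0"
    proof -
      have "sg t b \<noteq> e t"
      proof
        assume eq: "sg t b = e t"
        have "b = sg t (sg t b)" using assms(3) by simp
        also have "\<dots> = (\<lambda>x. - e t x)" unfolding eq using assms(3) by (rule refl_e_self)
        finally have "b t = -1" by simp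
        then show False using pr_nn[OF assms(1)] unfolding nn_def by (metis neg_0_le_iff_le not_one_le_zero)
      qed
      then show ?thesis using inv[of "sg t b"] pr_sg assms False that by simp
    qed
    then show ?thesis using inv[of b] assms False by (auto simp: A_def)
  qed
qed

lemma pr_sg_ne:
  assumes "b \<in> pos_roots" "t \<in> S"
  shows "sg t b \<noteq> e t"
proof
  assume eq: "sg t b = e t"
  have "b = sg t (sg t b)" using assms(2) by simp
  also have "\<dots> = (\<lambda>x. - e t x)" unfolding eq using assms(2) by (rule refl_e_self)
  finally have "b t = -1" by simp
  then show False using pr_nn[OF assms(1)] unfolding nn_def by (metis neg_0_le_iff_le not_one_le_zero)
qed

lemma sg_ip_0: "ip s b = 0 \<Longrightarrow> sg s b = b"
  by (simp add: sg_def)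

text \<open>The identity that makes the terms in x of the braid relation symmetric in s and t. After
  ordering the two pairings by symmetry, the cases are the signs of the pairings and of their sum,
  matching those of \<open>rhs\<close>.\<close>

lemma A_H_3:
  assumes b: "b \<in> pos_roots" and S: "s \<in> S" "t \<in> S" and m: "m s t = 3"
  shows "A t (\<lambda>b. H b s - 1) b = A s (\<lambda>b. H b t - 1) b"
proof -
  have wlog: "A t (\<lambda>b. H b s - 1) b = A s (\<lambda>b. H b t - 1) b"
    if S: "s \<in> S" "t \<in> S" and m: "m s t = 3" "m t s = 3" and le: "ip t b \<le> ip s b" for s t
  proof -
    have ne: "s \<noteq> t" using m_ne S m by blast
    have k: "kk s t = 1" "kk t s = 1" using kk_3 m by auto
    define x y where "x = ip s b" and "y = ip t b"
    note xy = x_def[symmetric] y_def[symmetric]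
    have adj: "sg t (e s) = sg s (e t)" using sg_e_adj[OF S m(1)] by simp
    have st_pr: "sg t (e s) \<in> pos_roots" using pr_sg[OF e_pr[OF S(1)] S(2)] ne by (simp add: e_inj)
    have i_st: "ip s (sg t (e s)) = 1" "ip t (sg t (e s)) = 1" using S k by (simp_all add: ip_refl ip_e kk_self)
    have st_ne: "sg t (e s) \<noteq> e s" "sg t (e s) \<noteq> e t"
      using i_st k S by (auto simp: ip_e kk_self dest: arg_cong[of _ _ "ip s"] arg_cong[of _ _ "ip t"])
    show ?thesis
    proof (cases "b = e s \<or> b = e t")
      case True
      then have "b = e s" using le S k by (auto simp: ip_e kk_self)
      moreover have "H (sg t (e s)) s = 0" using H_pos[OF st_pr S(1)] i_st st_ne by simp
      ultimately show ?thesis using S k ne H_self[OF S(1)] by (simp add: A_def ip_e e_inj kk_self)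
    next
      case False
      have p: "sg s b \<in> pos_roots" "sg t b \<in> pos_roots" using pr_sg b S False by auto
      have i_s: "ip s (sg s b) = - x" "ip t (sg s b) = x + y" using S k by (simp_all add: ip_refl xy)
      have i_t: "ip s (sg t b) = x + y" "ip t (sg t b) = - y" using S k by (simp_all add: ip_refl xy)
      have n: "sg s b = e t \<Longrightarrow> b = sg t (e s)" "sg t b = e s \<Longrightarrow> b = sg t (e s)"
        using adj S by (metis refl_refl)+
      have i_b: "b = sg t (e s) \<Longrightarrow> x = 1 \<and> y = 1" using i_st by (simp add: xy[symmetric])
      have rule_s: "H (sg t b) s = rhs H s t (sg t b)" if "y < 0" "x + y \<le> 0"
        using H_rule[OF p(2) S] i_t that pr_sg_ne[OF b S(2)] by simp
      have rule_t: "H (sg s b) t = rhs H t s (sg s b)" if "x < 0" "x + y \<le> 0"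
        using H_rule[OF p(1) S(2,1)] i_s that pr_sg_ne[OF b S(1)] by simp
      have z0: "H b s = 0" if "x > 0" using H_pos[OF b S(1)] that False by (simp add: xy)
      have z0': "H b t = 0" if "y > 0" using H_pos[OF b S(2)] that False by (simp add: xy)
      have q1: "H (sg t b) s = 0" if "x + y > 0" "sg t b \<noteq> e s" using H_pos[OF p(2) S(1)] i_t that by simp
      have q2: "H (sg s b) t = 0" if "x + y > 0" "sg s b \<noteq> e t" using H_pos[OF p(1) S(2)] i_s that by simp
      have le': "y \<le> x" using le by (simp add: xy)
      consider "y > 0" | "x > 0" "y \<le> 0" "x + y > 0" | "x > 0" "y < 0" "x + y \<le> 0"
        | "x = 0" "y = 0" | "x = 0" "y < 0" | "x < 0" "y < 0" using le' by linarith
      then show ?thesis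
      proof cases
        case 1
        show ?thesis
        proof (cases "b = sg t (e s)")
          case True
          then have "sg t b = e s" "sg s b = e t" using S adj by (metis refl_refl)+
          then show ?thesis using 1 le' False H_self S by (simp add: A_def xy)
        next
          case nb: False
          then have "H (sg t b) s = 0" "H (sg s b) t = 0" using q1 q2 n 1 le' by auto
          then show ?thesis using 1 le' False by (simp add: A_def xy)
        qed
      next
        case c: 2
        then have "sg t b \<noteq> e s" "sg s b \<noteq> e t" using n i_b by auto
        then have "H (sg t b) s = 0" "H (sg s b) t = 0" using q1 q2 c by auto
        then show ?thesis using c False z0 by (cases "y = 0") (simp_all add: A_def xy)
      next
        case 3
        have "sg s (sg t (sg t b)) = sg s b" using S by simp
        then show ?thesis using 3 False z0 rule_s m S i_t by (simp add: A_def xy rhs_def)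
      next
        case 4
        then show ?thesis using H_orthogonal[OF b S m(1)] False by (simp add: A_def xy)
      next
        case 5
        then show ?thesis using False rule_s m S i_t by (simp add: A_def xy rhs_def)
      next
        case 6
        then show ?thesis using False rule_s rule_t m S i_t i_s by (simp add: A_def xy rhs_def)
      qed
    qed
  qed
  have "m t s = 3" using m m_sym S by simp
  then show ?thesis
    using wlog[of s t] wlog[of t s] S m by (cases "ip t b \<le> ip s b") auto
qed

lemma A_comm:
  assumes "s \<in> S" "t \<in> S" "m s t = 2"
  shows "A t (A s u) b = A s (A t u) b"
proof -
  have k: "kk s t = 0" "kk t s = 0" using kk_2 assms m_sym by auto
  have i: "ip t (sg s c) = ip t c" "ip s (sg t c) = ip s c" for c using assms k by (simp_all add: ip_refl)
  have z: "ip t (e s) = 0" "ip s (e t) = 0" using assms k by (simp_all add: ip_e)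
  have n: "sg s b = e t \<longleftrightarrow> b = e t" "sg t b = e s \<longleftrightarrow> b = e s"
    using assms z sg_ip_0 by (metis refl_refl)+
  show ?thesis
  proof (cases "b = e s \<or> b = e t")
    case True
    then show ?thesis using z by (auto simp: A_def e_inj)
  next
    case False
    then show ?thesis
      using n sg_comm[OF assms, of b]
      by (cases "ip s b" "0 :: real" rule: linorder_cases; cases "ip t b" "0 :: real" rule: linorder_cases)
         (simp_all add: A_def i field_simps)
  qed
qed

text \<open>The positive roots of the dihedral subsystem are treated separately. For any other b the
  orbit avoids \<open>e s\<close> and \<open>e t\<close>, and every sign pattern of the pairings
  gives a linear identity between the values of u on the orbit.\<close>

lemma A_braid:
  assumes b: "b \<in> pos_roots" and S: "s \<in> S" "t \<in> S" and m: "m s t = 3"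
  shows "A s (A t (A s u)) b = A t (A s (A t u)) b"
proof -
  have m': "m t s = 3" using m m_sym S by simp
  have ne: "s \<noteq> t" using m_ne S m by blast
  have k: "kk s t = 1" "kk t s = 1" using kk_3 m m' by auto
  have adj: "sg t (e s) = sg s (e t)" using sg_e_adj[OF S m] by simp
  have i_st: "ip s (sg s (e t)) = 1" "ip t (sg s (e t)) = 1" using S k by (simp_all add: ip_refl ip_e kk_self)
  have st_ne: "sg s (e t) \<noteq> e s" "sg s (e t) \<noteq> e t"
    using i_st k S by (auto simp: ip_e kk_self dest: arg_cong[of _ _ "ip s"] arg_cong[of _ _ "ip t"])
  have bk: "sg t (sg s (e t)) = e s" using adj S by (metis refl_refl)
  consider "b = e s" | "b = e t" | "b = sg s (e t)" | "b \<noteq> e s" "b \<noteq> e t" "b \<noteq> sg s (e t)" by blast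
  then show ?thesis
  proof cases
    case 4
    have n: "sg s b \<noteq> e t" "sg t b \<noteq> e s" "sg s b \<noteq> e s" "sg t b \<noteq> e t"
      "sg t (sg s b) \<noteq> e s" "sg s (sg t b) \<noteq> e t"
      using 4 S adj bk pr_sg_ne[OF b] by (metis refl_refl)+
    have br: "sg t (sg s (sg t b)) = sg s (sg t (sg s b))" using sg_braid[OF S m] by simp
    define x y where "x = ip s b" and "y = ip t b"
    have i: "ip s b = x" "ip t b = y" "ip s (sg s b) = - x" "ip t (sg s b) = x + y"
        "ip s (sg t b) = x + y" "ip t (sg t b) = - y"
        "ip s (sg t (sg s b)) = y" "ip t (sg s (sg t b)) = x"
      using S k by (simp_all add: ip_refl x_def y_def)
    have zs: "x = 0 \<Longrightarrow> sg s b = b" "y = 0 \<Longrightarrow> sg t b = b"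
         "x + y = 0 \<Longrightarrow> sg t (sg s b) = sg s b" "x + y = 0 \<Longrightarrow> sg s (sg t b) = sg t b"
      using i by (auto intro!: sg_ip_0)
    show ?thesis
      using 4 n br zs S
      by (cases x "0 :: real" rule: linorder_cases; cases y "0 :: real" rule: linorder_cases;
          cases "x + y" "0 :: real" rule: linorder_cases)
         (simp_all add: A_def i field_simps)
  qed (use S k ne adj bk i_st st_ne in \<open>simp_all add: A_def ip_e e_inj kk_self\<close>)
qed


lemma K_in: "b \<in> pos_roots \<Longrightarrow> K x s u b = A s u b + x * (H b s - 1) * u (e s)"
  by (simp add: K_def)

lemma A_lin: "A s (\<lambda>b. u b + c * v b) b = A s u b + c * A s v b"
  by (simp add: A_def field_simps)

lemma A_cong:
  assumes "\<And>b. b \<in> pos_roots \<Longrightarrow> u b = v b" "b \<in> pos_roots" "s \<in> S"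
  shows "A s u b = A s v b"
  using assms pr_sg[of b s] by (simp add: A_def)

lemma A_K:
  assumes "b \<in> pos_roots" "t \<in> S"
  shows "A t (K x s u) b = A t (A s u) b + x * u (e s) * A t (\<lambda>b. H b s - 1) b"
proof -
  have "A t (K x s u) b = A t (\<lambda>b. A s u b + (x * u (e s)) * (H b s - 1)) b"
    using assms by (intro A_cong) (simp_all add: K_in)
  then show ?thesis by (simp add: A_lin)
qed

lemma K_comm:
  assumes "s \<in> S" "t \<in> S" "m s t = 2"
  shows "K x t (K x s u) = K x s (K x t u)"
proof
  fix b
  have m': "m t s = 2" using assms m_sym by simp
  have ne: "s \<noteq> t" using m_ne assms by blast
  have z: "ip t (e s) = 0" "ip s (e t) = 0" using assms kk_2 m' by (simp_all add: ip_e)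
  have "K x s u (e t) = u (e t)" "K x t u (e s) = u (e s)"
    using assms ne z H_simple e_pr by (simp_all add: K_in A_def e_inj)
  then show "K x t (K x s u) b = K x s (K x t u) b"
    using A_comm[OF assms, of u b] A_H_2[OF _ assms, of b] A_H_2[OF _ assms(2,1) m', of b] assms
    by (cases "b \<in> pos_roots") (simp_all add: K_in A_K, simp_all add: K_def)
qed

text \<open>The quadratic relation (A - 1)(A + 1/2) = 0, valid away from \<open>e s\<close>, where A
  gives 0.\<close>

lemma A_square:
  assumes "b \<in> pos_roots" "s \<in> S"
  shows "A s (A s u) b = A s u b / 2 + (if b = e s then 0 else u b / 2)"
  using pr_sg_ne[OF assms] assms(2) sg_ip_0[of s b] by (simp add: A_def field_simps)

lemma K_braid:
  assumes "s \<in> S" "t \<in> S" "m s t = 3"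
  shows "K x s (K x t (K x s u)) = K x t (K x s (K x t u))"
proof -
  \<comment> \<open>The expansion is affine in x, because the terms x u(e_s) cancel in
    \<open>u2 (e s)\<close>. What remains is symmetric in s and t by \<open>A_braid\<close> and
    \<open>A_H_3\<close>.\<close>
  have half: "K x s (K x t (K x s u)) b = A s (A t (A s u)) b
      + x * ((u (e s) + u (e t)) / 2 * A s (\<lambda>b. H b t - 1) b
          + u (sg s (e t)) / 2 * A s (\<lambda>b. H b t - 1) b
          + u (e s) / 2 * (H b t - 1) + u (e t) / 2 * (H b s - 1))"
    if b: "b \<in> pos_roots" and S: "s \<in> S" "t \<in> S" and m: "m s t = 3" for s t b
  proof -
    have m': "m t s = 3" using S m m_sym by simp
    have ne: "s \<noteq> t" using m_ne S m by blast
    have k: "kk s t = 1" "kk t s = 1" using kk_3 m m' by auto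
    have adj: "sg t (e s) = sg s (e t)" using sg_e_adj[OF S m] by simp
    define u1 where "u1 = K x s u"
    define u2 where "u2 = K x t u1"
    have st_pr: "sg s (e t) \<in> pos_roots" using pr_sg[OF e_pr[OF S(2)] S(1)] ne by (simp add: e_inj)
    have i_st: "ip s (sg s (e t)) = 1" using S k by (simp add: ip_refl ip_e kk_self)
    have st_ne: "sg s (e t) \<noteq> e s"
      using i_st k S by (auto simp: ip_e kk_self dest: arg_cong[of _ _ "ip s"])
    have u1s: "u1 (e s) = x * u (e s)"
      unfolding u1_def using S by (simp add: K_in e_pr A_def H_self)
    have u1t: "u1 (e t) = (u (e t) + u (sg s (e t))) / 2"
      unfolding u1_def using S ne k by (simp add: K_in e_pr A_def H_simple e_inj ip_e)
    have u1st: "u1 (sg s (e t)) = u (e t) - x * u (e s)"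
      unfolding u1_def using S st_pr st_ne i_st H_pos[OF st_pr S(1)] by (simp add: K_in A_def)
    have u2s: "u2 (e s) = u (e t) / 2"
      unfolding u2_def using S ne k adj
      by (simp add: K_in e_pr A_def H_simple e_inj ip_e u1s u1st)
    have As: "A s u2 b = A s (A t u1) b + x * u1 (e t) * A s (\<lambda>b. H b t - 1) b"
      unfolding u2_def by (rule A_K[OF b S(1)])
    have Ast: "A s (A t u1) b = A s (\<lambda>b. A t (A s u) b + x * u (e s) * A t (\<lambda>b. H b s - 1) b) b"
      unfolding u1_def using b S by (intro A_cong) (simp_all add: A_K)
    also have "\<dots> = A s (A t (A s u)) b + x * u (e s) * A s (A t (\<lambda>b. H b s - 1)) b"
      by (rule A_lin)
    also have "A s (A t (\<lambda>b. H b s - 1)) b = A s (A s (\<lambda>b. H b t - 1)) b"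
      using b S m by (intro A_cong) (simp_all add: A_H_3)
    also have "\<dots> = A s (\<lambda>b. H b t - 1) b / 2 + (H b t - 1) / 2"
      using A_square[OF b S(1), of "\<lambda>b. H b t - 1"] H_simple[of t s] S ne by auto
    finally have "K x s u2 b = A s (A t (A s u)) b
        + x * u (e s) * (A s (\<lambda>b. H b t - 1) b / 2 + (H b t - 1) / 2)
        + x * ((u (e t) + u (sg s (e t))) / 2) * A s (\<lambda>b. H b t - 1) b
        + x * (H b s - 1) * (u (e t) / 2)"
      using b by (simp add: K_in As u1t u2s)
    then show ?thesis unfolding u2_def u1_def by (simp add: field_simps)
  qed
  show ?thesis
  proof
    fix b
    have m': "m t s = 3" using assms m_sym by simp
    have adj: "sg t (e s) = sg s (e t)" using sg_e_adj[OF assms] by simp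
    show "K x s (K x t (K x s u)) b = K x t (K x s (K x t u)) b"
    proof (cases "b \<in> pos_roots")
      case True
      show ?thesis
        unfolding half[OF True assms] half[OF True assms(2,1) m']
        using A_braid[OF True assms, of u] A_H_3[OF True assms] adj by (simp add: field_simps)
    next
      case False
      then show ?thesis by (simp add: K_def)
    qed
  qed
qed

lemma bij_K:
  assumes s: "s \<in> S" and x: "x \<noteq> 0"
  shows "bij (K x s)"
proof -
  \<comment> \<open>The inverse first recovers the value at \<open>e s\<close> by dividing by x.
    Subtracting the term with \<open>H\<close>, as in \<open>w'\<close>, leaves
    \<open>A s u\<close>, which is inverted on each pair b, s b.\<close>
  define w' where "w' w b = w b - (H b s - 1) * w (e s)" for w :: "('s \<Rightarrow> real) \<Rightarrow> real" and b
  define J where "J w b = (if b \<notin> pos_roots then w b else if b = e s then w (e s) / x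
     else if ip s b = 0 then w' w b else if ip s b < 0 then w' w (sg s b)
     else 2 * w' w (sg s b) - w' w b)" for w b
  have Ks: "K x s u (e s) = x * u (e s)" for u
    using s by (simp add: K_in e_pr A_def H_self)
  have w'K: "w' (K x s u) b = A s u b" if "b \<in> pos_roots" for u b
    using that unfolding w'_def Ks by (simp add: K_in)
  have Js: "J w (e s) = w (e s) / x" for w using s by (simp add: J_def e_pr)
  have pos_roots: "sg s b \<in> pos_roots" "sg s b \<noteq> e s" if "b \<in> pos_roots" "b \<noteq> e s" for b
    using pr_sg pr_sg_ne s that by blast+
  have "J (K x s u) = u" for u
  proof
    fix b show "J (K x s u) b = u b"
    proof (cases "b \<in> pos_roots \<and> b \<noteq> e s")
      case True
      then show ?thesis using s pos_roots[of b]
        by (simp add: J_def w'K) (simp add: A_def field_simps)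
    qed (use x Ks in \<open>auto simp: J_def K_def\<close>)
  qed
  moreover have "K x s (J w) = w" for w
  proof
    fix b show "K x s (J w) b = w b"
    proof (cases "b \<in> pos_roots")
      case True
      show ?thesis
      proof (cases "b = e s")
        case True
        then show ?thesis using Ks[of "J w"] Js x by simp
      next
        case False
        have "A s (J w) b = w' w b"
          using True False s pos_roots[of b] by (auto simp: A_def J_def)
        then show ?thesis using True x by (simp add: K_in Js w'_def)
      qed
    qed (simp add: K_def J_def)
  qed
  ultimately show ?thesis by (intro o_bij[of J]) auto
qed

text \<open>\<open>fold\<close> lets the first letter act first, in contrast to \<open>act\<close>,
  because the operators are duals of a left action.\<close>

definition K_word :: "real \<Rightarrow> 's list \<Rightarrow> (('s \<Rightarrow> real) \<Rightarrow> real) \<Rightarrow> ('s \<Rightarrow> real) \<Rightarrow> real" where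
  "K_word x w u = fold (K x) w u"

lemma Kw_Nil [simp]: "K_word x [] u = u"
  by (simp add: K_word_def)

lemma Kw_Cons [simp]: "K_word x (s # w) u = K_word x w (K x s u)"
  by (simp add: K_word_def)

lemma Kw_append [simp]: "K_word x (v @ w) u = K_word x w (K_word x v u)"
  by (simp add: K_word_def)

lemma Kw_matsumoto:
  assumes "reduced u" "reduced v" "act u = act v"
  shows "K_word x u = K_word x v"
proof (rule matsumoto[where R = "\<lambda>u v. K_word x u = K_word x v" and T = S and u = u and v = v])
  fix s t n y assume st: "s \<in> S" "t \<in> S" "s \<noteq> t" "m s t = enat n"
  have "n = 2 \<or> n = 3" using small[OF st(1-3)] st(4) by (auto simp: numeral_eq_enat)
  then show "K_word x (alt_list s t n @ y) = K_word x (alt_list t s n @ y)"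
  proof
    assume "n = 2"
    then show ?thesis using K_comm[OF st(1,2)] st(4)
      by (intro ext) (simp add: numeral_2_eq_2 numeral_eq_enat)
  next
    assume "n = 3"
    then show ?thesis using K_braid[OF st(1,2)] st(4)
      by (intro ext) (simp add: numeral_3_eq_3 numeral_eq_enat)
  qed
qed (use assms red_lists in \<open>auto simp: fun_eq_iff\<close>)

lemma Kw_isCont:
  assumes "\<And>b. isCont (\<lambda>x. V x b) 0"
  shows "isCont (\<lambda>x. K_word x w (V x) b) 0"
  using assms
proof (induction w arbitrary: V b rule: list.induct)
  case (Cons s w)
  have "isCont (\<lambda>x. K x s (V x) b) 0" for b
  proof -
    have v: "isCont (\<lambda>x. V x d) 0" for d by (rule Cons.prems)
    have "isCont (\<lambda>x. A s (V x) b) 0"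
      using v by (cases "b = e s"; cases "ip s b = 0"; cases "ip s b > 0") (simp_all add: A_def)
    then show ?thesis
      using v by (cases "b \<in> pos_roots") (simp_all add: K_def)
  qed
  then show ?case using Cons.IH[of "\<lambda>x. K x s (V x)"] by simp
qed simp

text \<open>At nonzero x the operators are bijective, so equality in the Artin group can be
  exploited there; each entry being continuous in x, the result survives at x = 0, where the
  operators are singular.\<close>

lemma Kw_limit:
  assumes "\<And>x. x \<noteq> 0 \<Longrightarrow> K_word x v u = K_word x w u"
  shows "K_word 0 v u = K_word 0 w u"
proof
  fix b
  have "((\<lambda>x. K_word x v u b) \<longlongrightarrow> K_word 0 v u b) (at 0)" "((\<lambda>x. K_word x w u b) \<longlongrightarrow> K_word 0 w u b) (at 0)"
    using Kw_isCont[of "\<lambda>x. u" v b] Kw_isCont[of "\<lambda>x. u" w b] by (simp_all add: isCont_def)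
  moreover have "((\<lambda>x. K_word x w u b) \<longlongrightarrow> K_word 0 v u b) (at 0)"
    by (rule Lim_transform_eventually[OF calculation(1)]) (auto simp: eventually_at_filter assms)
  ultimately show "K_word 0 v u b = K_word 0 w u b" using LIM_unique by blast
qed

subsection \<open>Supports at \<open>x = 0\<close>\<close>

definition nonneg :: "(('s \<Rightarrow> real) \<Rightarrow> real) \<Rightarrow> bool" where
  "nonneg u \<longleftrightarrow> (\<forall>b\<in>pos_roots. u b \<ge> 0)"

lemma nonneg_K: "nonneg u \<Longrightarrow> s \<in> S \<Longrightarrow> nonneg (K 0 s u)"
  unfolding nonneg_def using pr_sg by (auto simp: K_in A_def)

lemma nonneg_Kw: "nonneg u \<Longrightarrow> w \<in> lists S \<Longrightarrow> nonneg (K_word 0 w u)"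
  by (induction w arbitrary: u rule: list.induct) (auto intro: nonneg_K)

lemma Kw_zero:
  assumes "\<And>b. b \<in> pos_roots \<Longrightarrow> u b = 0" "w \<in> lists S" "b \<in> pos_roots"
  shows "K_word 0 w u b = 0"
  using assms
proof (induction w arbitrary: u rule: list.induct)
  case (Cons s w)
  have "K 0 s u b = 0" if "b \<in> pos_roots" for b
    using that Cons.prems pr_sg[of b s] by (auto simp: K_in A_def)
  then show ?case using Cons by simp
qed simp

text \<open>At x = 0 the operator of s forgets the value at \<open>e s\<close> and otherwise moves
  support only between a root and its reflection. A function supported on the inversions of w, the
  positive roots that w^(-1) makes negative, is thus forgotten entirely.\<close>

lemma Kw_inversions:
  assumes "reduced w" "\<And>b. b \<in> pos_roots \<Longrightarrow> nn (act (rev w) b) \<Longrightarrow> u b = 0" "b \<in> pos_roots"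
  shows "K_word 0 w u b = 0"
  using assms
proof (induction w arbitrary: u rule: list.induct)
  case Nil
  then show ?case using pr_nn by simp
next
  case (Cons s w)
  have s: "s \<in> S" and rw: "reduced w" using red_lists[OF Cons.prems(1)] red_ConsD[OF Cons.prems(1)] by auto
  have ns: "nn (act (rev w) (e s))" using red_Cons_iff[OF rw s] Cons.prems(1) by (simp add: left_descent_def)
  have "K 0 s u c = 0" if c: "c \<in> pos_roots" "nn (act (rev w) c)" for c
  proof (cases "c = e s")
    case False
    have p: "sg s c \<in> pos_roots" using pr_sg c s False by blast
    have 1: "u (sg s c) = 0" using Cons.prems(2)[OF p] c s by simp
    have "u c = 0" if "ip s c \<le> 0"
    proof -
      have "act (rev w) (sg s c) = (\<lambda>x. 1 * act (rev w) c x + (- ip s c) * act (rev w) (e s) x)"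
        unfolding refl_as act_lin ..
      then have "nn (act (rev w) (sg s c))" using nn_lin[OF c(2) ns, of 1 "- ip s c"] that by simp
      then show ?thesis using Cons.prems(2)[OF c(1)] by simp
    qed
    then show ?thesis using 1 c by (simp add: K_in A_def)
  qed (use s in \<open>simp add: K_in A_def e_pr\<close>)
  then show ?case using Cons.IH[OF rw] Cons.prems(3) by simp
qed

text \<open>The positive value travels along the roots from z e_i to e_i. Since z i is reduced, it
  never meets the simple root of the letter being applied, where it would be lost.\<close>

lemma Kw_move:
  assumes "reduced (z @ [i])" "nonneg u" "u (act z (e i)) > 0"
  shows "K_word 0 z u (e i) > 0"
  using assms
proof (induction z arbitrary: u rule: list.induct)
  case (Cons s z)
  have S: "s \<in> S" "z \<in> lists S" "i \<in> S" using red_lists[OF Cons.prems(1)] by auto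
  have r: "reduced (z @ [i])" "reduced z" using Cons.prems(1) red_appendD2[of "[s]" "z @ [i]"] red_appendD1 by auto
  define d where "d = act z (e i)"
  have d: "d \<in> pos_roots" unfolding pos_roots_def d_def
    using S red_snoc_iff[OF r(2) S(3)] r(1) by blast
  have sd: "nn (sg s d)"
    using red_snoc_iff[of "s # z" i] Cons.prems(1) red_appendD1[of "s # z" "[i]"] S by (simp add: d_def)
  have "d \<noteq> e s"
  proof
    assume "d = e s"
    then have "sg s d s = -1" using refl_e_self S by simp
    then show False using sd unfolding nn_def by (metis neg_0_le_iff_le not_one_le_zero)
  qed
  moreover have "u (sg s d) > 0" using Cons.prems(3) by (simp add: d_def)
  moreover have "u d \<ge> 0" using Cons.prems(2) d by (simp add: nonneg_def)
  ultimately have "K 0 s u d > 0" using d sg_ip_0[of s d] by (auto simp: K_in A_def)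
  then show ?case using Cons.IH[OF r(1) nonneg_K[OF Cons.prems(2) S(1)]] by (simp add: d_def)
qed simp

text \<open>If r were a right descent, w could be rewritten to end in r, and the last operator puts
  0 at \<open>e r\<close>.\<close>

lemma Kw_right_descent:
  assumes "reduced w" "r \<in> S" "K_word 0 w u (e r) \<noteq> 0"
  shows "nn (act w (e r))"
proof (rule ccontr)
  assume n: "\<not> ?thesis"
  obtain w' where w': "reduced (w' @ [r])" "act (w' @ [r]) = act w"
    using red_snoc_cases[OF assms(1,2)] n by metis
  have "K_word 0 w = K_word 0 (w' @ [r])" using Kw_matsumoto assms(1) w' by metis
  then have "K_word 0 w u (e r) = 0" using assms(2) by (simp add: K_in e_pr A_def)
  then show False using assms(3) by simp
qed

text \<open>A positive value is kept at a simple root while w is read. It stays at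
  \<open>e i\<close> as long as i is no descent of the rest. Otherwise w can be rewritten to begin
  with t i, where \<open>m t i = 3\<close>, and the value passes to \<open>e t\<close>.\<close>

lemma Kw_reach:
  assumes "reduced w" "i \<in> S" "\<not> left_descent w i" "nonneg u" "u (e i) > 0"
  shows "\<exists>r\<in>S. K_word 0 w u (e r) > 0"
  using assms
proof (induction "length w" arbitrary: w i u rule: less_induct)
  case less
  show ?case
  proof (cases w)
    case Nil
    then show ?thesis using less.prems by auto
  next
    case (Cons t w1)
    have t: "t \<in> S" "reduced w1" using red_lists[of w] less.prems(1) Cons red_ConsD by auto
    have ne: "t \<noteq> i" using LD_Cons[of t w1] less.prems Cons by auto
    have w1S: "w1 \<in> lists S" using red_lists t by blast
    have nt: "nonneg (K 0 t u)" using nonneg_K less.prems t by blast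
    have ei: "u (e i) \<ge> 0" "e i \<in> pos_roots" "u (sg t (e i)) \<ge> 0"
      using less.prems e_pr pr_sg[OF e_pr t(1), of i] ne by (auto simp: nonneg_def e_inj)
    have Ki: "K 0 t u (e i) > 0"
      using less.prems ne ei t small[OF t(1) less.prems(2) ne] kk_2[of t i] kk_3[of t i]
      by (auto simp: K_in A_def e_inj ip_e)
    show ?thesis
    proof (cases "left_descent w1 i")
      case False
      then show ?thesis using less.hyps[OF _ t(2) less.prems(2) _ nt Ki] Cons by simp
    next
      case True
      have m3: "m t i = 3"
      proof (rule ccontr)
        assume "m t i \<noteq> 3"
        then have "ip t (e i) = 0"
          using small[OF t(1) less.prems(2) ne] kk_2[of t i] less.prems(2) by (simp add: ip_e)
        then have "sg t (e i) = e i" by (rule sg_ip_0)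
        then have "left_descent w i" using True Cons by (simp add: left_descent_def)
        then show False using less.prems by simp
      qed
      have m3': "m i t = 3" using m3 m_sym t less.prems by simp
      obtain w2 where w2: "reduced (i # w2)" "act (i # w2) = act w1" "length w1 = Suc (length w2)"
        using LD_exchange[OF t(2) less.prems(2) True] by blast
      have rw2: "reduced w2" "w2 \<in> lists S" using red_ConsD[OF w2(1)] red_lists by auto
      \<comment> \<open>Otherwise w = t i t w3 = i t i w3 would have i as a left descent.\<close>
      have "\<not> left_descent w2 t"
      proof
        assume "left_descent w2 t"
        then obtain w3 where w3: "reduced (t # w3)" "act (t # w3) = act w2" "length w2 = Suc (length w3)"
          using LD_exchange[OF rw2(1) t(1)] by blast
        have w3S: "w3 \<in> lists S" using red_lists[OF w3(1)] by simp
        have "act (i # t # i # w3) x = act w x" for x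
        proof -
          have "act w x = sg t (act w1 x)" using Cons by simp
          also have "act w1 x = sg i (act w2 x)" using w2(2) by (metis act_Cons)
          also have "act w2 x = sg t (act w3 x)" using w3(2) by (metis act_Cons)
          finally show ?thesis using sg_braid[OF t(1) less.prems(2) m3] by simp
        qed
        then have a: "act (i # t # i # w3) = act w" by auto
        have "reduced (i # t # i # w3)"
          using w2 w3 Cons w3S t(1) less.prems(2) by (intro red_cong[OF less.prems(1) _ a]) auto
        then have "left_descent w i"
          using LD_Cons LD_cong[OF _ _ a] red_lists less.prems(1) by metis
        then show False using less.prems by simp
      qed
      moreover have "nonneg (K 0 i (K 0 t u))" using nonneg_K nt less.prems by blast
      moreover have "K 0 i (K 0 t u) (e t) > 0"
      proof -
        have adj: "sg t (e i) = sg i (e t)" using sg_e_adj[OF t(1) less.prems(2) m3] by simp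
        have p: "sg i (e t) \<in> pos_roots" using pr_sg[OF e_pr[OF t(1)] less.prems(2)] ne by (simp add: e_inj)
        have k: "kk t i = 1" "kk i t = 1" using m3 m3' kk_3 by auto
        have i1: "ip t (sg i (e t)) = 1" using t less.prems k by (simp add: ip_refl ip_e kk_self)
        then have "sg i (e t) \<noteq> e t" using t by auto
        moreover have "sg t (sg i (e t)) = e i" using adj t by (metis refl_refl)
        ultimately have "K 0 t u (sg i (e t)) = u (e i)" using p i1 by (simp add: K_in A_def)
        moreover have "K 0 t u (e t) \<ge> 0" using nt e_pr t by (simp add: nonneg_def)
        ultimately show ?thesis
          using less.prems t ne k e_pr by (simp add: K_in A_def e_inj ip_e)
      qed
      ultimately have "\<exists>r\<in>S. K_word 0 w2 (K 0 i (K 0 t u)) (e r) > 0"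
        using less.hyps[of w2 t "K 0 i (K 0 t u)"] rw2 t w2(3) Cons by simp
      moreover have "K_word 0 w1 = K_word 0 (i # w2)" using Kw_matsumoto t(2) w2 by metis
      ultimately show ?thesis using Cons by simp
    qed
  qed
qed

text \<open>The simple root reached after a is no right descent of a, hence by the chain condition
  no left descent of the next factor, and \<open>Kw_reach\<close> applies again.\<close>

lemma Kw_chain:
  assumes "normal_chain (a # as)" "i \<in> S" "\<not> left_descent a i" "nonneg u" "u (e i) > 0"
  shows "\<exists>r\<in>S. K_word 0 (concat (a # as)) u (e r) > 0"
  using assms
proof (induction as arbitrary: a i u)
  case Nil
  then show ?case using Kw_reach[of a i u] by simp
next
  case (Cons b as)
  have ra: "reduced a" using Cons.prems by simp
  obtain r where r: "r \<in> S" "K_word 0 a u (e r) > 0" using Kw_reach[OF ra Cons.prems(2-5)] by blast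
  have "\<not> left_descent b r" using Kw_right_descent[OF ra r(1), of u] r Cons.prems(1) by auto
  then show ?case
    using Cons.IH[of b r "K_word 0 a u"] Cons.prems r nonneg_Kw red_lists[OF ra] by simp
qed

text \<open>The operators are tested on the indicator of g = z e_i. If g were an inversion of h,
  those of h, and so of h c, would kill it. Along a = z y and the rest of the chain, however, a
  positive value survives at some simple root.\<close>

theorem inversions_of_divisor:
  assumes h: "reduced h" and c: "c \<in> lists S" and chain: "normal_chain (a # as)"
    and eq: "\<And>x. x \<noteq> 0 \<Longrightarrow> K_word x (h @ c) = K_word x (concat (a # as))"
    and z: "reduced (z @ y)" "act (z @ y) = act a" "i \<in> S" "\<not> left_descent y i" "reduced (z @ [i])"
  shows "nn (act (rev h) (act z (e i)))"
proof (rule ccontr)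
  assume neg: "\<not> ?thesis"
  define g where "g = act z (e i)"
  define u where "u b = (if b = g then 1 else 0 :: real)" for b
  have zS: "z \<in> lists S" "reduced z" using red_lists[OF z(5)] red_appendD1[OF z(5)] by auto
  have ra: "reduced a" using chain by (cases as) auto
  have u: "nonneg u" by (simp add: nonneg_def u_def)
  have "K_word 0 h u b = 0" if "b \<in> pos_roots" for b
  proof (rule Kw_inversions[OF h _ that])
    show "u d = 0" if "d \<in> pos_roots" "nn (act (rev h) d)" for d
      using that neg by (auto simp: u_def g_def)
  qed
  then have "K_word 0 (h @ c) u b = 0" if "b \<in> pos_roots" for b
    using Kw_zero[OF _ c that] by simp
  moreover have "K_word 0 (h @ c) u = K_word 0 (concat (a # as)) u"
    using eq by (intro Kw_limit) simp
  ultimately have zero: "K_word 0 (concat (a # as)) u b = 0" if "b \<in> pos_roots" for b using that by simp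
  have "K_word 0 z u (e i) > 0" using Kw_move[OF z(5) u] by (simp add: u_def g_def)
  then obtain r where r: "r \<in> S" "K_word 0 y (K_word 0 z u) (e r) > 0"
    using Kw_reach[OF red_appendD2[OF z(1)] z(3,4) nonneg_Kw[OF u zS(1)]] by blast
  have Ka: "K_word 0 a = K_word 0 (z @ y)" using Kw_matsumoto ra z(1,2) by metis
  then have r': "K_word 0 a u (e r) > 0" using r by simp
  have "\<exists>r\<in>S. K_word 0 (concat (a # as)) u (e r) > 0"
  proof (cases as)
    case Nil
    then show ?thesis using r r' by auto
  next
    case (Cons b bs)
    have "\<not> left_descent b r" using Kw_right_descent[OF ra r(1), of u] r' chain Cons r(1) by auto
    then show ?thesis
      using Kw_chain[of b bs r "K_word 0 a u"] chain Cons r r' nonneg_Kw[OF u red_lists[OF ra]] by simp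
  qed
  then show False using zero e_pr by fastforce
qed

end

subsection \<open>Actions of presented groups\<close>

text \<open>Letters act from left to right. The formal inverse acts through \<open>inv_into\<close>,
  which is the inverse map for the bijections that \<open>sact_presentation_cong\<close>
  assumes.\<close>

definition sact :: "('a \<Rightarrow> 'b \<Rightarrow> 'b) \<Rightarrow> 'a signed_word \<Rightarrow> 'b \<Rightarrow> 'b" where
  "sact f w = fold (\<lambda>(s, b). if b then f s else inv_into UNIV (f s)) w"

lemma sact_append: "sact f (u @ v) x = sact f v (sact f u x)"
  by (simp add: sact_def)

lemma sact_pos_word: "sact f (pos_word w) = fold f w"
  by (induction w) (auto simp: sact_def pos_word_def)

lemma sact_presentation_cong:
  assumes "(u, v) \<in> presentation_cong X R"
    and bij: "\<And>s. s \<in> X \<Longrightarrow> bij (f s)"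
    and R: "\<And>u v. (u, v) \<in> R \<Longrightarrow> sact f u = sact f v"
  shows "sact f u = sact f v"
  using assms(1)
proof induction
  case (cancel s x y b)
  have "sact f [(s, b), (s, \<not> b)] z = z" for z
    using bij[OF cancel(1)] by (cases b) (auto simp: sact_def bij_is_inj bij_is_surj surj_f_inv_f)
  then show ?case by (intro ext) (simp only: sact_append)
next
  case (relation u v x y)
  then show ?case using R by (intro ext) (simp add: sact_append)
qed auto

lemma braid_relationsE:
  assumes "(u, v) \<in> braid_relations S m"
  obtains s t n where "s \<in> S" "t \<in> S" "s \<noteq> t" "m s t = enat n"
    "u = pos_word (alt_list s t n)" "v = pos_word (alt_list t s n)"
  using assms unfolding braid_relations_def by auto

context coxeter_system
begin

lemma artin_action:
  assumes "(pos_word u, pos_word v) \<in> presentation_cong S (braid_relations S m)"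
    and bij: "\<And>s. s \<in> S \<Longrightarrow> bij (f s)"
    and braid: "\<And>s t n. s \<in> S \<Longrightarrow> t \<in> S \<Longrightarrow> s \<noteq> t \<Longrightarrow> m s t = enat n \<Longrightarrow>
      fold f (alt_list s t n) = fold f (alt_list t s n)"
  shows "fold f u = fold f v"
proof -
  have "sact f (pos_word u) = sact f (pos_word v)"
  proof (rule sact_presentation_cong[OF assms(1) bij])
    fix a b assume "(a, b) \<in> braid_relations S m"
    then show "sact f a = sact f b"
      by (elim braid_relationsE) (metis sact_pos_word braid)
  qed
  then show ?thesis by (simp add: sact_pos_word)
qed

text \<open>The greatest common prefix z, obtained by splitting off common left descents until none
  remain.\<close>

lemma common_prefix:
  assumes "reduced h" "reduced a"
  obtains z y y' where "reduced (z @ y)" "act (z @ y) = act h" "reduced (z @ y')" "act (z @ y') = act a"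
    "\<And>s. s \<in> S \<Longrightarrow> left_descent y s \<Longrightarrow> \<not> left_descent y' s"
proof -
  have "\<exists>z y y'. reduced (z @ y) \<and> act (z @ y) = act h \<and> reduced (z @ y') \<and> act (z @ y') = act a \<and>
      (\<forall>s\<in>S. left_descent y s \<longrightarrow> \<not> left_descent y' s)"
    if "reduced (z @ y)" "act (z @ y) = act h" "reduced (z @ y')" "act (z @ y') = act a" for z y y'
    using that
  proof (induction "length y" arbitrary: z y y' rule: less_induct)
    case less
    show ?case
    proof (cases "\<forall>s\<in>S. left_descent y s \<longrightarrow> \<not> left_descent y' s")
      case True
      then show ?thesis using less.prems by blast
    next
      case False
      then obtain s where s: "s \<in> S" "left_descent y s" "left_descent y' s" by blast
      have r: "reduced y" "reduced y'" using less.prems red_appendD2 by blast+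
      obtain u where u: "reduced (s # u)" "act (s # u) = act y" "length y = Suc (length u)"
        using LD_exchange[OF r(1) s(1,2)] by blast
      obtain u' where u': "reduced (s # u')" "act (s # u') = act y'" "length y' = Suc (length u')"
        using LD_exchange[OF r(2) s(1,3)] by blast
      have a: "act ((z @ [s]) @ u) = act (z @ y)" "act ((z @ [s]) @ u') = act (z @ y')"
        using u(2) u'(2) act_cong_append[of z z "s # u" y] act_cong_append[of z z "s # u'" y'] by simp_all
      have l: "z \<in> lists S" "u \<in> lists S" "u' \<in> lists S"
        using red_lists[OF less.prems(1)] red_lists[OF u(1)] red_lists[OF u'(1)] by auto
      have "reduced ((z @ [s]) @ u)" "reduced ((z @ [s]) @ u')"
        using red_cong[OF less.prems(1) _ a(1)] red_cong[OF less.prems(3) _ a(2)] l s(1) u(3) u'(3)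
        by auto
      then show ?thesis using less.hyps[of u "z @ [s]" u'] u(3) a less.prems by simp
    qed
  qed
  from this[of "[]" h a] show ?thesis using that assms by auto
qed

subsection \<open>Unfolding to a triangle-free simply laced system\<close>

text \<open>\<open>THE\<close> is well defined on pairs because \<open>m\<close> is symmetric on S
  (\<open>md_pair\<close>).\<close>

definition pair_m :: "'s set \<Rightarrow> enat" where
  "pair_m p = (THE k. \<exists>s\<in>S. \<exists>t\<in>S. s \<noteq> t \<and> p = {s, t} \<and> k = m s t)"

definition Pairs :: "'s set set" where
  "Pairs = {{s, t} | s t. s \<in> S \<and> t \<in> S \<and> s \<noteq> t}"

text \<open>Over the pair \<open>{s, t}\<close> we place the bipartite double of the path with \<open>m s t - 1\<close> vertices,
  or of the triangle if \<open>m s t = \<infinity>\<close>; \<open>perron\<close> is the Perron eigenvector, of eigenvalue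
  \<open>2 cos (\<pi> / m s t)\<close>, or \<open>2\<close>.\<close>

definition label_range :: "'s set \<Rightarrow> nat set" where
  "label_range p = (if pair_m p = \<infinity> then {0, 1, 2} else {1..<the_enat (pair_m p)})"

definition label_adj :: "'s set \<Rightarrow> nat \<Rightarrow> nat \<Rightarrow> bool" where
  "label_adj p i j \<longleftrightarrow> (if pair_m p = \<infinity> then i \<noteq> j else i = Suc j \<or> j = Suc i)"

definition perron :: "'s set \<Rightarrow> nat \<Rightarrow> real" where
  "perron p i = (if pair_m p = \<infinity> then 1 else sin (real i * (pi / real (the_enat (pair_m p)))))"

text \<open>A label chooses a vertex for every pair at once. All fibres then have the same labels,
  and different pairs act on independent coordinates, so that the Perron weights can be
  multiplied.\<close>

definition labels :: "('s set \<Rightarrow> nat) set" where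
  "labels = PiE Pairs label_range"

definition label_weight :: "('s set \<Rightarrow> nat) \<Rightarrow> real" where
  "label_weight x = (\<Prod>p\<in>Pairs. perron p (x p))"

definition unfolded :: "('s \<times> ('s set \<Rightarrow> nat)) set" where
  "unfolded = S \<times> labels"

definition joined :: "'s \<times> ('s set \<Rightarrow> nat) \<Rightarrow> 's \<times> ('s set \<Rightarrow> nat) \<Rightarrow> bool" where
  "joined i j \<longleftrightarrow> fst i \<noteq> fst j \<and> (\<forall>p\<in>Pairs. p \<noteq> {fst i, fst j} \<longrightarrow> snd i p = snd j p)
     \<and> label_adj {fst i, fst j} (snd i {fst i, fst j}) (snd j {fst i, fst j})"

definition unfolded_m :: "'s \<times> ('s set \<Rightarrow> nat) \<Rightarrow> 's \<times> ('s set \<Rightarrow> nat) \<Rightarrow> enat" where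
  "unfolded_m i j = (if i = j then 1 else if joined i j then 3 else 2)"

lemma md_pair:
  assumes "s \<in> S" "t \<in> S" "s \<noteq> t"
  shows "pair_m {s, t} = m s t"
  unfolding pair_m_def
proof (rule the_equality)
  show "k = m s t" if "\<exists>s'\<in>S. \<exists>t'\<in>S. s' \<noteq> t' \<and> {s, t} = {s', t'} \<and> k = m s' t'" for k
    using that m_sym assms by (auto simp: doubleton_eq_iff)
qed (use assms in blast)

lemma finite_Pairs: "finite Pairs"
proof -
  have "Pairs \<subseteq> Pow S" by (auto simp: Pairs_def)
  then show ?thesis using finite_S finite_subset by blast
qed

lemma PairsE:
  assumes "p \<in> Pairs"
  obtains s t where "s \<in> S" "t \<in> S" "s \<noteq> t" "p = {s, t}" "pair_m p = m s t"
  using assms md_pair unfolding Pairs_def by blast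

lemma finite_idx: "finite (label_range p)"
  by (simp add: label_range_def)

lemma idx_nonempty: "p \<in> Pairs \<Longrightarrow> label_range p \<noteq> {}"
proof (elim PairsE)
  fix s t assume st: "s \<in> S" "t \<in> S" "s \<noteq> t" "pair_m p = m s t"
  show "label_range p \<noteq> {}" using m_ge_2[OF st(1-3)] st(4) by (auto simp: label_range_def)
qed

lemma finite_X: "finite labels"
  unfolding labels_def using finite_Pairs finite_idx by (intro finite_PiE) auto

lemma X_nonempty: "labels \<noteq> {}"
  unfolding labels_def using idx_nonempty by (simp add: PiE_eq_empty_iff)

lemma wg_pos:
  assumes "p \<in> Pairs" "i \<in> label_range p"
  shows "perron p i > 0"
proof (cases "pair_m p = \<infinity>")
  case False
  then obtain n where n: "pair_m p = enat n" by auto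
  then have "0 < i" "i < n" using assms(2) by (auto simp: label_range_def)
  then have "0 < real i * (pi / real n)" "real i * (pi / real n) < pi"
    by (simp_all add: field_simps)
  then show ?thesis using n sin_gt_zero by (simp add: perron_def)
qed (simp add: perron_def)

lemma wt_pos: "x \<in> labels \<Longrightarrow> label_weight x > 0"
  unfolding label_weight_def using wg_pos by (intro prod_pos) (auto simp: labels_def)

lemma adj_sym: "label_adj p i j = label_adj p j i"
  by (auto simp: label_adj_def)

lemma adj_irrefl: "\<not> label_adj p i i"
  by (auto simp: label_adj_def)

lemma joined_sym: "joined i j \<longleftrightarrow> joined j i"
  by (auto simp: joined_def adj_sym insert_commute)

text \<open>On the path this is sin(a - h) + sin(a + h) = 2 cos h sin a; on the triangle every
  vertex has two neighbours of weight 1.\<close>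

lemma wg_eigen:
  assumes p: "p \<in> Pairs" and st: "s \<in> S" "t \<in> S" "s \<noteq> t" "p = {s, t}" and i: "i \<in> label_range p"
  shows "(\<Sum>j\<in>{j\<in>label_range p. label_adj p j i}. perron p j) = kk s t * perron p i"
proof (cases "m s t = \<infinity>")
  case True
  then have pair_m: "pair_m p = \<infinity>" using md_pair st by simp
  have "{j \<in> label_range p. label_adj p j i} = {0, 1, 2} - {i}" by (auto simp: label_range_def label_adj_def pair_m)
  moreover have "card ({0, 1, 2 :: nat} - {i}) = 2" using i pair_m by (auto simp: label_range_def)
  ultimately show ?thesis using pair_m True by (simp add: perron_def kk_def)
next
  case False
  then obtain n where n: "m s t = enat n" by auto
  then have pair_m: "pair_m p = enat n" using md_pair st by simp
  define h where "h = pi / real n"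
  have i': "1 \<le> i" "i < n" using i pair_m by (auto simp: label_range_def)
  have perron: "perron p j = sin (real j * h)" for j by (simp add: perron_def pair_m h_def)
  have "(\<Sum>j\<in>{j\<in>label_range p. label_adj p j i}. perron p j) = (\<Sum>j\<in>{i - 1, i + 1}. perron p j)"
  proof (rule sum.mono_neutral_left)
    show "{j \<in> label_range p. label_adj p j i} \<subseteq> {i - 1, i + 1}" by (auto simp: label_adj_def pair_m)
    show "\<forall>j\<in>{i - 1, i + 1} - {j \<in> label_range p. label_adj p j i}. perron p j = 0"
    proof
      fix j assume j: "j \<in> {i - 1, i + 1} - {j \<in> label_range p. label_adj p j i}"
      \<comment> \<open>The neighbours missing at the ends of the path would be 0 and n, where the
        sine vanishes.\<close>
      then have "j = 0 \<or> j = n" using i' pair_m by (auto simp: label_range_def label_adj_def)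
      then show "perron p j = 0" using i' by (auto simp: perron h_def)
    qed
  qed simp
  also have "\<dots> = sin (real i * h - h) + sin (real i * h + h)"
    using i' by (simp add: perron of_nat_diff algebra_simps)
  also have "\<dots> = 2 * cos h * sin (real i * h)" by (simp add: sin_add sin_diff)
  finally show ?thesis by (simp add: kk_def n perron h_def)
qed

lemma wt_eigen:
  assumes st: "s \<in> S" "t \<in> S" "s \<noteq> t" and y: "y \<in> labels"
  shows "(\<Sum>x\<in>labels. (if joined (s, x) (t, y) then 1 else 0) * label_weight x) = kk s t * label_weight y"
proof -
  define p where "p = {s, t}"
  have p: "p \<in> Pairs" using st by (auto simp: Pairs_def p_def)
  have yp: "y p \<in> label_range p" using y p by (auto simp: labels_def)
  define J where "J = {j\<in>label_range p. label_adj p j (y p)}"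
  have "{x\<in>labels. joined (s, x) (t, y)} = (\<lambda>j. y(p := j)) ` J"
  proof (intro Set.set_eqI iffI)
    fix x assume "x \<in> {x\<in>labels. joined (s, x) (t, y)}"
    then have x: "x \<in> labels" "\<And>q. q \<in> Pairs \<Longrightarrow> q \<noteq> p \<Longrightarrow> x q = y q" "label_adj p (x p) (y p)"
      by (simp_all add: joined_def p_def)
    have "x = y(p := x p)"
    proof
      fix q
      have "x q = y q" if "q \<notin> Pairs"
        using x(1) y that PiE_arb[of x Pairs label_range q] PiE_arb[of y Pairs label_range q] by (simp add: labels_def)
      then show "x q = (y(p := x p)) q"
        using x(2)[of q] by (cases "q = p"; cases "q \<in> Pairs") simp_all
    qed
    moreover have "x p \<in> J" using x(1,3) p PiE_mem[of x Pairs label_range p] by (simp add: labels_def J_def)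
    ultimately show "x \<in> (\<lambda>j. y(p := j)) ` J" by blast
  next
    fix x assume "x \<in> (\<lambda>j. y(p := j)) ` J"
    then obtain j where j: "j \<in> J" "x = y(p := j)" by blast
    have j': "j \<in> label_range p" "label_adj p j (y p)" using j(1) by (simp_all add: J_def)
    have "x \<in> labels" using PiE_fun_upd[of j label_range p y Pairs] j' y j(2) insert_absorb[OF p]
      by (simp add: labels_def)
    moreover have "x q = y q" if "q \<noteq> p" for q using that j(2) by simp
    moreover have "label_adj p (x p) (y p)" using j' j(2) by simp
    ultimately show "x \<in> {x\<in>labels. joined (s, x) (t, y)}" using st by (simp add: joined_def p_def)
  qed
  moreover have "inj_on (\<lambda>j. y(p := j)) J" by (rule inj_onI) (metis fun_upd_same)
  moreover have wtu: "label_weight (y(p := j)) = perron p j * (\<Prod>q\<in>Pairs - {p}. perron q (y q))" for j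
    unfolding label_weight_def using prod.remove[OF finite_Pairs p, of "\<lambda>q. perron q ((y(p := j)) q)"] by simp
  ultimately have "(\<Sum>x\<in>{x\<in>labels. joined (s, x) (t, y)}. label_weight x)
      = (\<Sum>j\<in>J. perron p j) * (\<Prod>q\<in>Pairs - {p}. perron q (y q))"
    by (simp add: sum.reindex sum_distrib_right)
  also have "(\<Sum>j\<in>J. perron p j) = kk s t * perron p (y p)"
    unfolding J_def by (rule wg_eigen[OF p st p_def yp])
  also have "\<dots> * (\<Prod>q\<in>Pairs - {p}. perron q (y q)) = kk s t * label_weight y"
    using wtu[of "y p"] by simp
  finally show ?thesis
    using sum.inter_filter[OF finite_X, of label_weight "\<lambda>x. joined (s, x) (t, y)"]
    by (simp add: if_distrib[of "\<lambda>c. c * _"] cong: if_cong)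
qed

text \<open>Three pairwise joined vertices would lie over distinct generators s, t, r. The two edges
  at r leave the coordinate {s, t} unchanged, whereas the edge between s and t has to change
  it.\<close>

lemma unfolding_small_type: "small_type unfolded unfolded_m"
proof
  show "coxeter_matrix unfolded unfolded_m"
    unfolding coxeter_matrix_def
    using finite_S finite_X by (auto simp: unfolded_def unfolded_m_def joined_sym)
  show "unfolded_m i j = 2 \<or> unfolded_m i j = 3" if "i \<noteq> j" for i j using that by (simp add: unfolded_m_def)
  have three: "joined i j" if "unfolded_m i j = 3" for i j
    using that by (auto simp: unfolded_m_def split: if_splits)
  show "unfolded_m j l \<noteq> 3" if "i \<in> unfolded" "j \<in> unfolded" "l \<in> unfolded" "unfolded_m i j = 3" "unfolded_m i l = 3" for i j l
  proof
    assume "unfolded_m j l = 3"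
    then have J: "joined i j" "joined i l" "joined j l" using three that by blast+
    obtain s x t y r z where ijl: "i = (s, x)" "j = (t, y)" "l = (r, z)" by (metis prod.exhaust)
    have st: "s \<noteq> t" "s \<noteq> r" "t \<noteq> r" "s \<in> S" "t \<in> S" using J ijl that by (auto simp: joined_def unfolded_def)
    then have "{s, t} \<in> Pairs" by (auto simp: Pairs_def)
    moreover have "{s, t} \<noteq> {s, r}" "{s, t} \<noteq> {t, r}" using st by (auto simp: doubleton_eq_iff)
    ultimately have "x {s, t} = z {s, t}" "y {s, t} = z {s, t}" using J ijl by (auto simp: joined_def)
    then show False using J(1) ijl adj_irrefl by (simp add: joined_def)
  qed
qed

section \<open>Signs of roots and reduced words in the unfolding\<close>

interpretation F: small_type unfolded unfolded_m
  by (rule unfolding_small_type)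

lemma F_kk:
  assumes "(s, x) \<in> unfolded"
  shows "F.kk (s, x) (t, y) = (if (s, x) = (t, y) then -2 else if joined (s, x) (t, y) then 1 else 0)"
  using F.kk_self[OF assms] F.kk_2[of "(s, x)" "(t, y)"] F.kk_3[of "(s, x)" "(t, y)"]
  by (auto simp: unfolded_m_def)

lemma not_joined_fibre: "\<not> joined (s, x) (s, y)"
  by (simp add: joined_def)

text \<open>By the eigenvector identity this weighted sum intertwines the product of the reflections
  of a fibre with the reflection of its generator (\<open>proj_act_Fl\<close>).\<close>

definition proj :: "('s \<times> ('s set \<Rightarrow> nat) \<Rightarrow> real) \<Rightarrow> 's \<Rightarrow> real" where
  "proj v s = (\<Sum>x\<in>labels. label_weight x * v (s, x))"

definition X_list :: "('s set \<Rightarrow> nat) list" where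
  "X_list = (SOME xs. set xs = labels \<and> distinct xs)"

text \<open>Vertices over one generator are pairwise not joined, so their reflections commute and
  the arbitrary order of \<open>X_list\<close> is harmless.\<close>

definition fibre :: "'s \<Rightarrow> ('s \<times> ('s set \<Rightarrow> nat)) list" where
  "fibre s = map (Pair s) X_list"

definition unfold_word :: "'s list \<Rightarrow> ('s \<times> ('s set \<Rightarrow> nat)) list" where
  "unfold_word w = concat (map fibre w)"

lemma X_list: "set X_list = labels" "distinct X_list"
proof -
  have "\<exists>xs. set xs = labels \<and> distinct xs" using finite_distinct_list[OF finite_X] by blast
  then have "set X_list = labels \<and> distinct X_list" unfolding X_list_def by (rule someI_ex)
  then show "set X_list = labels" "distinct X_list" by auto
qed

lemma F_ip_fibre:
  assumes "s \<in> S" "set xs \<subseteq> labels" "x \<in> labels" "x \<notin> set xs"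
  shows "F.ip (s, x) (F.act (map (Pair s) xs) v) = F.ip (s, x) v"
  using assms(2,4)
proof (induction xs rule: list.induct)
  case (Cons y xs)
  have "(s, y) \<in> unfolded" "(s, x) \<in> unfolded" using Cons.prems assms(1,3) by (auto simp: unfolded_def)
  then show ?case using Cons by (auto simp: F.ip_refl F_kk not_joined_fibre)
qed simp

lemma F_act_fibre:
  assumes "s \<in> S" "set xs \<subseteq> labels" "distinct xs"
  shows "F.act (map (Pair s) xs) v =
    (\<lambda>i. if fst i = s \<and> snd i \<in> set xs then v i - F.ip i v else v i)"
  using assms(2,3)
proof (induction xs rule: list.induct)
  case (Cons y xs)
  have "F.ip (s, y) (F.act (map (Pair s) xs) v) = F.ip (s, y) v"
    using F_ip_fibre[OF assms(1), of xs y] Cons.prems by simp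
  then show ?case using Cons by (intro ext) (auto simp: F.sg_def)
qed simp

lemma F_act_Fl: "s \<in> S \<Longrightarrow> F.act (fibre s) v = (\<lambda>i. if fst i = s \<and> snd i \<in> labels then v i - F.ip i v else v i)"
  unfolding fibre_def using F_act_fibre[of s X_list v] X_list by simp

lemma F_act_rev_Fl: "s \<in> S \<Longrightarrow> F.act (rev (fibre s)) = F.act (fibre s)"
  unfolding fibre_def rev_map using F_act_fibre[of s X_list] F_act_fibre[of s "rev X_list"] X_list by (intro ext) simp

lemma sum_F_kk:
  assumes "s \<in> S" "t \<in> S" "y \<in> labels"
  shows "(\<Sum>x\<in>labels. label_weight x * F.kk (s, x) (t, y)) = kk s t * label_weight y"
proof (cases "s = t")
  case True
  have "(\<Sum>x\<in>labels. label_weight x * F.kk (s, x) (t, y)) = (\<Sum>x\<in>labels. if x = y then - 2 * label_weight y else 0)"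
    using assms True by (intro sum.cong) (auto simp: F_kk unfolded_def not_joined_fibre)
  then show ?thesis using assms True finite_X by (simp add: kk_self)
next
  case False
  have "(\<Sum>x\<in>labels. label_weight x * F.kk (s, x) (t, y)) = (\<Sum>x\<in>labels. (if joined (s, x) (t, y) then 1 else 0) * label_weight x)"
    using assms False by (intro sum.cong) (auto simp: F_kk unfolded_def)
  then show ?thesis using wt_eigen[OF assms(1,2) False assms(3)] by simp
qed

lemma sum_F_ip:
  assumes "s \<in> S"
  shows "(\<Sum>x\<in>labels. label_weight x * F.ip (s, x) v) = ip s (proj v)"
proof -
  have "(\<Sum>x\<in>labels. label_weight x * F.ip (s, x) v) = - (\<Sum>x\<in>labels. \<Sum>i\<in>unfolded. label_weight x * F.kk (s, x) i * v i)"
    by (simp add: F.ip_def sum_distrib_left sum_negf mult.assoc)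
  also have "(\<Sum>x\<in>labels. \<Sum>i\<in>unfolded. label_weight x * F.kk (s, x) i * v i) = (\<Sum>i\<in>unfolded. \<Sum>x\<in>labels. label_weight x * F.kk (s, x) i * v i)"
    by (rule sum.swap)
  also have "\<dots> = (\<Sum>i\<in>unfolded. kk s (fst i) * label_weight (snd i) * v i)"
  proof (rule sum.cong)
    fix i assume "i \<in> unfolded"
    then show "(\<Sum>x\<in>labels. label_weight x * F.kk (s, x) i * v i) = kk s (fst i) * label_weight (snd i) * v i"
      using sum_F_kk[OF assms, of "fst i" "snd i"]
      by (auto simp: unfolded_def sum_distrib_right[symmetric])
  qed simp
  also have "\<dots> = (\<Sum>t\<in>S. \<Sum>y\<in>labels. kk s t * label_weight y * v (t, y))"
    unfolding unfolded_def by (simp add: sum.cartesian_product case_prod_beta)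
  also have "\<dots> = (\<Sum>t\<in>S. kk s t * proj v t)"
    by (simp add: proj_def sum_distrib_left mult.assoc)
  finally show ?thesis by (simp add: ip_def)
qed

lemma proj_act_Fl:
  assumes "s \<in> S"
  shows "proj (F.act (fibre s) v) = sg s (proj v)"
proof
  fix r
  show "proj (F.act (fibre s) v) r = sg s (proj v) r"
  proof (cases "r = s")
    case True
    have "proj (F.act (fibre s) v) s = (\<Sum>x\<in>labels. label_weight x * v (s, x) - label_weight x * F.ip (s, x) v)"
      unfolding proj_def by (rule sum.cong) (simp_all add: F_act_Fl[OF assms] right_diff_distrib)
    also have "\<dots> = proj v s - ip s (proj v)"
      using sum_F_ip[OF assms] by (simp add: sum_subtractf proj_def)
    finally show ?thesis using True by (simp add: sg_def)
  next
    case False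
    then show ?thesis by (simp add: proj_def F_act_Fl[OF assms] sg_def)
  qed
qed

lemma Fw_Nil [simp]: "unfold_word [] = []" and Fw_Cons [simp]: "unfold_word (s # w) = fibre s @ unfold_word w"
  and Fw_append [simp]: "unfold_word (v @ w) = unfold_word v @ unfold_word w"
  by (simp_all add: unfold_word_def)

lemma proj_act: "w \<in> lists S \<Longrightarrow> proj (F.act (unfold_word w) v) = act w (proj v)"
  by (induction w rule: list.induct) (auto simp: proj_act_Fl)

lemma Fl_lists: "s \<in> J \<Longrightarrow> fibre s \<in> lists (J \<times> labels)"
  by (simp add: in_lists_conv_set fibre_def X_list(1))

lemma Fw_lists: "w \<in> lists J \<Longrightarrow> unfold_word w \<in> lists (J \<times> labels)"
  by (induction w rule: list.induct) (simp_all add: Fl_lists del: in_lists_conv_set)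

lemma Fw_lists_St: "w \<in> lists S \<Longrightarrow> unfold_word w \<in> lists unfolded"
  unfolding unfolded_def by (rule Fw_lists)

lemma F_act_rev_Fw: "w \<in> lists S \<Longrightarrow> F.act (rev (unfold_word w)) = F.act (unfold_word (rev w))"
proof (induction w rule: list.induct)
  case (Cons s w)
  then have "F.act (rev (unfold_word w)) = F.act (unfold_word (rev w))" "s \<in> S" by simp_all
  then show ?case by (simp add: F.act_eq_iff F_act_rev_Fl)
qed simp

lemma proj_e:
  assumes "s \<in> S" "x \<in> labels"
  shows "proj (F.e (s, x)) = (\<lambda>r. label_weight x * e s r)"
proof
  fix r
  have "proj (F.e (s, x)) r = (\<Sum>y\<in>labels. if y = x then (if r = s then label_weight x else 0) else 0)"
    unfolding proj_def by (rule sum.cong) (auto simp: F.e_def)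
  then show "proj (F.e (s, x)) r = label_weight x * e s r" using assms finite_X by (simp add: e_def)
qed

text \<open>A root of the unfolding has one sign and \<open>proj\<close> has positive weights. The
  sign can thus be read off the projection, a positive multiple of w e_s.\<close>

lemma nn_Fw:
  assumes "w \<in> lists S" "s \<in> S" "x \<in> labels"
  shows "F.nn (F.act (unfold_word w) (F.e (s, x))) \<longleftrightarrow> nn (act w (e s))"
proof -
  let ?v = "F.act (unfold_word w) (F.e (s, x))"
  have i: "(s, x) \<in> unfolded" using assms by (simp add: unfolded_def)
  have p: "proj ?v = (\<lambda>r. label_weight x * act w (e s) r)"
    using act_lin[of w "label_weight x" "e s" 0 "e s"] by (simp add: proj_act[OF assms(1)] proj_e[OF assms(2,3)])
  have pos: "nn (proj v)" if "F.nn v" for v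
    using that wt_pos unfolding nn_def F.nn_def proj_def by (auto intro!: sum_nonneg simp: less_imp_le)
  have w0: "label_weight x > 0" using wt_pos assms by blast
  show ?thesis
  proof (cases "F.nn ?v")
    case True
    then have "nn (\<lambda>r. label_weight x * act w (e s) r)" using pos p by metis
    then show ?thesis using True w0 by (simp add: nn_def zero_le_mult_iff)
  next
    case False
    then have "F.nn (\<lambda>i. - ?v i)" using F.root_cases[OF Fw_lists_St[OF assms(1)] i] by blast
    then have "nn (proj (\<lambda>i. - ?v i))" by (rule pos)
    moreover have "proj (\<lambda>i. - ?v i) = (\<lambda>r. - (label_weight x * act w (e s) r))"
      using p by (simp add: proj_def sum_negf fun_eq_iff)
    ultimately have "nn (\<lambda>r. - act w (e s) r)" using w0 by (simp add: nn_def mult_le_0_iff)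
    then have "\<not> nn (act w (e s))" using not_nn_both[OF assms(1,2)] by blast
    then show ?thesis using False by simp
  qed
qed

lemma LD_Fw:
  assumes "w \<in> lists S" "s \<in> S" "x \<in> labels"
  shows "F.left_descent (unfold_word w) (s, x) \<longleftrightarrow> left_descent w s"
  unfolding left_descent_def F.left_descent_def F_act_rev_Fw[OF assms(1)] using nn_Fw[of "rev w" s x] assms by simp

lemma red_Fw_fibre:
  assumes "F.reduced (unfold_word w)" "w \<in> lists S" "s \<in> S" "nn (act w (e s))" "set xs \<subseteq> labels" "distinct xs"
  shows "F.reduced (unfold_word w @ map (Pair s) xs)"
  using assms(5,6)
proof (induction xs rule: rev_induct)
  case (snoc x xs)
  have i: "(s, x) \<in> unfolded" using snoc.prems assms(3) by (simp add: unfolded_def)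
  have "F.ip (s, y) (F.e (s, x)) = 0" if "y \<in> set xs" for y
    using that snoc.prems assms(3) i by (subst F.ip_e) (auto simp: F_kk unfolded_def not_joined_fibre)
  then have "F.act (map (Pair s) xs) (F.e (s, x)) = F.e (s, x)"
    using F_act_fibre[OF assms(3), of xs "F.e (s, x)"] snoc.prems by (auto simp: fun_eq_iff)
  then have "F.nn (F.act (unfold_word w @ map (Pair s) xs) (F.e (s, x)))"
    using nn_Fw[OF assms(2,3), of x] assms(4) snoc.prems by simp
  moreover have "F.reduced (unfold_word w @ map (Pair s) xs)" using snoc by simp
  ultimately have "F.reduced ((unfold_word w @ map (Pair s) xs) @ [(s, x)])"
    using F.red_snoc_iff[OF _ i] by blast
  then show ?case by simp
qed (use assms in simp)

lemma red_Fw: "reduced w \<Longrightarrow> F.reduced (unfold_word w)"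
proof (induction w rule: rev_induct)
  case (snoc s w)
  have "reduced w" "s \<in> S" using snoc.prems red_appendD1 red_lists by fastforce+
  then have "F.reduced (unfold_word w @ map (Pair s) X_list)"
    using red_Fw_fibre[of w s X_list] snoc red_snoc_iff X_list red_lists by auto
  then show ?case by (simp add: fibre_def)
qed simp

lemma longest_alt_list:
  assumes "s \<in> S" "t \<in> S" "s \<noteq> t" "m s t = enat n"
  shows "longest {s, t} (alt_list s t n)"
proof -
  have mts: "m t s = enat n" using assms m_sym by simp
  obtain n' where n': "n = Suc n'" using m_ge_2[of s t] assms by (cases n) auto
  have r: "reduced (alt_list s t n)" "reduced (alt_list t s n)"
    using red_alt_list[of s t n] red_alt_list[of t s n] assms mts by auto
  have "left_descent (alt_list s t n) s" "left_descent (alt_list t s n) t"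
    using LD_Cons r n' by simp_all
  then show ?thesis
    using r LD_cong[OF red_lists[OF r(1)] red_lists[OF r(2)] braid_act[OF assms]] by (auto simp: longest_def)
qed

lemma F_longest:
  assumes "J \<subseteq> S" "longest J d"
  shows "F.longest (J \<times> labels) (unfold_word d)"
  using assms red_Fw[of d] Fw_lists[of d J] LD_Fw[of d] red_lists[of d]
  by (auto simp: longest_def F.longest_def)

text \<open>Both sides unfold to the longest element of the parabolic subgroup over {s, t}, which is
  unique.\<close>

lemma F_act_braid:
  assumes "s \<in> S" "t \<in> S" "s \<noteq> t" "m s t = enat n"
  shows "F.act (unfold_word (alt_list s t n)) = F.act (unfold_word (alt_list t s n))"
proof -
  have J: "{s, t} \<times> labels \<subseteq> unfolded" using assms by (auto simp: unfolded_def)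
  have "F.longest ({s, t} \<times> labels) (unfold_word (alt_list s t n))"
    using F_longest longest_alt_list[OF assms] assms by simp
  moreover have "F.longest ({s, t} \<times> labels) (unfold_word (alt_list t s n))"
    using F_longest longest_alt_list[of t s n] assms m_sym by (simp add: insert_commute)
  ultimately show ?thesis using F.longest_unique[OF J] by blast
qed

lemma F_Kw_braid:
  assumes "s \<in> S" "t \<in> S" "s \<noteq> t" "m s t = enat n"
  shows "F.K_word x (unfold_word (alt_list s t n)) = F.K_word x (unfold_word (alt_list t s n))"
proof -
  have "reduced (alt_list s t n)" "reduced (alt_list t s n)"
    using red_alt_list[of s t n] red_alt_list[of t s n] assms m_sym by auto
  then show ?thesis using F.Kw_matsumoto[OF red_Fw red_Fw F_act_braid[OF assms]] by blast
qed

lemma F_act_cong: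
  assumes "reduced u" "reduced v" "act u = act v"
  shows "F.act (unfold_word u) = F.act (unfold_word v)"
proof (rule matsumoto[where R = "\<lambda>u v. F.act (unfold_word u) = F.act (unfold_word v)" and T = S and u = u and v = v])
  fix s u v assume "F.act (unfold_word u) = F.act (unfold_word v)"
  then show "F.act (unfold_word (s # u)) = F.act (unfold_word (s # v))" by (simp add: F.act_eq_iff)
next
  fix s t n y assume "s \<in> S" "t \<in> S" "s \<noteq> t" "m s t = enat n"
  then show "F.act (unfold_word (alt_list s t n @ y)) = F.act (unfold_word (alt_list t s n @ y))"
    using F_act_braid[of s t n] by (simp add: F.act_eq_iff)
qed (use assms red_lists in auto)

lemma fold_Kw: "fold (\<lambda>s. F.K_word x (fibre s)) w = F.K_word x (unfold_word w)"
  by (induction w) (auto simp: fun_eq_iff)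

lemma bij_Kw: "x \<noteq> 0 \<Longrightarrow> w \<in> lists unfolded \<Longrightarrow> bij (F.K_word x w)"
proof (induction w rule: list.induct)
  case Nil
  have "F.K_word x [] = id" by auto
  then show ?case by (metis bij_id)
next
  case (Cons i w)
  have "F.K_word x (i # w) = F.K_word x w \<circ> F.K x i" by auto
  moreover have "bij (F.K_word x w)" "bij (F.K x i)" using Cons F.bij_K[of i x] by simp_all
  ultimately show ?case by (metis bij_comp)
qed

lemma normal_chain_Fw: "normal_chain as \<Longrightarrow> F.normal_chain (map unfold_word as)"
proof (induction as rule: normal_chain.induct)
  case (3 a b as)
  have ab: "reduced a" "reduced b" using 3 by (cases as; auto)+
  have "\<not> F.nn (F.act (unfold_word a) (F.e i))" if "i \<in> unfolded" "F.left_descent (unfold_word b) i" for i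
    using that 3 LD_Fw[OF red_lists[OF ab(2)]] nn_Fw[OF red_lists[OF ab(1)]] by (auto simp: unfolded_def)
  then show ?case using 3 ab red_Fw by simp
qed (auto simp: red_Fw)

text \<open>Let z be the greatest common prefix of h and a. If h goes on with a letter s, then z e_s
  is an inversion of h, while s is no descent of the rest of a;
  \<open>inversions_of_divisor\<close>, applied in the unfolding, excludes this.\<close>

theorem divisor_of_normal_chain:
  assumes h: "reduced h" and c: "c \<in> lists S" and chain: "normal_chain (a # as)"
    and eq: "(pos_word (h @ c), pos_word (concat (a # as))) \<in> presentation_cong S (braid_relations S m)"
  shows "\<exists>y. reduced (h @ y) \<and> act (h @ y) = act a"
proof -
  have ra: "reduced a" using chain by (cases as) auto
  obtain z y y' where z: "reduced (z @ y)" "act (z @ y) = act h" "reduced (z @ y')" "act (z @ y') = act a"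
      "\<And>s. s \<in> S \<Longrightarrow> left_descent y s \<Longrightarrow> \<not> left_descent y' s"
    using common_prefix[OF h ra] by blast
  have zS: "z \<in> lists S" "y \<in> lists S" "y' \<in> lists S" "h \<in> lists S"
    using red_lists[OF z(1)] red_lists[OF z(3)] red_lists[OF h] by auto
  show ?thesis
  proof (cases y)
    case Nil
    then have "act h = act z" using z(2) by simp
    moreover have "length h = length z" using red_length[OF h red_appendD1[OF z(1)]] calculation by simp
    ultimately show ?thesis
      using red_cong[OF z(3), of "h @ y'"] zS z(4) act_cong_append[of h z y' y'] by (intro exI[of _ y']) simp
  next
    case (Cons s y1)
    have s: "s \<in> S" using zS Cons by simp
    have ry: "reduced (s # y1)" using red_appendD2[OF z(1)] Cons by simp
    have lds: "left_descent y s" using LD_Cons[OF ry] Cons by simp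
    obtain x where x: "x \<in> labels" using X_nonempty by blast
    have i: "(s, x) \<in> unfolded" using s x by (simp add: unfolded_def)
    have "F.nn (F.act (rev (unfold_word h)) (F.act (unfold_word z) (F.e (s, x))))"
    proof (rule F.inversions_of_divisor[where c = "unfold_word c" and a = "unfold_word a" and as = "map unfold_word as" and y = "unfold_word y'"])
      show "F.reduced (unfold_word h)" using red_Fw h by blast
      show "unfold_word c \<in> lists unfolded" using Fw_lists_St c by blast
      show "F.normal_chain (unfold_word a # map unfold_word as)" using normal_chain_Fw[OF chain] by simp
      show "F.reduced (unfold_word z @ unfold_word y')" using red_Fw[OF z(3)] by simp
      show "F.act (unfold_word z @ unfold_word y') = F.act (unfold_word a)" using F_act_cong[OF z(3) ra z(4)] by simp
      show "\<not> F.left_descent (unfold_word y') (s, x)" using LD_Fw[OF zS(3) s x] z(5)[OF s lds] by simp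
      have "reduced (z @ [s])" using z(1) Cons red_appendD1[of "z @ [s]" y1] by simp
      then have "nn (act z (e s))" using red_snoc_iff[OF red_appendD1[OF z(1)] s] by simp
      then show "F.reduced (unfold_word z @ [(s, x)])"
        using red_Fw_fibre[OF red_Fw[OF red_appendD1[OF z(1)]] zS(1) s, of "[x]"] x by simp
      fix k :: real assume k: "k \<noteq> 0"
      have "fold (\<lambda>s. F.K_word k (fibre s)) (h @ c) = fold (\<lambda>s. F.K_word k (fibre s)) (concat (a # as))"
      proof (rule artin_action[OF eq])
        show "bij (F.K_word k (fibre s))" if "s \<in> S" for s
          using bij_Kw[OF k] Fw_lists_St[of "[s]"] that by simp
        show "fold (\<lambda>s. F.K_word k (fibre s)) (alt_list s t n) = fold (\<lambda>s. F.K_word k (fibre s)) (alt_list t s n)"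
          if "s \<in> S" "t \<in> S" "s \<noteq> t" "m s t = enat n" for s t n
          unfolding fold_Kw by (rule F_Kw_braid[OF that])
      qed
      moreover have "unfold_word (concat (a # as)) = concat (unfold_word a # map unfold_word as)"
        by (induction as) simp_all
      ultimately show "F.K_word k (unfold_word h @ unfold_word c) = F.K_word k (concat (unfold_word a # map unfold_word as))"
        unfolding fold_Kw by simp
    qed (rule i)
    then have "nn (act (rev h @ z) (e s))"
      using nn_Fw[of "rev h @ z" s x] F_act_rev_Fw[OF zS(4)] zS s x by simp
    moreover have "act (rev h) = act (rev (z @ y))"
      using act_rev_cong[of h "z @ y"] z(2) zS by simp
    ultimately have "nn (act (rev y) (e s))" using zS by simp
    then show ?thesis using lds by (simp add: left_descent_def)
  qed
qed

end

subsection \<open>Presented groups\<close>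

definition cls :: "'a set \<Rightarrow> ('a signed_word \<times> 'a signed_word) set \<Rightarrow> 'a signed_word \<Rightarrow> 'a signed_word set" where
  "cls X R w = presentation_cong X R `` {w}"

lemma pc_lists:
  "(u, v) \<in> presentation_cong X R \<Longrightarrow> u \<in> lists (X \<times> UNIV) \<and> v \<in> lists (X \<times> UNIV)"
  by (induction rule: presentation_cong.induct) auto

lemma pc_context:
  assumes "(u, v) \<in> presentation_cong X R" "a \<in> lists (X \<times> UNIV)" "b \<in> lists (X \<times> UNIV)"
  shows "(a @ u @ b, a @ v @ b) \<in> presentation_cong X R"
  using assms
proof induction
  case (refl w)
  then show ?case by (intro presentation_cong.refl) simp
next
  case (sym v w)
  then show ?case using presentation_cong.sym by blast
next
  case (trans u v w)
  then show ?case using presentation_cong.trans by blast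
next
  case (cancel s x y c)
  then show ?case using presentation_cong.cancel[of s X "a @ x" "y @ b" c R] by simp
next
  case (relation u v x y)
  then show ?case using presentation_cong.relation[of u v R X "a @ x" "y @ b"] by simp
qed

lemma pc_append:
  assumes "(u, u') \<in> presentation_cong X R" "(v, v') \<in> presentation_cong X R"
  shows "(u @ v, u' @ v') \<in> presentation_cong X R"
proof -
  have "(u @ v, u' @ v) \<in> presentation_cong X R"
    using pc_context[OF assms(1), of "[]" v] pc_lists[OF assms(2)] by simp
  moreover have "(u' @ v, u' @ v') \<in> presentation_cong X R"
    using pc_context[OF assms(2), of u' "[]"] pc_lists[OF assms(1)] by simp
  ultimately show ?thesis by (rule presentation_cong.trans)
qed

lemma cls_eq_iff:
  assumes "u \<in> lists (X \<times> UNIV)"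
  shows "cls X R u = cls X R v \<longleftrightarrow> (u, v) \<in> presentation_cong X R"
proof
  assume "cls X R u = cls X R v"
  then have "u \<in> cls X R v" using presentation_cong.refl[OF assms] by (auto simp: cls_def)
  then show "(u, v) \<in> presentation_cong X R" by (auto simp: cls_def intro: presentation_cong.sym)
next
  assume uv: "(u, v) \<in> presentation_cong X R"
  show "cls X R u = cls X R v"
    unfolding cls_def using uv presentation_cong.sym presentation_cong.trans by blast
qed

lemma presented_group_carrier: "carrier (presented_group X R) = cls X R ` lists (X \<times> UNIV)"
  by (auto simp: presented_group_def cls_def quotient_def)

lemma presented_group_one: "\<one>\<^bsub>presented_group X R\<^esub> = cls X R []"
  by (simp add: presented_group_def cls_def)

lemma presented_group_mult:
  assumes "u \<in> lists (X \<times> UNIV)" "v \<in> lists (X \<times> UNIV)"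
  shows "cls X R u \<otimes>\<^bsub>presented_group X R\<^esub> cls X R v = cls X R (u @ v)"
proof -
  have uv: "u @ v \<in> lists (X \<times> UNIV)" using assms by simp
  have eq: "cls X R (a @ b) = cls X R (u @ v)" if "a \<in> cls X R u" "b \<in> cls X R v" for a b
  proof -
    have "(u @ v, a @ b) \<in> presentation_cong X R" using that pc_append by (auto simp: cls_def)
    then show ?thesis using cls_eq_iff[OF uv] by metis
  qed
  have "u \<in> cls X R u" "v \<in> cls X R v"
    using assms presentation_cong.refl by (auto simp: cls_def)
  then have "(\<Union>a\<in>cls X R u. \<Union>b\<in>cls X R v. cls X R (a @ b)) = cls X R (u @ v)"
    using eq by blast
  then show ?thesis by (simp add: presented_group_def cls_def)
qed

lemma cls_inverse:
  assumes "w \<in> lists (X \<times> UNIV)"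
  shows "\<exists>w'\<in>lists (X \<times> UNIV). cls X R (w @ w') = cls X R []"
  using assms
proof (induction w rule: rev_induct)
  case (snoc a w)
  then obtain w' where w': "w' \<in> lists (X \<times> UNIV)" "cls X R (w @ w') = cls X R []" by auto
  obtain s b where a: "a = (s, b)" by force
  have l: "w \<in> lists (X \<times> UNIV)" "s \<in> X" using snoc.prems a by auto
  have "(w @ [(s, b), (s, \<not> b)] @ w', w @ w') \<in> presentation_cong X R"
    using l w' by (intro presentation_cong.cancel) auto
  then have "cls X R ((w @ [a]) @ ((s, \<not> b) # w')) = cls X R (w @ w')"
    using cls_eq_iff[of "w @ [(s, b), (s, \<not> b)] @ w'" X R "w @ w'"] a l w' by simp
  then show ?case using w' l by (intro bexI[of _ "(s, \<not> b) # w'"]) auto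
qed auto

text \<open>Serves to compute the image of 1: \<open>hom\<close> only asks for multiplicativity, and
  1 is recovered as the only idempotent.\<close>

lemma presented_group_idem:
  assumes "x \<in> carrier (presented_group X R)" "x \<otimes>\<^bsub>presented_group X R\<^esub> x = x"
  shows "x = \<one>\<^bsub>presented_group X R\<^esub>"
proof -
  obtain w where w: "w \<in> lists (X \<times> UNIV)" "x = cls X R w"
    using assms(1) by (auto simp: presented_group_carrier)
  obtain w' where w': "w' \<in> lists (X \<times> UNIV)" "cls X R (w @ w') = cls X R []"
    using cls_inverse[OF w(1)] by blast
  have "(w @ w, w) \<in> presentation_cong X R"
    using assms(2) w cls_eq_iff[of "w @ w" X R w] by (simp add: presented_group_mult)
  then have "((w @ w) @ w', w @ w') \<in> presentation_cong X R"
    using pc_context[of "w @ w" w X R "[]" w'] w'(1) by simp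
  moreover have 1: "(w @ w', []) \<in> presentation_cong X R"
    using w w' cls_eq_iff[of "w @ w'" X R "[]"] by simp
  moreover have "(w @ (w @ w'), w @ []) \<in> presentation_cong X R"
    using pc_context[OF 1 w(1), of "[]"] by simp
  ultimately have "(w, []) \<in> presentation_cong X R"
    using presentation_cong.sym presentation_cong.trans by (metis append_Nil2 append_assoc)
  then show ?thesis using cls_eq_iff[OF w(1)] w(2) by (simp add: presented_group_one)
qed

lemma pos_word_append [simp]: "pos_word (u @ v) = pos_word u @ pos_word v"
  by (simp add: pos_word_def)

lemma pos_word_lists [simp]: "w \<in> lists X \<Longrightarrow> pos_word w \<in> lists (X \<times> UNIV)"
  by (auto simp: pos_word_def)

subsection \<open>The Artin monoid\<close>

context coxeter_system
begin

definition E :: "'s list \<Rightarrow> 's signed_word set" where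
  "E w = cls S (braid_relations S m) (pos_word w)"

lemma artin_gen_E: "artin_gen S m s = E [s]"
  by (simp add: artin_gen_def E_def cls_def)

lemma E_eq_iff: "u \<in> lists S \<Longrightarrow> E u = E v \<longleftrightarrow>
    (pos_word u, pos_word v) \<in> presentation_cong S (braid_relations S m)"
  unfolding E_def by (rule cls_eq_iff) simp

lemma E_mult: "u \<in> lists S \<Longrightarrow> v \<in> lists S \<Longrightarrow> E u \<otimes>\<^bsub>artin_group S m\<^esub> E v = E (u @ v)"
  by (simp add: E_def artin_group_def presented_group_mult)

lemma E_one: "\<one>\<^bsub>artin_group S m\<^esub> = E []"
  by (simp add: E_def artin_group_def presented_group_one pos_word_def)

lemma E_carrier_group: "w \<in> lists S \<Longrightarrow> E w \<in> carrier (artin_group S m)"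
  by (simp add: E_def artin_group_def presented_group_carrier)

lemma artin_monoid_carrier: "carrier (artin_monoid S m) = E ` lists S"
proof
  show "carrier (artin_monoid S m) \<subseteq> E ` lists S"
  proof
    fix g assume "g \<in> carrier (artin_monoid S m)"
    then have "g \<in> generated_submonoid (artin_group S m) (artin_gen S m ` S)"
      by (simp add: artin_monoid_def)
    then show "g \<in> E ` lists S"
    proof induction
      case one
      then show ?case by (intro image_eqI[of _ _ "[]"]) (simp_all add: E_one)
    next
      case (incl h)
      then obtain s where "s \<in> S" "h = E [s]" by (auto simp: artin_gen_E)
      then show ?case by (intro image_eqI[of _ _ "[s]"]) simp_all
    next
      case (mult x y)
      then obtain u v where "u \<in> lists S" "v \<in> lists S" "x = E u" "y = E v" by blast
      then show ?case by (intro image_eqI[of _ _ "u @ v"]) (simp_all add: E_mult)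
    qed
  qed
  have "E w \<in> generated_submonoid (artin_group S m) (artin_gen S m ` S)" if "w \<in> lists S" for w
    using that
  proof (induction w rule: list.induct)
    case Nil
    show ?case using generated_submonoid.one[of "artin_group S m"] by (simp add: E_one)
  next
    case (Cons s w)
    have "E [s] \<in> generated_submonoid (artin_group S m) (artin_gen S m ` S)"
      using Cons.prems by (intro generated_submonoid.incl) (simp add: artin_gen_E)
    then have "E [s] \<otimes>\<^bsub>artin_group S m\<^esub> E w \<in> generated_submonoid (artin_group S m) (artin_gen S m ` S)"
      using Cons by (intro generated_submonoid.mult) auto
    then show ?case using Cons.prems E_mult[of "[s]" w] by simp
  qed
  then show "E ` lists S \<subseteq> carrier (artin_monoid S m)" by (auto simp: artin_monoid_def)
qed

lemma monoid_mult: "u \<in> lists S \<Longrightarrow> v \<in> lists S \<Longrightarrow> E u \<otimes>\<^bsub>artin_monoid S m\<^esub> E v = E (u @ v)"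
  by (simp add: artin_monoid_def E_mult)

lemma monoid_one: "\<one>\<^bsub>artin_monoid S m\<^esub> = E []"
  by (simp add: artin_monoid_def E_one)

lemma list_prod_E: "(\<And>a. a \<in> set as \<Longrightarrow> a \<in> lists S) \<Longrightarrow>
    list_prod (artin_monoid S m) (map E as) = E (concat as)"
proof (induction as)
  case (Cons a as)
  have "concat as \<in> lists S" using Cons.prems by fastforce
  then show ?case using Cons by (simp add: list_prod_def monoid_mult)
qed (simp add: list_prod_def monoid_one)

lemma list_prod_gens: "w \<in> lists S \<Longrightarrow>
    list_prod (artin_monoid S m) (map (artin_gen S m) w) = E w"
proof -
  assume w: "w \<in> lists S"
  have "map (artin_gen S m) w = map E (map (\<lambda>s. [s]) w)" by (simp add: artin_gen_E)
  moreover have "concat (map (\<lambda>s. [s]) w) = w" by (induction w) auto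
  moreover have "a \<in> lists S" if "a \<in> set (map (\<lambda>s. [s]) w)" for a
    using that w by auto
  ultimately show ?thesis using list_prod_E[of "map (\<lambda>s. [s]) w"] by metis
qed

lemma divides_E: "u \<in> lists S \<Longrightarrow> E u divides\<^bsub>artin_monoid S m\<^esub> x \<longleftrightarrow> (\<exists>c\<in>lists S. x = E (u @ c))"
  unfolding factor_def artin_monoid_carrier using monoid_mult by (auto simp: image_iff)

lemma fold_sg: "fold sg w v = act (rev w) v"
  by (simp add: act_def foldr_conv_fold)

lemma E_act:
  assumes "u \<in> lists S" "v \<in> lists S" "E u = E v"
  shows "act u = act v"
proof -
  have "(pos_word u, pos_word v) \<in> presentation_cong S (braid_relations S m)"
    using assms E_eq_iff by simp
  then have "fold sg u = fold sg v"
  proof (rule artin_action[OF _ bij_refl])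
    show "fold sg (alt_list s t n) = fold sg (alt_list t s n)"
      if "s \<in> S" "t \<in> S" "s \<noteq> t" "m s t = enat n" for s t n
      using braid_act_rev[OF that] by (intro ext) (simp add: fold_sg)
  qed
  then have "act (rev u) = act (rev v)" by (metis fold_sg ext)
  then show ?thesis using act_rev_cong[of "rev u" "rev v"] assms by simp
qed

text \<open>Letting every generator act on the integers by adding 1 respects the braid relations,
  whose two sides have the same length.\<close>

lemma E_length:
  assumes "u \<in> lists S" "E u = E v"
  shows "length u = length v"
proof -
  have f: "fold (\<lambda>s n. n + 1) w k = k + int (length w)" for w :: "'s list" and k
    by (induction w arbitrary: k) auto
  have "(pos_word u, pos_word v) \<in> presentation_cong S (braid_relations S m)"
    using assms E_eq_iff by simp
  then have "fold (\<lambda>s n. n + 1 :: int) u = fold (\<lambda>s n. n + 1) v"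
  proof (rule artin_action)
    show "bij (\<lambda>n. n + 1 :: int)" by (rule o_bij[of "\<lambda>n. n - 1"]) auto
  qed (simp add: f fun_eq_iff)
  then have "fold (\<lambda>s n. n + 1) u (0 :: int) = fold (\<lambda>s n. n + 1) v 0" by metis
  then show ?thesis unfolding f by simp
qed

lemma E_append_cong:
  assumes "u \<in> lists S" "u' \<in> lists S" "v \<in> lists S" "v' \<in> lists S" "E u = E u'" "E v = E v'"
  shows "E (u @ v) = E (u' @ v')"
  using E_mult[of u v] E_mult[of u' v'] assms by simp

lemma E_braid:
  assumes "s \<in> S" "t \<in> S" "s \<noteq> t" "m s t = enat n"
  shows "E (alt_list s t n) = E (alt_list t s n)"
proof -
  have "(pos_word (alt_list s t n), pos_word (alt_list t s n)) \<in> braid_relations S m"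
    unfolding braid_relations_def using assms by (intro CollectI exI[of _ s] exI[of _ t]) simp
  then have "([] @ pos_word (alt_list s t n) @ [], [] @ pos_word (alt_list t s n) @ [])
      \<in> presentation_cong S (braid_relations S m)"
    using assms by (intro presentation_cong.relation) (simp_all del: in_lists_conv_set)
  then show ?thesis using E_eq_iff[of "alt_list s t n"] assms by simp
qed

lemma E_matsumoto:
  assumes "reduced u" "reduced v" "act u = act v"
  shows "E u = E v"
proof -
  have uv: "u \<in> lists S" "v \<in> lists S" using assms red_lists by auto
  have "u \<in> lists S \<and> v \<in> lists S \<and> E u = E v"
  proof (rule matsumoto[where R = "\<lambda>u v. u \<in> lists S \<and> v \<in> lists S \<and> E u = E v" and T = S])
    show "s # u \<in> lists S \<and> s # v \<in> lists S \<and> E (s # u) = E (s # v)"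
      if "s \<in> S" "u \<in> lists S \<and> v \<in> lists S \<and> E u = E v" for s u v
      using that E_append_cong[of "[s]" "[s]" u v] by simp
    show "alt_list s t n @ y \<in> lists S \<and> alt_list t s n @ y \<in> lists S \<and>
        E (alt_list s t n @ y) = E (alt_list t s n @ y)"
      if "s \<in> S" "t \<in> S" "s \<noteq> t" "m s t = enat n" "y \<in> lists S" for s t n y
      using that E_append_cong[of "alt_list s t n" "alt_list t s n" y y] E_braid[of s t n]
      by (simp del: in_lists_conv_set)
  qed (use assms uv in auto)
  then show ?thesis by simp
qed

text \<open>Rewriting a reduced prefix of a non-reduced word exposes a square
  (\<open>not_red_square\<close>). Conversely, all words for one element share length and action, so
  they are reduced as soon as one of them is.\<close>

lemma reduced_elements_E: "reduced_elements S m = E ` {w. reduced w}"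
proof (intro Set.set_eqI iffI)
  fix g assume g: "g \<in> reduced_elements S m"
  then have "g \<in> carrier (artin_monoid S m)" by (simp add: reduced_elements_def)
  then obtain w where w: "w \<in> lists S" "g = E w" using artin_monoid_carrier by blast
  have "reduced w"
  proof (rule ccontr)
    assume "\<not> reduced w"
    then obtain x s y u where xy: "w = x @ [s] @ y" "reduced x" "u \<in> lists S" "s \<in> S" "reduced (u @ [s])"
        "act (u @ [s]) = act x"
      using not_red_square[OF subset_refl w(1)] by blast
    have l: "x \<in> lists S" "y \<in> lists S" "u \<in> lists S" using w(1) xy by auto
    have "E (u @ [s]) = E x" using E_matsumoto xy by blast
    then have "E ((u @ [s]) @ [s] @ y) = E (x @ [s] @ y)"
      using l xy(4) by (intro E_append_cong) simp_all
    then have "list_prod (artin_monoid S m) (map (artin_gen S m) (u @ [s, s] @ y)) = g"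
      using w xy l by (subst list_prod_gens) auto
    moreover have "u @ [s, s] @ y \<in> lists S" using l xy(4) by simp
    ultimately show False using g unfolding reduced_elements_def by blast
  qed
  then show "g \<in> E ` {w. reduced w}" using w by blast
next
  fix g assume "g \<in> E ` {w. reduced w}"
  then obtain w where w: "reduced w" "g = E w" by blast
  have "\<not> (\<exists>x s y. w' = x @ [s, s] @ y)"
    if "w' \<in> lists S" "list_prod (artin_monoid S m) (map (artin_gen S m) w') = g" for w'
  proof -
    have e: "E w' = E w" using that w by (simp add: list_prod_gens del: in_lists_conv_set)
    have "act w' = act w" "length w' = length w"
      using E_act[OF that(1) red_lists[OF w(1)] e] E_length[OF that(1) e] by auto
    then have "reduced w'" using red_cong[OF w(1) that(1)] by simp
    then show ?thesis using red_no_square by blast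
  qed
  then show "g \<in> reduced_elements S m"
    using w artin_monoid_carrier red_lists[OF w(1)] by (auto simp: reduced_elements_def)
qed

text \<open>Moving a letter to the left increases \<open>weight\<close>, the sum of the lengths of all initial
  products.\<close>

fun weight :: "'s list list \<Rightarrow> nat" where
  "weight [] = 0"
| "weight (a # as) = Suc (length as) * length a + weight as"

lemma weight_le: "weight as \<le> length as * length (concat as)"
  by (induction as) (auto simp: algebra_simps)

text \<open>Where the chain condition fails at a, b, some left descent s of b lengthens a; writing b
  = s b', the two factors become a s and b'.\<close>

lemma improve:
  assumes "\<And>a. a \<in> set as \<Longrightarrow> reduced a" "\<not> normal_chain as"
  shows "\<exists>bs. (\<forall>b\<in>set bs. reduced b) \<and> length bs = length as \<and> E (concat bs) = E (concat as) \<and>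
    weight as < weight bs"
  using assms
proof (induction as rule: normal_chain.induct)
  case (3 a b as)
  have ab: "reduced a" "reduced b" "a \<in> lists S" "b \<in> lists S" using 3 red_lists by auto
  have asS: "concat as \<in> lists S" using 3(2) red_lists by fastforce
  show ?case
  proof (cases "\<exists>s\<in>S. left_descent b s \<and> nn (act a (e s))")
    case True
    then obtain s where s: "s \<in> S" "left_descent b s" "nn (act a (e s))" by blast
    obtain b' where b': "reduced (s # b')" "act (s # b') = act b" "length b = Suc (length b')"
      using LD_exchange[OF ab(2) s(1,2)] by blast
    have b'S: "b' \<in> lists S" "reduced b'" using red_lists[OF b'(1)] red_ConsD[OF b'(1)] by auto
    have ra: "reduced (a @ [s])" using red_snoc_iff[OF ab(1) s(1)] s(3) by simp
    have "E (s # b') = E b" using E_matsumoto[OF b'(1) ab(2) b'(2)] .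
    then have "E ((s # b') @ concat as) = E (b @ concat as)"
      using s b'S ab asS by (intro E_append_cong) simp_all
    then have "E (a @ (s # b') @ concat as) = E (a @ b @ concat as)"
      using s b'S ab asS E_append_cong[of a a "(s # b') @ concat as" "b @ concat as"] by simp
    then show ?thesis
      using 3(2) ra b'S b'(3) by (intro exI[of _ "(a @ [s]) # b' # as"]) (auto simp: algebra_simps)
  next
    case False
    then have "\<not> normal_chain (b # as)" using 3 ab by auto
    then obtain bs where bs: "\<forall>b\<in>set bs. reduced b" "length bs = length (b # as)"
        "E (concat bs) = E (concat (b # as))" "weight (b # as) < weight bs"
      using 3 by auto
    have "concat bs \<in> lists S" using bs(1) red_lists by fastforce
    then have "E (a @ concat bs) = E (a @ concat (b # as))"
      using bs(3) ab asS E_append_cong[of a a "concat bs" "concat (b # as)"] by simp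
    then show ?thesis using bs ab by (intro exI[of _ "a # bs"]) auto
  qed
qed auto

text \<open>Begins with one-letter factors. Their number is kept and the total length is an
  invariant, so \<open>weight\<close> is bounded; a factorisation of greatest weight is a chain by
  \<open>improve\<close>.\<close>

lemma normal_chain_exists:
  assumes w: "w \<in> lists S"
  obtains as where "normal_chain as" "E (concat as) = E w"
proof -
  define P where "P as \<longleftrightarrow> (\<forall>a\<in>set as. reduced a) \<and> length as = length w \<and> E (concat as) = E w" for as
  have single: "reduced [s]" if "s \<in> S" for s
    using red_Cons_iff[OF red_Nil that] by (simp add: left_descent_def)
  have "concat (map (\<lambda>s. [s]) w) = w" by (induction w) auto
  then have P0: "P (map (\<lambda>s. [s]) w)" using w single by (auto simp: P_def)
  have bound: "weight as < Suc (length w * length w)" if "P as" for as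
  proof -
    have "concat as \<in> lists S" using that red_lists by (fastforce simp: P_def)
    then have "length (concat as) = length w" using E_length that P_def by blast
    then show ?thesis using weight_le[of as] that by (simp add: P_def)
  qed
  obtain as where as: "P as" "\<And>bs. P bs \<Longrightarrow> weight bs \<le> weight as"
    using ex_has_greatest_nat[of P, OF P0] bound by (metis less_imp_le)
  have "normal_chain as"
  proof (rule ccontr)
    assume "\<not> normal_chain as"
    then obtain bs where "\<forall>b\<in>set bs. reduced b" "length bs = length as" "E (concat bs) = E (concat as)"
        "weight as < weight bs"
      using improve[of as] as(1) P_def by blast
    then have "P bs" using as(1) by (simp add: P_def)
    then show False using as(2) \<open>weight as < weight bs\<close> by fastforce
  qed
  then show ?thesis using that as(1) P_def by blast
qed

section \<open>Divisors, common multiples and \<open>artin_Delta\<close>\<close>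

lemma divides_normal_chain:
  assumes "normal_chain (a # as)" "reduced h" "E h divides\<^bsub>artin_monoid S m\<^esub> E (concat (a # as))"
  shows "\<exists>y. reduced (h @ y) \<and> act (h @ y) = act a"
proof -
  have hS: "h \<in> lists S" using red_lists assms(2) by blast
  obtain c where c: "c \<in> lists S" "E (concat (a # as)) = E (h @ c)"
    using assms(3) divides_E[OF hS] by blast
  then have "E (h @ c) = E (concat (a # as))" by simp
  then show ?thesis
    using divisor_of_normal_chain[OF assms(2) c(1) assms(1)] E_eq_iff[of "h @ c"] hS c(1) by simp
qed

text \<open>A generator that divides w is a left descent of the first factor a of a normal chain for
  w. All of J then consists of descents of a, which yields the longest element of J as a divisor of
  a, hence of w.\<close>

lemma common_multiple:
  assumes "w \<in> lists S" "J \<subseteq> S" "\<And>j. j \<in> J \<Longrightarrow> E [j] divides\<^bsub>artin_monoid S m\<^esub> E w"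
  obtains d where "longest J d"
    "\<And>d. longest J d \<Longrightarrow> E d divides\<^bsub>artin_monoid S m\<^esub> E w"
proof -
  obtain as where as: "normal_chain as" "E (concat as) = E w" using normal_chain_exists assms(1) by blast
  have single: "reduced [s]" if "s \<in> S" for s
    using red_Cons_iff[OF red_Nil that] by (simp add: left_descent_def)
  show ?thesis
  proof (cases as)
    case Nil
    have "length w = 0" using E_length[OF assms(1), of "[]"] as Nil by simp
    have "j \<notin> J" for j
    proof
      assume j: "j \<in> J"
      then have jS: "j \<in> S" using assms(2) by auto
      obtain c where "c \<in> lists S" "E w = E ([j] @ c)"
        using assms(3)[OF j] divides_E[of "[j]" "E w"] jS by auto
      then have "length w = length ([j] @ c)" using E_length[OF assms(1)] by blast
      then show False using \<open>length w = 0\<close> by simp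
    qed
    then have "J = {}" by blast
    then show ?thesis using that[of "[]"] assms(1) by (auto simp: longest_def divides_E)
  next
    case (Cons a bs)
    have ra: "reduced a" using as Cons by (cases bs) auto
    have "left_descent a j" if j: "j \<in> J" for j
    proof -
      have jS: "j \<in> S" using j assms(2) by auto
      obtain y where y: "reduced ([j] @ y)" "act ([j] @ y) = act a"
        using divides_normal_chain[of a bs "[j]"] as Cons single[OF jS] assms(3)[OF j] by auto
      then show ?thesis
        using LD_Cons[of j y] LD_cong[OF red_lists[OF y(1)] red_lists[OF ra] y(2)] by simp
    qed
    note LDa = this
    have "E d divides\<^bsub>artin_monoid S m\<^esub> E w" if d: "longest J d" for d
    proof -
      have dS: "d \<in> lists S" using d red_lists by (auto simp: longest_def)
      obtain y where y: "reduced (d @ y)" "act (d @ y) = act a"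
        using longest_divides(2)[OF assms(2) ra LDa d] by blast
      have yS: "y \<in> lists S" using red_lists[OF y(1)] by simp
      have bsS: "concat bs \<in> lists S"
      proof -
        have "reduced b" if "normal_chain xs" "b \<in> set xs" for b xs
          using that by (induction xs rule: normal_chain.induct) auto
        then show ?thesis using as Cons red_lists by fastforce
      qed
      have "E (d @ y) = E a" using E_matsumoto[OF y(1) ra y(2)] .
      then have "E ((d @ y) @ concat bs) = E (a @ concat bs)"
        using dS yS bsS red_lists[OF ra] by (intro E_append_cong) simp_all
      then have "E w = E (d @ (y @ concat bs))" using as Cons by simp
      then show ?thesis using divides_E[OF dS] yS bsS by (metis append_in_lists_conv)
    qed
    then show ?thesis using that longest_divides(1)[OF assms(2) ra LDa] by blast
  qed
qed

lemma divides_antisym: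
  assumes "u \<in> lists S" "v \<in> lists S"
    "E u divides\<^bsub>artin_monoid S m\<^esub> E v" "E v divides\<^bsub>artin_monoid S m\<^esub> E u"
  shows "E u = E v"
proof -
  obtain c c' where c: "c \<in> lists S" "E v = E (u @ c)" "c' \<in> lists S" "E u = E (v @ c')"
    using divides_E[OF assms(1)] divides_E[OF assms(2)] assms(3,4) by metis
  have "length v = length (u @ c)" "length u = length (v @ c')"
    using E_length[OF assms(2) c(2)] E_length[OF assms(1) c(4)] .
  then have "length c = 0" unfolding length_append by linarith
  then show ?thesis using c by simp
qed

lemma longest_is_lcm:
  assumes "J \<subseteq> S" "longest J d"
  shows "is_left_lcm (artin_monoid S m) (artin_gen S m ` J) (E d)"
  unfolding is_left_lcm_def
proof (intro conjI ballI impI)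
  have d: "reduced d" "d \<in> lists S" using assms(2) red_lists by (auto simp: longest_def)
  then show "E d \<in> carrier (artin_monoid S m)" by (simp add: artin_monoid_carrier)
  show "x divides\<^bsub>artin_monoid S m\<^esub> E d" if x: "x \<in> artin_gen S m ` J" for x
  proof -
    obtain j where j: "j \<in> J" "x = E [j]" "j \<in> S" using x assms(1) by (auto simp: artin_gen_E)
    then obtain d' where d': "reduced (j # d')" "act (j # d') = act d"
      using LD_exchange[OF d(1) j(3)] assms(2) by (metis longest_def)
    have "E d = E ([j] @ d')" using E_matsumoto[OF d'(1) d(1) d'(2)] by simp
    moreover have "d' \<in> lists S" using red_lists[OF d'(1)] by simp
    ultimately show ?thesis using j divides_E[of "[j]" "E d"] by auto
  qed
  show "E d divides\<^bsub>artin_monoid S m\<^esub> x"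
    if x: "x \<in> carrier (artin_monoid S m)" "\<forall>y\<in>artin_gen S m ` J. y divides\<^bsub>artin_monoid S m\<^esub> x" for x
  proof -
    obtain w where w: "w \<in> lists S" "x = E w" using x(1) artin_monoid_carrier by blast
    show ?thesis
      using common_multiple[OF w(1) assms(1)] x(2) assms(2) w(2) by (auto simp: artin_gen_E)
  qed
qed

lemma Delta_longest:
  assumes "J \<subseteq> S" "longest J d"
  shows "artin_Delta S m J = E d"
  unfolding artin_Delta_def
proof (rule the_equality)
  show l: "is_left_lcm (artin_monoid S m) (artin_gen S m ` J) (E d)" by (rule longest_is_lcm[OF assms])
  fix v assume v: "is_left_lcm (artin_monoid S m) (artin_gen S m ` J) v"
  then obtain w where w: "w \<in> lists S" "v = E w"
    using artin_monoid_carrier by (auto simp: is_left_lcm_def)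
  have "d \<in> lists S" using assms(2) red_lists by (auto simp: longest_def)
  then show "v = E d"
    using divides_antisym[OF w(1), of d] l v w unfolding is_left_lcm_def by simp
qed

subsection \<open>Spherical subsets\<close>

abbreviation cox_rel :: "'s set \<Rightarrow> ('s signed_word \<times> 's signed_word) set" where
  "cox_rel T \<equiv> braid_relations T m \<union> {(pos_word [s, s], []) | s. s \<in> T}"

lemma cox_rel_pos:
  assumes "(u, v) \<in> cox_rel T" "u \<in> lists (T \<times> UNIV)" "v \<in> lists (T \<times> UNIV)"
    "x \<in> lists (T \<times> UNIV)" "y \<in> lists (T \<times> UNIV)"
  shows "cls T (cox_rel T) (x @ u @ y) = cls T (cox_rel T) (x @ v @ y)"
  using presentation_cong.relation[OF assms] cls_eq_iff[of "x @ u @ y" T "cox_rel T" "x @ v @ y"] assms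
  by simp

lemma cls_cox_positive:
  assumes "w \<in> lists (T \<times> UNIV)"
  shows "cls T (cox_rel T) w = cls T (cox_rel T) (pos_word (map fst w))"
proof -
  have "(w, pos_word (map fst w)) \<in> presentation_cong T (cox_rel T)"
    using assms
  proof (induction w rule: list.induct)
    case Nil
    then show ?case by (simp add: pos_word_def presentation_cong.refl)
  next
    case (Cons a w)
    obtain s b where a: "a = (s, b)" by force
    have s: "s \<in> T" using Cons.prems a by simp
    have "([(s, b)], [(s, True)]) \<in> presentation_cong T (cox_rel T)"
    proof (cases b)
      case True
      then show ?thesis using s by (auto intro: presentation_cong.refl)
    next
      case False
      have "([(s, False)] @ pos_word [s, s] @ [], [(s, False)] @ [] @ []) \<in> presentation_cong T (cox_rel T)"
        using s by (intro presentation_cong.relation) (auto simp: pos_word_def)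
      then have 1: "([(s, False), (s, True), (s, True)], [(s, False)]) \<in> presentation_cong T (cox_rel T)"
        by (simp add: pos_word_def)
      have "([] @ [(s, False), (s, \<not> False)] @ [(s, True)], [] @ [(s, True)]) \<in> presentation_cong T (cox_rel T)"
        using s by (intro presentation_cong.cancel) auto
      then have 2: "([(s, False), (s, True), (s, True)], [(s, True)]) \<in> presentation_cong T (cox_rel T)"
        by simp
      show ?thesis using False presentation_cong.trans[OF presentation_cong.sym[OF 1] 2] by simp
    qed
    then show ?case using pc_append[of "[(s, b)]" "[(s, True)]"] Cons a by (simp add: pos_word_def)
  qed
  then show ?thesis using cls_eq_iff[OF assms] by blast
qed

text \<open>Tits' rewriting: braid moves on a reduced prefix expose a square, the Coxeter relations
  remove it, and the word has become shorter.\<close>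

lemma cls_cox_reduced:
  assumes "T \<subseteq> S" "w \<in> lists T"
  shows "\<exists>x\<in>lists T. reduced x \<and> cls T (cox_rel T) (pos_word w) = cls T (cox_rel T) (pos_word x)"
  using assms(2)
proof (induction "length w" arbitrary: w rule: less_induct)
  case less
  define C where "C w = cls T (cox_rel T) (pos_word w)" for w
  have app: "C (u @ v) = C (u' @ v')"
    if "u \<in> lists T" "v \<in> lists T" "C u = C u'" "C v = C v'" for u v u' v'
  proof -
    have "(pos_word u, pos_word u') \<in> presentation_cong T (cox_rel T)"
      "(pos_word v, pos_word v') \<in> presentation_cong T (cox_rel T)"
      using that cls_eq_iff[of "pos_word u" T "cox_rel T"] cls_eq_iff[of "pos_word v" T "cox_rel T"]
      by (simp_all add: C_def)
    from pc_append[OF this] show ?thesis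
      using that cls_eq_iff[of "pos_word (u @ v)" T "cox_rel T"] by (simp add: C_def)
  qed
  show ?case
  proof (cases "reduced w")
    case True
    then show ?thesis using less.prems by blast
  next
    case False
    then obtain x s y u where xy: "w = x @ [s] @ y" "reduced x" "u \<in> lists T" "s \<in> T" "reduced (u @ [s])"
        "act (u @ [s]) = act x"
      using not_red_square[OF assms(1) less.prems] by blast
    have l: "x \<in> lists T" "y \<in> lists T" using less.prems xy by auto
    have "x \<in> lists T \<and> u @ [s] \<in> lists T \<and> C x = C (u @ [s])"
    proof (rule matsumoto[where R = "\<lambda>u v. u \<in> lists T \<and> v \<in> lists T \<and> C u = C v", OF assms(1)])
      show "s # u \<in> lists T \<and> s # v \<in> lists T \<and> C (s # u) = C (s # v)"
        if "s \<in> T" "u \<in> lists T \<and> v \<in> lists T \<and> C u = C v" for s u v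
        using that app[of "[s]" u "[s]" v] by simp
      show "alt_list s t n @ y \<in> lists T \<and> alt_list t s n @ y \<in> lists T \<and>
          C (alt_list s t n @ y) = C (alt_list t s n @ y)"
        if st: "s \<in> T" "t \<in> T" "s \<noteq> t" "m s t = enat n" "y \<in> lists T" for s t n y
      proof -
        have "(pos_word (alt_list s t n), pos_word (alt_list t s n)) \<in> cox_rel T"
          unfolding braid_relations_def using st by (intro UnI1 CollectI exI[of _ s] exI[of _ t]) simp
        then have "C (alt_list s t n @ y) = C (alt_list t s n @ y)"
          using cox_rel_pos[of "pos_word (alt_list s t n)" "pos_word (alt_list t s n)" T "[]" "pos_word y"] st
          by (simp add: C_def del: in_lists_conv_set)
        then show ?thesis using st by (simp del: in_lists_conv_set)
      qed
    qed (use xy l in auto)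
    then have "C w = C ((u @ [s]) @ [s] @ y)"
      unfolding xy(1) using app[of x "[s] @ y" "u @ [s]" "[s] @ y"] l xy(4) by simp
    also have "\<dots> = C (u @ y)"
    proof -
      have ss: "[s, s] \<in> lists T" using xy(4) by simp
      have "(pos_word [s, s], []) \<in> cox_rel T" using xy(4) by blast
      then have "cls T (cox_rel T) (pos_word u @ pos_word [s, s] @ pos_word y)
          = cls T (cox_rel T) (pos_word u @ [] @ pos_word y)"
        by (rule cox_rel_pos) (use pos_word_lists[OF ss] pos_word_lists[OF xy(3)] pos_word_lists[OF l(2)] in simp_all)
      moreover have "pos_word ((u @ [s]) @ [s] @ y) = pos_word u @ pos_word [s, s] @ pos_word y"
        by (simp add: pos_word_def)
      ultimately show ?thesis by (simp add: C_def)
    qed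
    finally have "C w = C (u @ y)" .
    moreover have "length x = Suc (length u)" using red_length[OF xy(2,5)] xy(6) by simp
    then have "\<exists>x\<in>lists T. reduced x \<and> C (u @ y) = C x"
      unfolding C_def using less.hyps[of "u @ y"] xy(1,3) l by simp
    ultimately show ?thesis by (simp add: C_def)
  qed
qed

text \<open>A finite group has a finite image under \<open>act\<close>, and a reduced word of
  maximal length is then longest. Conversely, every class contains a reduced word no longer than the
  longest element, which leaves finitely many.\<close>

lemma spherical_iff_longest:
  assumes T: "T \<subseteq> S"
  shows "spherical S m T \<longleftrightarrow> (\<exists>d. longest T d)"
proof
  assume "spherical S m T"
  then have fin: "finite (cls T (cox_rel T) ` lists (T \<times> UNIV))"
    by (simp add: spherical_def coxeter_group_def presented_group_carrier)
  \<comment> \<open>A chosen representative is made to act; the action depends only on the class.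
    Since \<open>sact\<close> reads from the left, it is that of the reversed word.\<close>
  define f where "f A = sact sg (SOME w. w \<in> A)" for A
  have f: "f (cls T (cox_rel T) (pos_word w)) = act (rev w)" if w: "w \<in> lists T" for w
  proof -
    have "pos_word w \<in> cls T (cox_rel T) (pos_word w)"
      using w by (simp add: cls_def presentation_cong.refl)
    then have "(SOME v. v \<in> cls T (cox_rel T) (pos_word w)) \<in> cls T (cox_rel T) (pos_word w)"
      by (rule someI)
    then have "(pos_word w, SOME v. v \<in> cls T (cox_rel T) (pos_word w)) \<in> presentation_cong T (cox_rel T)"
      by (simp add: cls_def)
    then have "sact sg (pos_word w) = f (cls T (cox_rel T) (pos_word w))"
      unfolding f_def
    proof (rule sact_presentation_cong)
      show "bij (sg s)" if "s \<in> T" for s using bij_refl that T by blast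
      fix u v assume "(u, v) \<in> cox_rel T"
      then consider "(u, v) \<in> braid_relations T m" | s where "s \<in> T" "u = pos_word [s, s]" "v = []" by blast
      then show "sact sg u = sact sg v"
      proof cases
        case 1
        then obtain s t n where st: "s \<in> S" "t \<in> S" "s \<noteq> t" "m s t = enat n"
            "u = pos_word (alt_list s t n)" "v = pos_word (alt_list t s n)"
          using T by (elim braid_relationsE) blast
        then show ?thesis using braid_act_rev[OF st(1-4)] by (intro ext) (simp add: sact_pos_word fold_sg)
      next
        case 2
        then show ?thesis using T by (intro ext) (auto simp: sact_def pos_word_def)
      qed
    qed
    then show ?thesis by (intro ext) (simp add: sact_pos_word fold_sg fun_eq_iff)
  qed
  have "act ` lists T \<subseteq> f ` (cls T (cox_rel T) ` lists (T \<times> UNIV))"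
  proof
    fix g assume "g \<in> act ` lists T"
    then obtain w where w: "w \<in> lists T" "g = act w" by blast
    then have "g = f (cls T (cox_rel T) (pos_word (rev w)))" using f[of "rev w"] by simp
    moreover have "pos_word (rev w) \<in> lists (T \<times> UNIV)" using w by simp
    ultimately show "g \<in> f ` (cls T (cox_rel T) ` lists (T \<times> UNIV))" by blast
  qed
  then have "finite (act ` lists T)" using fin finite_surj by blast
  then show "\<exists>d. longest T d" by (rule longest_exists[OF T])
next
  assume "\<exists>d. longest T d"
  then obtain d where d: "longest T d" by blast
  have "cls T (cox_rel T) ` lists (T \<times> UNIV)
      \<subseteq> (\<lambda>x. cls T (cox_rel T) (pos_word x)) ` {x. set x \<subseteq> T \<and> length x \<le> length d}"
  proof
    fix A assume "A \<in> cls T (cox_rel T) ` lists (T \<times> UNIV)"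
    then obtain v where v: "A = cls T (cox_rel T) v" "v \<in> lists (T \<times> UNIV)" by (rule imageE)
    define w where "w = map fst v"
    have w: "A = cls T (cox_rel T) (pos_word w)" using v cls_cox_positive by (simp add: w_def)
    have "w \<in> lists T" using v(2) by (fastforce simp: w_def)
    then obtain x where x: "x \<in> lists T" "reduced x" "A = cls T (cox_rel T) (pos_word x)"
      using cls_cox_reduced[OF T, of w] w by blast
    have "length x \<le> length d" using longest_max_length[OF T d x(1,2)] .
    then show "A \<in> (\<lambda>x. cls T (cox_rel T) (pos_word x)) ` {x. set x \<subseteq> T \<and> length x \<le> length d}"
      using x by auto
  qed
  moreover have "finite T" using T finite_S finite_subset by blast
  then have "finite {x. set x \<subseteq> T \<and> length x \<le> length d}" by (rule finite_lists_length_le)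
  ultimately show "spherical S m T"
    using T by (simp add: spherical_def coxeter_group_def presented_group_carrier finite_surj)
qed

end

subsection \<open>LCM-homomorphisms\<close>

lemma alt_list_map: "map f (alt_list s t n) = alt_list (f s) (f t) n"
  by (induction n arbitrary: s t) simp_all

lemma concat_lists: "(\<And>a. a \<in> set as \<Longrightarrow> a \<in> lists T) \<Longrightarrow> concat as \<in> lists T"
  by (induction as) simp_all

context coxeter_system
begin

text \<open>For u outside T the coordinate u of w^(-1) e_u remains 1, so the root is not
  negative.\<close>

lemma LD_letter:
  assumes "w \<in> lists T" "T \<subseteq> S" "u \<in> S" "left_descent w u"
  shows "u \<in> T"
proof (rule ccontr)
  assume "u \<notin> T"
  then have "act (rev w) (e u) u = 1" using act_outside[of "rev w" T u "e u"] assms(1) by simp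
  then have "\<not> nn (\<lambda>x. - act (rev w) (e u) x)" unfolding nn_def by (metis neg_0_le_iff_le not_one_le_zero)
  moreover have "rev w \<in> lists S" using assms(1,2) by auto
  ultimately show False using root_cases[of "rev w" u] assms(3,4) by (auto simp: left_descent_def)
qed

lemma normal_chain_nth:
  assumes "\<And>i. i < length as \<Longrightarrow> reduced (as ! i)"
    "\<And>i s. Suc i < length as \<Longrightarrow> s \<in> S \<Longrightarrow> left_descent (as ! Suc i) s \<Longrightarrow> \<not> nn (act (as ! i) (e s))"
  shows "normal_chain as"
  using assms
proof (induction as rule: normal_chain.induct)
  case (3 a b as)
  have "normal_chain (b # as)"
  proof (rule 3(1))
    show "reduced ((b # as) ! i)" if "i < length (b # as)" for i using 3(2)[of "Suc i"] that by simp
    show "\<not> nn (act ((b # as) ! i) (e s))"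
      if "Suc i < length (b # as)" "s \<in> S" "left_descent ((b # as) ! Suc i) s" for i s
      using 3(3)[of "Suc i" s] that by simp
  qed
  then show ?case using 3(2)[of 0] 3(3)[of 0] by simp
qed auto

lemma normal_chain_drop: "normal_chain as \<Longrightarrow> normal_chain (drop i as)"
proof (induction as arbitrary: i rule: normal_chain.induct)
  case (3 a b as)
  then show ?case by (cases i) simp_all
qed (auto simp: drop_Cons')

lemma normal_chain_red: "normal_chain as \<Longrightarrow> a \<in> set as \<Longrightarrow> reduced a"
  by (induction as rule: normal_chain.induct) auto

text \<open>Turns the local chain condition into the maximality required by \<open>is_alpha\<close>;
  this is how the image sequence is recognised as a normal form.\<close>

lemma is_alpha_normal_chain:
  assumes "normal_chain (a # as)"
  shows "is_alpha S m (E (concat (a # as))) (E a)"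
proof -
  have ra: "reduced a" and l: "a \<in> lists S" "concat as \<in> lists S"
    using normal_chain_red[OF assms] red_lists by fastforce+
  have "E h divides\<^bsub>artin_monoid S m\<^esub> E a"
    if h: "reduced h" "E h divides\<^bsub>artin_monoid S m\<^esub> E (concat (a # as))" for h
  proof -
    obtain y where y: "reduced (h @ y)" "act (h @ y) = act a" using divides_normal_chain[OF assms h] by blast
    have "E a = E (h @ y)" using E_matsumoto[OF y(1) ra y(2)] by simp
    moreover have "h \<in> lists S" "y \<in> lists S" using red_lists[OF y(1)] by auto
    ultimately show ?thesis using divides_E by blast
  qed
  moreover have "E a divides\<^bsub>artin_monoid S m\<^esub> E (concat (a # as))"
    using divides_E[OF l(1), of "E (concat (a # as))"] l(2) by auto
  ultimately show ?thesis
    using ra by (auto simp: is_alpha_def Let_def reduced_elements_E)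
qed

end

section \<open>Lifting words along an LCM-map\<close>

locale lcm_morphism = C: coxeter_system S m + D: coxeter_system S' m'
  for S :: "'s set" and m and S' :: "'t set" and m' +
  fixes p :: "'s \<Rightarrow> 't set" and \<phi>
  assumes lcm_map: "lcm_map S m S' m' p"
    and \<phi>_hom: "\<phi> \<in> hom (artin_group S m) (artin_group S' m')"
    and \<phi>_gen: "\<And>s. s \<in> S \<Longrightarrow> \<phi> (artin_gen S m s) = artin_Delta S' m' (p s)"
begin

lemma p: "s \<in> S \<Longrightarrow> p s \<noteq> {}" "s \<in> S \<Longrightarrow> p s \<subseteq> S'"
  "s \<in> S \<Longrightarrow> t \<in> S \<Longrightarrow> s \<noteq> t \<Longrightarrow> p s \<inter> p t = {}"
  "s \<in> S \<Longrightarrow> spherical S' m' (p s)"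
  using lcm_map by (simp_all add: lcm_map_def)

text \<open>A chosen reduced word for the image of s; another choice would change neither
  \<open>D.E\<close> nor \<open>D.act\<close>.\<close>

definition Delta_word :: "'s \<Rightarrow> 't list" where
  "Delta_word s = (SOME d. D.longest (p s) d)"

definition lift_word :: "'s list \<Rightarrow> 't list" where
  "lift_word w = concat (map Delta_word w)"

lemma lift_word_simps [simp]: "lift_word [] = []" "lift_word (s # w) = Delta_word s @ lift_word w" "lift_word (v @ w) = lift_word v @ lift_word w"
  by (simp_all add: lift_word_def)

lemma Delta_word_longest: "s \<in> S \<Longrightarrow> D.longest (p s) (Delta_word s)"
  unfolding Delta_word_def using D.spherical_iff_longest[of "p s"] p by (intro someI_ex[of "D.longest (p s)"]) blast

lemma Delta_word_lists: "s \<in> S \<Longrightarrow> Delta_word s \<in> lists (p s)"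
  using Delta_word_longest by (simp add: D.longest_def)

lemma Delta_word_lists_S': "s \<in> S \<Longrightarrow> Delta_word s \<in> lists S'"
  using Delta_word_lists p(2) by fastforce

lemma lift_word_lists: "w \<in> lists T \<Longrightarrow> T \<subseteq> S \<Longrightarrow> lift_word w \<in> lists (\<Union>s\<in>T. p s)"
proof (induction w rule: list.induct)
  case (Cons s w)
  then have "s \<in> T" "s \<in> S" "lift_word w \<in> lists (\<Union>s\<in>T. p s)" by auto
  then show ?case using Delta_word_lists[of s] by auto
qed simp

lemma lift_word_lists_S': "w \<in> lists S \<Longrightarrow> lift_word w \<in> lists S'"
  using lift_word_lists[of w S] p(2) by fastforce

lemma Delta_Delta_word: "s \<in> S \<Longrightarrow> artin_Delta S' m' (p s) = D.E (Delta_word s)"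
  by (rule D.Delta_longest[OF p(2) Delta_word_longest])

lemma Delta_word_nonempty: "s \<in> S \<Longrightarrow> Delta_word s \<noteq> []"
proof
  assume s: "s \<in> S" "Delta_word s = []"
  then obtain u where "u \<in> p s" using p(1) by blast
  then have "D.left_descent [] u" using Delta_word_longest[OF s(1)] s(2) by (simp add: D.longest_def)
  then show False by (simp add: D.left_descent_def)
qed

lemma \<phi>_one: "\<phi> (C.E []) = D.E []"
proof -
  have c: "C.E [] \<in> carrier (artin_group S m)" using C.E_carrier_group by simp
  then have "\<phi> (C.E []) \<in> carrier (artin_group S' m')" using \<phi>_hom by (auto simp: hom_def)
  moreover have "\<phi> (C.E []) \<otimes>\<^bsub>artin_group S' m'\<^esub> \<phi> (C.E []) = \<phi> (C.E [])"
    using hom_mult[OF \<phi>_hom c c] C.E_mult[of "[]" "[]"] by simp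
  ultimately show ?thesis
    using presented_group_idem[of "\<phi> (C.E [])" S' "braid_relations S' m'"] D.E_one
    by (simp add: artin_group_def)
qed

lemma \<phi>_E: "w \<in> lists S \<Longrightarrow> \<phi> (C.E w) = D.E (lift_word w)"
proof (induction w rule: list.induct)
  case Nil
  show ?case using \<phi>_one by simp
next
  case (Cons s w)
  then have s: "s \<in> S" "w \<in> lists S" by auto
  have "\<phi> (C.E (s # w)) = \<phi> (C.E [s] \<otimes>\<^bsub>artin_group S m\<^esub> C.E w)"
    using C.E_mult[of "[s]" w] s by simp
  also have "\<dots> = \<phi> (C.E [s]) \<otimes>\<^bsub>artin_group S' m'\<^esub> \<phi> (C.E w)"
    using \<phi>_hom s C.E_carrier_group[of "[s]"] C.E_carrier_group[of w] by (simp add: hom_def)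
  also have "\<phi> (C.E [s]) = D.E (Delta_word s)" using \<phi>_gen[OF s(1)] Delta_Delta_word[OF s(1)] by (simp add: C.artin_gen_E)
  also have "D.E (Delta_word s) \<otimes>\<^bsub>artin_group S' m'\<^esub> \<phi> (C.E w) = D.E (Delta_word s @ lift_word w)"
    using Cons s D.E_mult[OF Delta_word_lists_S'[OF s(1)] lift_word_lists_S'[OF s(2)]] by simp
  finally show ?case by simp
qed

text \<open>That the lift depends only on the Coxeter element is seen through the Artin groups:
  reduced words of one element agree there by Matsumoto's theorem, and \<phi> carries the equality
  over.\<close>

lemma lift_word_act_cong:
  assumes "C.reduced u" "C.reduced v" "C.act u = C.act v"
  shows "D.act (lift_word u) = D.act (lift_word v)" "length (lift_word u) = length (lift_word v)"
proof -
  have l: "u \<in> lists S" "v \<in> lists S" using assms C.red_lists by auto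
  have "D.E (lift_word u) = \<phi> (C.E u)" using \<phi>_E l by simp
  also have "\<dots> = D.E (lift_word v)" unfolding C.E_matsumoto[OF assms] using \<phi>_E l by simp
  finally have eq: "D.E (lift_word u) = D.E (lift_word v)" .
  show "D.act (lift_word u) = D.act (lift_word v)" by (rule D.E_act[OF lift_word_lists_S'[OF l(1)] lift_word_lists_S'[OF l(2)] eq])
  show "length (lift_word u) = length (lift_word v)" by (rule D.E_length[OF lift_word_lists_S'[OF l(1)] eq])
qed

text \<open>By (L2) the lifted alternating word represents the least common multiple of the two
  Delta elements. By divisibility both ways it equals the Delta of the union, and comparing length
  and action shows that the word itself is reduced.\<close>

lemma alt_longest:
  assumes st: "s \<in> S" "t \<in> S" "s \<noteq> t" "m s t = enat n"
  shows "D.longest (p s \<union> p t) (lift_word (alt_list s t n))"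
proof -
  let ?M = "artin_monoid S' m'" and ?P = "p s \<union> p t" and ?w = "lift_word (alt_list s t n)"
  have P: "?P \<subseteq> S'" using p(2) st by blast
  have wS: "?w \<in> lists S'" using lift_word_lists_S' st by simp
  have "alt_prod ?M (D.E (Delta_word s)) (D.E (Delta_word t)) n = list_prod ?M (map D.E (map Delta_word (alt_list s t n)))"
    by (simp add: alt_prod_def alt_list_map)
  also have "\<dots> = D.E ?w"
  proof -
    have "a \<in> lists S'" if "a \<in> set (map Delta_word (alt_list s t n))" for a
      using that C.set_alt_list[of s t n] st Delta_word_lists_S' by auto
    then show ?thesis unfolding lift_word_def by (rule D.list_prod_E)
  qed
  finally have ap: "alt_prod ?M (D.E (Delta_word s)) (D.E (Delta_word t)) n = D.E ?w" .
  have "is_left_lcm ?M {D.E (Delta_word s), D.E (Delta_word t)} (D.E ?w)"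
  proof -
    have "\<forall>s\<in>S. \<forall>t\<in>S. s \<noteq> t \<and> m s t \<noteq> \<infinity> \<longrightarrow>
      is_left_lcm ?M {artin_Delta S' m' (p s), artin_Delta S' m' (p t)}
        (alt_prod ?M (artin_Delta S' m' (p s)) (artin_Delta S' m' (p t)) (the_enat (m s t)))"
      using lcm_map unfolding lcm_map_def Let_def by blast
    from this[rule_format, OF st(1,2)] show ?thesis using st by (simp add: Delta_Delta_word ap)
  qed
  then have div: "D.E (Delta_word s) divides\<^bsub>?M\<^esub> D.E ?w" "D.E (Delta_word t) divides\<^bsub>?M\<^esub> D.E ?w"
    and least: "\<And>x. x \<in> carrier ?M \<Longrightarrow> D.E (Delta_word s) divides\<^bsub>?M\<^esub> x \<Longrightarrow> D.E (Delta_word t) divides\<^bsub>?M\<^esub> x \<Longrightarrow>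
      D.E ?w divides\<^bsub>?M\<^esub> x"
    by (auto simp: is_left_lcm_def)
  have gen: "D.E [u] divides\<^bsub>?M\<^esub> D.E ?w" if u: "u \<in> ?P" for u
  proof -
    obtain r where r: "r \<in> S" "u \<in> p r" "D.E (Delta_word r) divides\<^bsub>?M\<^esub> D.E ?w" using u st div by blast
    have uS: "u \<in> S'" using r p(2) by blast
    have Fr: "D.reduced (Delta_word r)" "D.left_descent (Delta_word r) u" using Delta_word_longest[OF r(1)] r(2) by (auto simp: D.longest_def)
    obtain z where z: "D.reduced (u # z)" "D.act (u # z) = D.act (Delta_word r)"
      using D.LD_exchange[OF Fr(1) uS Fr(2)] by blast
    have zS: "z \<in> lists S'" using D.red_lists[OF z(1)] by simp
    obtain c where c: "c \<in> lists S'" "D.E ?w = D.E (Delta_word r @ c)"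
      using r(3) D.divides_E[OF Delta_word_lists_S'[OF r(1)]] by blast
    have "D.E (Delta_word r) = D.E (u # z)" using D.E_matsumoto[OF z(1) Fr(1) z(2)] by simp
    then have "D.E (Delta_word r @ c) = D.E ((u # z) @ c)"
      using Delta_word_lists_S'[OF r(1)] uS zS c(1) by (intro D.E_append_cong) simp_all
    then have "D.E ?w = D.E ([u] @ z @ c)" using c by simp
    then show ?thesis using D.divides_E[of "[u]" "D.E ?w"] uS zS c(1) by (metis append_in_lists_conv lists.simps)
  qed
  obtain d where d: "D.longest ?P d" "\<And>d. D.longest ?P d \<Longrightarrow> D.E d divides\<^bsub>?M\<^esub> D.E ?w"
    using D.common_multiple[OF wS P gen] by blast
  have dd: "D.reduced d" "d \<in> lists ?P" "d \<in> lists S'" using d(1) P by (auto simp: D.longest_def)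
  have "D.E (Delta_word r) divides\<^bsub>?M\<^esub> D.E d" if r: "r \<in> {s, t}" for r
  proof -
    have rS: "r \<in> S" using r st by auto
    have "D.reduced (Delta_word r)" "Delta_word r \<in> lists ?P"
      using Delta_word_longest[OF rS] Delta_word_lists[OF rS] r by (auto simp: D.longest_def)
    then obtain y where y: "y \<in> lists ?P" "D.reduced (Delta_word r @ y)" "D.act (Delta_word r @ y) = D.act d"
      using D.longest_prefix[OF P d(1)] by blast
    have "D.E d = D.E (Delta_word r @ y)" using D.E_matsumoto[OF y(2) dd(1) y(3)] by simp
    moreover have "y \<in> lists S'" using D.red_lists[OF y(2)] by simp
    ultimately show ?thesis using D.divides_E[OF Delta_word_lists_S'[OF rS]] by blast
  qed
  then have "D.E ?w divides\<^bsub>?M\<^esub> D.E d"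
    using least[of "D.E d"] dd(3) by (simp add: D.artin_monoid_carrier)
  then have eq: "D.E ?w = D.E d" using D.divides_antisym[OF wS dd(3)] d by blast
  have a: "D.act ?w = D.act d" "length ?w = length d"
    using D.E_act[OF wS dd(3) eq] D.E_length[OF wS eq] by auto
  have "D.reduced ?w" using D.red_cong[OF dd(1) wS a(1)] a(2) by simp
  moreover have "?w \<in> lists ?P"
    using lift_word_lists[of "alt_list s t n" "{s, t}"] st by simp
  moreover have "D.left_descent ?w j" if "j \<in> ?P" for j
    using D.LD_cong[OF wS dd(3) a(1)] d(1) that by (simp add: D.longest_def)
  ultimately show ?thesis by (simp add: D.longest_def)
qed

text \<open>This is how (L3) is used: a reduced word with these descents would yield a longest
  element of \<open>insert u (p t)\<close>, making that set spherical.\<close>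

lemma infinite_no_LD:
  assumes "s \<in> S" "t \<in> S" "s \<noteq> t" "m s t = \<infinity>" "u \<in> p s" "D.reduced w"
    "D.left_descent w u" "\<And>q. q \<in> p t \<Longrightarrow> D.left_descent w q"
  shows False
proof -
  have sub: "insert u (p t) \<subseteq> S'" using assms p(2) by blast
  have "\<not> spherical S' m' (insert u (p t))"
  proof -
    have "\<forall>s\<in>S. \<forall>t\<in>S. s \<noteq> t \<and> m s t = \<infinity> \<longrightarrow> (\<forall>u\<in>p s. \<not> spherical S' m' (insert u (p t)))"
      using lcm_map unfolding lcm_map_def by blast
    then show ?thesis using assms(1-5) by blast
  qed
  moreover have "\<exists>d. D.longest (insert u (p t)) d"
    using D.longest_divides(1)[OF sub assms(6)] assms(7,8) by blast
  ultimately show False using D.spherical_iff_longest[OF sub] by blast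
qed

text \<open>The two claims need each other: if w = t w1, the lift of w1 has no descent in
  \<open>p t\<close>, so the lift of w is reduced. If \<open>p s\<close> contributes a descent
  although s is no descent of w, the contradiction is found in the dihedral subgroup of s and t,
  where \<open>alt_longest\<close> applies.\<close>

lemma red_lift_word:
  assumes "C.reduced w"
  shows "D.reduced (lift_word w)" "\<And>s u. s \<in> S \<Longrightarrow> u \<in> p s \<Longrightarrow> D.left_descent (lift_word w) u \<Longrightarrow> C.left_descent w s"
proof -
  have "D.reduced (lift_word w) \<and> (\<forall>s\<in>S. \<forall>u\<in>p s. D.left_descent (lift_word w) u \<longrightarrow> C.left_descent w s)"
    using assms
  proof (induction "length w" arbitrary: w rule: less_induct)
    case less
    show ?case
    proof (cases w)
      case Nil
      then show ?thesis by (simp add: D.left_descent_def)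
    next
      case (Cons t w1)
      have t: "t \<in> S" "C.reduced w1" "w1 \<in> lists S"
        using C.red_lists[of w] less.prems Cons C.red_ConsD by auto
      have nLD: "\<not> C.left_descent w1 t" using C.red_Cons_iff[OF t(2,1)] less.prems Cons by simp
      have IH1: "D.reduced (lift_word w1)" "\<And>u. u \<in> p t \<Longrightarrow> \<not> D.left_descent (lift_word w1) u"
        using less.hyps[of w1] t nLD Cons by auto
      have Ft: "D.reduced (Delta_word t)" "Delta_word t \<in> lists (p t)" "\<And>u. u \<in> p t \<Longrightarrow> D.left_descent (Delta_word t) u"
        using Delta_word_longest[OF t(1)] by (auto simp: D.longest_def)
      have rw: "D.reduced (lift_word w)"
        using D.red_parabolic_append[OF p(2)[OF t(1)] Ft(2,1) IH1] Cons by simp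
      have LDt: "D.left_descent (lift_word w) q" if "q \<in> p t" for q
        using D.LD_append[of "Delta_word t" "lift_word w1" q] rw Cons Ft(3)[OF that] that p(2)[OF t(1)] by auto
      have "C.left_descent w s" if s: "s \<in> S" and u: "u \<in> p s" and ld: "D.left_descent (lift_word w) u" for s u
      proof (rule ccontr)
        assume ns: "\<not> C.left_descent w s"
        have ldwt: "C.left_descent w t" using C.LD_Cons[of t w1] less.prems Cons by simp
        then have st: "s \<noteq> t" using ns by blast
        have uS: "u \<in> S'" using u p(2) s by blast
        have "m s t \<noteq> \<infinity>" using infinite_no_LD[OF s t(1) st _ u rw ld LDt] by blast
        then obtain n where n: "m s t = enat n" by auto
        have n': "m t s = enat n" using n C.m_sym s t(1) by simp
        have P: "p s \<union> p t \<subseteq> S'" using p(2) s t(1) by blast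
        obtain d y where y: "d \<in> lists {s, t}" "y \<in> lists S" "C.reduced (d @ y)" "C.act (d @ y) = C.act w"
            "\<And>j. j \<in> {s, t} \<Longrightarrow> \<not> C.left_descent y j"
          using C.parabolic_decomposition[of "{s, t}" S w] s t(1) less.prems C.red_lists[OF less.prems]
          by (metis empty_subsetI insert_subset subset_refl)
        have ry: "C.reduced y" and rd: "C.reduced d" using y(3) C.red_appendD2 C.red_appendD1 by blast+
        have dS: "d \<in> lists S" using C.red_lists rd by blast
        have LDdy: "C.left_descent (d @ y) j \<longleftrightarrow> C.left_descent w j" for j
          using C.LD_cong[OF C.red_lists[OF y(3)] C.red_lists[OF less.prems] y(4)] by simp
        have "d \<noteq> []"
          using LDdy[of t] ldwt y(5)[of t] by auto
        then have ly: "length y < length w"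
          using C.red_length[OF y(3) less.prems y(4)] by (cases d) auto
        \<comment> \<open>As y has neither s nor t as a descent, its lift has no descent in
          \<open>p s\<close> or \<open>p t\<close>; so u must already be a descent of the lift of
          d.\<close>
        have IHy: "D.reduced (lift_word y)" "\<And>q. q \<in> p s \<union> p t \<Longrightarrow> \<not> D.left_descent (lift_word y) q"
          using less.hyps[OF ly ry] y(5) s t(1) by blast+
        have FFd: "lift_word d \<in> lists (p s \<union> p t)" using lift_word_lists[of d "{s, t}"] y(1) s t(1) by simp
        have eqF: "D.act (lift_word d @ lift_word y) = D.act (lift_word w)" using lift_word_act_cong(1)[OF y(3) less.prems y(4)] by simp
        have "D.left_descent (lift_word d @ lift_word y) u"
          using D.LD_cong[OF _ D.red_lists[OF rw] eqF, of u] ld lift_word_lists_S'[OF dS] lift_word_lists_S'[OF y(2)]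
          by simp
        then have ldd: "D.left_descent (lift_word d) u"
          using D.LD_parabolic[OF P FFd lift_word_lists_S'[OF y(2)] IHy(2), of u] u by simp
        have nsd: "\<not> C.left_descent d s" using C.LD_append[OF y(3) s] LDdy[of s] ns by blast
        have "d \<noteq> x @ [a, a] @ z" for x a z using rd C.red_no_square by metis
        then have "d = alt_list s t (length d) \<or> d = alt_list t s (length d)"
          using C.alternating[OF y(1)] by blast
        moreover have "d \<noteq> alt_list s t (length d)"
        proof
          assume a: "d = alt_list s t (length d)"
          obtain j where "length d = Suc j" using \<open>d \<noteq> []\<close> by (cases d) auto
          then have "d = s # alt_list t s j" using a by simp
          then show False using C.LD_Cons rd nsd by metis
        qed
        ultimately have da: "d = alt_list t s (length d)" by blast
        have kn: "length d < n"
        proof (rule ccontr)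
          assume "\<not> ?thesis"
          then have "d = alt_list t s n @ (if even n then alt_list t s (length d - n) else alt_list s t (length d - n))"
            using da C.alt_list_add[of t s n "length d - n"] by simp
          then obtain f where f: "d = alt_list t s n @ f" by blast
          have "C.left_descent (alt_list t s n) s"
            using C.longest_alt_list[OF t(1) s st[symmetric] n'] by (simp add: C.longest_def)
          then show False using C.LD_append[of "alt_list t s n" f s] f rd s nsd by simp
        qed
        \<comment> \<open>f extends d to the alternating word of length n - 1 that begins with t, so
          that s d f is the full alternating word of length n.\<close>
        define k where "k = n - 1 - length d"
        have n1: "n = Suc (length d + k)" using kn k_def by simp
        define f where "f = (if even (length d) then alt_list t s k else alt_list s t k)"
        have a1: "alt_list s t n = s # d @ f"
          using da C.alt_list_add[of t s "length d" k] n1 by (simp add: f_def)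
        have red_all: "D.reduced (Delta_word s @ lift_word d @ lift_word f)"
          using alt_longest[OF s t(1) st n] by (simp add: D.longest_def a1)
        have rdf: "D.reduced (lift_word d @ lift_word f)" using red_all D.red_appendD2 by blast
        have "D.left_descent (lift_word d @ lift_word f) u" using D.LD_append[OF rdf uS ldd] .
        then obtain z where z: "D.reduced (u # z)" "D.act (u # z) = D.act (lift_word d @ lift_word f)"
            "length (lift_word d @ lift_word f) = Suc (length z)"
          using D.LD_exchange[OF rdf uS] by blast
        \<comment> \<open>The Delta of \<open>p s\<close> can be written to end in u, and the lift
          of d f to begin with u; the reduced lift of s d f would then have an expression with the
          square u u.\<close>
        obtain v where v: "D.reduced (v @ [u])" "D.act (v @ [u]) = D.act (Delta_word s)"
          using D.longest_snoc[OF p(2)[OF s] Delta_word_longest[OF s] u] by blast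
        have lv: "length (Delta_word s) = Suc (length v)"
          using D.red_length[OF v(1) _ v(2)] Delta_word_longest[OF s] by (simp add: D.longest_def)
        have a2: "D.act (v @ [u, u] @ z) = D.act (Delta_word s @ lift_word d @ lift_word f)"
          using D.act_cong_append[OF v(2) z(2)] by simp
        have "v @ [u, u] @ z \<in> lists S'" using D.red_lists[OF v(1)] D.red_lists[OF z(1)] by simp
        then have "D.reduced (v @ [u, u] @ z)"
          using D.red_cong[OF red_all _ a2] lv z(3) by simp
        then show False by (rule D.red_no_square)
      qed
      then show ?thesis using rw by blast
    qed
  qed
  then show "D.reduced (lift_word w)" "\<And>s u. s \<in> S \<Longrightarrow> u \<in> p s \<Longrightarrow> D.left_descent (lift_word w) u \<Longrightarrow> C.left_descent w s" by blast+
qed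

lemma normal_form_image:
  assumes nf: "normal_form S m g gs"
  shows "normal_form S' m' (\<phi> g) (map \<phi> gs)"
proof -
  let ?M = "artin_monoid S m" and ?M' = "artin_monoid S' m'"
  have nf1: "list_prod ?M gs = g" "\<one>\<^bsub>?M\<^esub> \<notin> set gs"
    "\<And>i. i < length gs \<Longrightarrow> is_alpha S m (list_prod ?M (drop i gs)) (gs ! i)"
    using nf by (auto simp: normal_form_def Let_def)
  have "\<exists>w. C.reduced w \<and> C.E w = x" if "x \<in> set gs" for x
  proof -
    obtain i where "i < length gs" "x = gs ! i" using \<open>x \<in> set gs\<close> by (metis in_set_conv_nth)
    then have "x \<in> reduced_elements S m" using nf1(3) by (auto simp: is_alpha_def Let_def)
    then show ?thesis by (auto simp: C.reduced_elements_E)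
  qed
  then obtain W where W: "\<And>x. x \<in> set gs \<Longrightarrow> C.reduced (W x) \<and> C.E (W x) = x" by metis
  define as where "as = map W gs"
  have gs: "gs = map C.E as" using W by (simp add: as_def map_idI)
  have ra: "C.reduced a" if "a \<in> set as" for a using that W by (auto simp: as_def)
  have aS: "a \<in> lists S" if "a \<in> set as" for a using ra C.red_lists that by blast
  have lp: "list_prod ?M (drop i gs) = C.E (concat (drop i as))" for i
    unfolding gs drop_map using aS by (intro C.list_prod_E) (auto dest: in_set_dropD)
  define bs where "bs = map lift_word as"
  have bE: "map \<phi> gs = map D.E bs"
    using aS \<phi>_E by (simp add: gs bs_def)
  have chain: "D.normal_chain bs"
  proof (rule D.normal_chain_nth)
    show "D.reduced (bs ! i)" if "i < length bs" for i using that red_lift_word(1) ra by (simp add: bs_def)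
    show "\<not> D.nn (D.act (bs ! i) (D.e q))"
      if i: "Suc i < length bs" and q: "q \<in> S'" and ld: "D.left_descent (bs ! Suc i) q" for i q
    proof -
      define a b where "a = as ! i" and "b = as ! Suc i"
      have ab: "C.reduced a" "C.reduced b" "bs ! i = lift_word a" "bs ! Suc i = lift_word b" "i < length as" "Suc i < length as"
        using i ra by (auto simp: bs_def a_def b_def)
      have abS: "a \<in> lists S" "b \<in> lists S" using ab C.red_lists by auto
      have pS: "(\<Union>s\<in>S. p s) \<subseteq> S'" using p(2) by blast
      have "D.left_descent (lift_word b) q" using ld ab(4) by simp
      then have "q \<in> (\<Union>s\<in>S. p s)"
        by (rule D.LD_letter[OF lift_word_lists[OF abS(2) subset_refl] pS q])
      then obtain s where s: "s \<in> S" "q \<in> p s" by blast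
      have lds: "C.left_descent b s" using red_lift_word(2)[OF ab(2) s] ld ab by simp
      have dr: "drop i as = a # b # drop (Suc (Suc i)) as"
        using ab(5,6) by (simp add: Cons_nth_drop_Suc a_def b_def)
      \<comment> \<open>Otherwise a s would be a reduced divisor of the tail product and longer than
        a, its greatest reduced divisor.\<close>
      have "\<not> C.reduced (a @ [s])"
      proof
        assume r: "C.reduced (a @ [s])"
        obtain b' where b': "C.reduced (s # b')" "C.act (s # b') = C.act b"
          using C.LD_exchange[OF ab(2) s(1) lds] by blast
        have b'S: "b' \<in> lists S" using C.red_lists[OF b'(1)] by simp
        define c where "c = concat (drop (Suc (Suc i)) as)"
        have cS: "c \<in> lists S"
          unfolding c_def by (rule concat_lists) (use aS in_set_dropD in fast)
        have "C.E b = C.E (s # b')" using C.E_matsumoto[OF b'(1) ab(2) b'(2)] by simp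
        then have "C.E (b @ c) = C.E ((s # b') @ c)"
          using abS b'S cS s by (intro C.E_append_cong) simp_all
        then have "C.E (a @ b @ c) = C.E (a @ (s # b') @ c)"
          using C.E_append_cong[of a a "b @ c" "(s # b') @ c"] abS b'S cS s by simp
        then have "C.E (concat (drop i as)) = C.E ((a @ [s]) @ b' @ c)"
          by (simp add: dr c_def)
        then have "C.E (a @ [s]) divides\<^bsub>?M\<^esub> C.E (concat (drop i as))"
          using C.divides_E[of "a @ [s]"] abS b'S cS s by (metis append_in_lists_conv lists.simps)
        moreover have "is_alpha S m (C.E (concat (drop i as))) (C.E a)"
          using nf1(3)[of i] lp[of i] ab(5) by (simp add: gs a_def)
        moreover have "C.E (a @ [s]) \<in> reduced_elements S m" using r by (simp add: C.reduced_elements_E)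
        ultimately have "C.E (a @ [s]) divides\<^bsub>?M\<^esub> C.E a" by (simp add: is_alpha_def Let_def)
        then obtain x where "x \<in> lists S" "C.E a = C.E ((a @ [s]) @ x)"
          using C.divides_E[of "a @ [s]"] abS s by auto
        then show False using C.E_length[OF abS(1)] by fastforce
      qed
      then obtain a' where a': "C.reduced (a' @ [s])" "C.act (a' @ [s]) = C.act a"
        using C.red_snoc_cases[OF ab(1) s(1)] by metis
      have a'S: "a' \<in> lists S" using C.red_lists[OF a'(1)] by simp
      \<comment> \<open>The lift of a can be written to end in the Delta of \<open>p s\<close>,
        which can itself be written to end in q. Hence q is a right descent of the lift.\<close>
      obtain v where v: "D.reduced (v @ [q])" "D.act (v @ [q]) = D.act (Delta_word s)"
        using D.longest_snoc[OF p(2)[OF s(1)] Delta_word_longest[OF s(1)] s(2)] by blast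
      have lv: "length (Delta_word s) = Suc (length v)"
        using D.red_length[OF v(1) _ v(2)] Delta_word_longest[OF s(1)] by (simp add: D.longest_def)
      have rF: "D.reduced (lift_word a)" using red_lift_word(1) ab by blast
      have vS: "v \<in> lists S'" using D.red_lists[OF v(1)] by simp
      have "D.act (lift_word a' @ v @ [q]) = D.act (lift_word a' @ Delta_word s)"
        by (rule D.act_cong_append[OF _ v(2)]) simp
      also have "\<dots> = D.act (lift_word a)" using lift_word_act_cong(1)[OF a'(1) ab(1) a'(2)] by simp
      finally have ac: "D.act ((lift_word a' @ v) @ [q]) = D.act (lift_word a)" by simp
      have len: "length ((lift_word a' @ v) @ [q]) = length (lift_word a)"
        using lift_word_act_cong(2)[OF a'(1) ab(1) a'(2)] lv by simp
      show ?thesis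
      proof
        assume "D.nn (D.act (bs ! i) (D.e q))"
        then have raq: "D.reduced (lift_word a @ [q])" using D.red_snoc_iff[OF rF q] ab by simp
        have "D.act (lift_word a' @ v) = D.act (lift_word a @ [q])"
          using ac q by (simp add: D.act_eq_iff) (metis D.refl_refl)
        then have "length (lift_word a @ [q]) \<le> length (lift_word a' @ v)"
          using D.red_le[OF raq, of "lift_word a' @ v"] lift_word_lists_S'[OF a'S] vS by simp
        then show False using len by simp
      qed
    qed
  qed
  have bS: "b \<in> lists S'" if "b \<in> set bs" for b
  proof -
    obtain a where "a \<in> set as" "b = lift_word a" using \<open>b \<in> set bs\<close> by (auto simp: bs_def)
    then show ?thesis using lift_word_lists_S'[OF aS] by simp
  qed
  have lp': "list_prod ?M' (drop i (map \<phi> gs)) = D.E (concat (drop i bs))" for i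
    unfolding bE drop_map using bS by (intro D.list_prod_E) (auto dest: in_set_dropD)
  have FFc: "lift_word (concat xs) = concat (map lift_word xs)" for xs by (induction xs) simp_all
  show ?thesis
    unfolding normal_form_def Let_def
  proof (intro conjI allI impI)
    show "set (map \<phi> gs) \<subseteq> carrier ?M'"
      unfolding bE using bS by (auto simp: D.artin_monoid_carrier)
    have "g = C.E (concat as)" using nf1(1) lp[of 0] by simp
    moreover have "concat as \<in> lists S" using aS by (rule concat_lists)
    ultimately have "\<phi> g = D.E (concat bs)" using \<phi>_E FFc by (simp add: bs_def)
    then show "list_prod ?M' (map \<phi> gs) = \<phi> g" using lp'[of 0] by simp
    show "\<one>\<^bsub>?M'\<^esub> \<notin> set (map \<phi> gs)"
    proof
      assume "\<one>\<^bsub>?M'\<^esub> \<in> set (map \<phi> gs)"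
      then obtain a where a: "a \<in> set as" "D.E (lift_word a) = D.E []"
        unfolding bE by (auto simp: D.monoid_one bs_def)
      then have "length (lift_word a) = 0" using D.E_length[OF lift_word_lists_S'[OF aS[OF a(1)]]] by fastforce
      then have "a = []" using aS[OF a(1)] Delta_word_nonempty by (cases a) auto
      then show False using nf1(2) a(1) by (auto simp: gs C.monoid_one)
    qed
    fix i assume i: "i < length (map \<phi> gs)"
    then have il: "i < length bs" by (simp add: gs bs_def)
    have "drop i bs = bs ! i # drop (Suc i) bs" using il by (simp add: Cons_nth_drop_Suc)
    then have "is_alpha S' m' (D.E (concat (drop i bs))) (D.E (bs ! i))"
      using D.is_alpha_normal_chain D.normal_chain_drop[OF chain, of i] by metis
    then show "is_alpha S' m' (list_prod ?M' (drop i (map \<phi> gs))) (map \<phi> gs ! i)"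
      unfolding lp' using il by (simp add: bE del: map_map)
  qed
qed

end

theorem mainTheorem2:
  fixes S :: "'s set" and m :: "'s \<Rightarrow> 's \<Rightarrow> enat"
    and S' :: "'t set" and m' :: "'t \<Rightarrow> 't \<Rightarrow> enat"
    and p :: "'s \<Rightarrow> 't set" and \<phi> :: "'s signed_word set \<Rightarrow> 't signed_word set"
    and g :: "'s signed_word set" and gs :: "'s signed_word set list"
  assumes "coxeter_matrix S m"
    and "coxeter_matrix S' m'"
    and "lcm_homomorphism S m S' m' p \<phi>"
    and "g \<in> carrier (artin_monoid S m)"
    and "normal_form S m g gs"
  shows "normal_form S' m' (\<phi> g) (map \<phi> gs)"
proof -
  interpret lcm_morphism S m S' m' p \<phi>
    using assms(1-3)
    by (simp add: lcm_morphism_def lcm_morphism_axioms_def coxeter_system_def lcm_homomorphism_def)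
  show ?thesis using normal_form_image assms(5) .
qed

end
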